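(* There exist absolute constants $C,c>0$ and a function $\delta:\mathbb{N}\to[0,1]$ with $\delta(n)\to 0$ as $n\to\infty$ such that the following holds. Let $n\ge 2$ be an integer, $k_1,k_2\in[0,n]$ and $\varepsilon\in(0,1)$ satisfy $$k_1+k_2 > n + C\log^3(n/\varepsilon),$$ and let $$m=\Big\lfloor(1-\delta(n))\max(k_1,k_2)+\tfrac16\,(k_1+k_2-n)-9\log\varepsilon^{-1}-c\Big\rfloor .$$ If $m\ge 1$, then the DEOR-construction (see context) gives an explicit function $E:\{0,1\}^n\times\{0,1\}^n\to\{0,1\}^m$ that is a $(k_1,k_2,\varepsilon)$ two-source extractor against quantum knowledge.
   Context: Logarithms are base 2. For a matrix $A$, $|A|_{\mathrm{tr}}=\frac12\mathrm{Tr}\sqrt{A^\dagger A}$. $U_m$ is the uniform distribution on $\{0,1\}^m$ (identified with the maximally mixed state). Guessing entropy: for a random variable $X$ and density matrices $\{\rho_x\}$, $H_g(X\leftarrow\rho_X)=-\log\max_M\mathbb{E}_{x\leftarrow X}[\mathrm{Tr}(M_x\rho_x)]$, the maximum being over all POVMs $M=\{M_x\}$ indexed by the values of $X$. $E:\{0,1\}^n\times\{0,1\}^n\to\{0,1\}^m$ is a $(k_1,k_2,\varepsilon)$ two-source extractor against quantum knowledge if for all independent $n$-bit sources $X,Y$ and all families of states $\{\rho_x\},\{\rho_y\}$ with $H_g(X\leftarrow\rho_X)\ge k_1$ and $H_g(Y\leftarrow\rho_Y)\ge k_2$, $$\Big|\sum_{x,y}p(x)p(y)\,|E(x,y)\rangle\langle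 E(x,y)|\otimes\rho_x\otimes\rho_y-U_m\otimes\sum_{x,y}p(x)p(y)\rho_x\otimes\rho_y\Big|_{\mathrm{tr}}\le\varepsilon .$$ DEOR-construction. Let $A_1,\dots,A_n$ be an efficiently computable set of $n\times n$ matrices over $GF(2)$ such that $\sum_{i\in S}A_i$ has full rank for every nonempty $S\subseteq[n]$ (such a set exists by Dodis et al.). For $\ell\le n$ let $E_D:\{0,1\}^n\times\{0,1\}^n\to\{0,1\}^\ell$, $E_D(x,y)=(A_1x\cdot y,\dots,A_\ell x\cdot y)$, where $x\cdot y=\sum_j x_jy_j \bmod 2$. The construction is $E(x,y)=E_S(x,E_D(x,y))$ or $E(x,y)=E_S(y,E_D(x,y))$ (whichever gives better parameters), possibly truncated to $m$ bits, where $E_S$ is the explicit seeded extractor of De, Portmann, Vidick and Renner. A function $E_S:\{0,1\}^n\times\{0,1\}^d\to\{0,1\}^{m'}$ is a $(k,\varepsilon')$ seeded extractor against quantum knowledge if for every $n$-bit source $X$ and states $\{\rho_x\}$ with $H_g(X\leftarrow\rho_X)\ge k$, $|\sum_x p(x)\,\mathbb{E}_{u\in\{0,1\}^d}|E_S(x,u)\rangle\langle E_S(x,u)|\otimes\rho_x-U_{m'}\otimes\sum_xp(x)\rho_x|_{\mathrm{tr}}\le\varepsilon'$. The extractor of De et al. is an explicit $(k,\varepsilon')$ seeded extractor against quantum knowledge with seed length $d=O(\log^3(n/\varepsilon'))$ and $m'=d+k-8\log k-8\log\varepsilon'^{-1}-O(1)$ output bits; it may be used with a longer seed by copying the surplus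 seed bits to the output. *)

theory Defs
  imports
    "HOL-Probability.Probability_Mass_Function"
    "HOL-Library.Z2"
    "Jordan_Normal_Form.Schur_Decomposition"
    "Jordan_Normal_Form.DL_Rank"
begin

section \<open>Bit strings and quantum states\<close>

definition bits :: "nat \<Rightarrow> bit list set" where
  "bits n = {x. length x = n}"

definition mat_sum :: "nat \<Rightarrow> ('i \<Rightarrow> 'a::comm_monoid_add mat) \<Rightarrow> 'i set \<Rightarrow> 'a mat" where
  "mat_sum D F S = Matrix.mat D D (\<lambda>(i, j). \<Sum>s\<in>S. F s $$ (i, j))"

definition mat_trace :: "'a::comm_monoid_add mat \<Rightarrow> 'a" where
  "mat_trace A = (\<Sum>i<dim_row A. A $$ (i, i))"

definition kron :: "complex mat \<Rightarrow> complex mat \<Rightarrow> complex mat" (infixr "\<otimes>\<^sub>m" 75) where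
  "A \<otimes>\<^sub>m B = Matrix.mat (dim_row A * dim_row B) (dim_col A * dim_col B)
     (\<lambda>(i, j). A $$ (i div dim_row B, j div dim_col B) * B $$ (i mod dim_row B, j mod dim_col B))"

text \<open>The order on \<^typ>\<open>complex\<close> is that of \<^theory>\<open>HOL-Library.Complex_Order\<close>: \<open>0 \<le> z\<close>
  says that \<open>z\<close> is real and nonnegative, so positive semidefinite matrices are Hermitian.\<close>

definition psd :: "nat \<Rightarrow> complex mat \<Rightarrow> bool" where
  "psd D A \<longleftrightarrow> A \<in> carrier_mat D D \<and> (\<forall>v\<in>carrier_vec D. 0 \<le> (A *\<^sub>v v) \<bullet>c v)"

definition psd_sqrt :: "complex mat \<Rightarrow> complex mat" where
  "psd_sqrt A = (THE B. psd (dim_row A) B \<and> B * B = A)"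

definition tr_norm :: "complex mat \<Rightarrow> real" where
  "tr_norm A = 1/2 * Re (mat_trace (psd_sqrt (mat_adjoint A * A)))"

definition density :: "nat \<Rightarrow> complex mat \<Rightarrow> bool" where
  "density D \<rho> \<longleftrightarrow> psd D \<rho> \<and> mat_trace \<rho> = 1"

fun bit_index :: "bit list \<Rightarrow> nat" where
  "bit_index [] = 0"
| "bit_index (b # s) = of_bool (b = 1) * 2 ^ length s + bit_index s"

text \<open>The projector \<open>|s\<rangle>\<langle>s|\<close> onto a computational basis state of \<open>length s\<close> qubits.\<close>

definition ket_bra :: "bit list \<Rightarrow> complex mat" where
  "ket_bra s = Matrix.mat (2 ^ length s) (2 ^ length s)
     (\<lambda>(i, j). of_bool (i = bit_index s \<and> j = bit_index s))"

definition max_mixed :: "nat \<Rightarrow> complex mat" where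
  "max_mixed m = (1 / 2 ^ m) \<cdot>\<^sub>m 1\<^sub>m (2 ^ m)"


section \<open>Guessing entropy and extractors\<close>

definition bit_source :: "nat \<Rightarrow> bit list pmf \<Rightarrow> bool" where
  "bit_source n X \<longleftrightarrow> set_pmf X \<subseteq> bits n"

definition povm :: "nat \<Rightarrow> nat \<Rightarrow> (bit list \<Rightarrow> complex mat) \<Rightarrow> bool" where
  "povm n D M \<longleftrightarrow> (\<forall>x\<in>bits n. psd D (M x)) \<and> mat_sum D M (bits n) = 1\<^sub>m D"

text \<open>The supremum is attained, since the POVMs form a compact set.\<close>

definition guess_entropy :: "nat \<Rightarrow> nat \<Rightarrow> bit list pmf \<Rightarrow> (bit list \<Rightarrow> complex mat) \<Rightarrow> real" where
  "guess_entropy n D X \<rho> =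
     - log 2 (Sup {\<Sum>x\<in>bits n. pmf X x * Re (mat_trace (M x * \<rho> x)) | M. povm n D M})"

definition two_source_extractor ::
  "nat \<Rightarrow> nat \<Rightarrow> real \<Rightarrow> real \<Rightarrow> real \<Rightarrow> (bit list \<Rightarrow> bit list \<Rightarrow> bit list) \<Rightarrow> bool" where
  "two_source_extractor n m k1 k2 \<epsilon> E \<longleftrightarrow>
     (\<forall>x\<in>bits n. \<forall>y\<in>bits n. E x y \<in> bits m) \<and>
     (\<forall>X Y D1 D2 \<rho> \<sigma>.
        bit_source n X \<and> bit_source n Y \<and>
        (\<forall>x\<in>bits n. density D1 (\<rho> x)) \<and> (\<forall>y\<in>bits n. density D2 (\<sigma> y)) \<and>
        guess_entropy n D1 X \<rho> \<ge> k1 \<and> guess_entropy n D2 Y \<sigma> \<ge> k2 \<longrightarrow>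
        tr_norm
          (mat_sum (2 ^ m * (D1 * D2))
             (\<lambda>(x, y). complex_of_real (pmf X x * pmf Y y) \<cdot>\<^sub>m (ket_bra (E x y) \<otimes>\<^sub>m \<rho> x \<otimes>\<^sub>m \<sigma> y))
             (bits n \<times> bits n)
           - max_mixed m \<otimes>\<^sub>m
             mat_sum (D1 * D2)
               (\<lambda>(x, y). complex_of_real (pmf X x * pmf Y y) \<cdot>\<^sub>m (\<rho> x \<otimes>\<^sub>m \<sigma> y))
               (bits n \<times> bits n)) \<le> \<epsilon>)"

definition seeded_extractor ::
  "nat \<Rightarrow> nat \<Rightarrow> nat \<Rightarrow> real \<Rightarrow> real \<Rightarrow> (bit list \<Rightarrow> bit list \<Rightarrow> bit list) \<Rightarrow> bool" where
  "seeded_extractor n d m k \<epsilon> F \<longleftrightarrow>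
     (\<forall>x\<in>bits n. \<forall>u\<in>bits d. F x u \<in> bits m) \<and>
     (\<forall>X D \<rho>.
        bit_source n X \<and> (\<forall>x\<in>bits n. density D (\<rho> x)) \<and> guess_entropy n D X \<rho> \<ge> k \<longrightarrow>
        tr_norm
          (mat_sum (2 ^ m * D)
             (\<lambda>(x, u). complex_of_real (pmf X x / 2 ^ d) \<cdot>\<^sub>m (ket_bra (F x u) \<otimes>\<^sub>m \<rho> x))
             (bits n \<times> bits d)
           - max_mixed m \<otimes>\<^sub>m
             mat_sum D (\<lambda>x. complex_of_real (pmf X x) \<cdot>\<^sub>m \<rho> x) (bits n)) \<le> \<epsilon>)"


section \<open>Polynomial time\<close>

text \<open>Machines with finitely many binary stacks and unit-cost stack operations. Two stacks simulate
  a Turing machine tape, so up to constant factors running times are those of multitape Turing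
  machines. \<open>runs p s t s'\<close> says that \<open>p\<close> takes the stacks \<open>s\<close> to \<open>s'\<close> in \<open>t\<close> steps.\<close>

datatype prog =
    Skip
  | Push nat bit
  | Pop nat
  | Seq prog prog
  | Branch nat prog prog prog
  | While nat prog

inductive runs :: "prog \<Rightarrow> (nat \<Rightarrow> bit list) \<Rightarrow> nat \<Rightarrow> (nat \<Rightarrow> bit list) \<Rightarrow> bool" where
  skip: "runs Skip s 1 s"
| push: "runs (Push r b) s 1 (s(r := b # s r))"
| pop: "runs (Pop r) s 1 (s(r := tl (s r)))"
| seq: "runs p s t s' \<Longrightarrow> runs q s' t' s'' \<Longrightarrow> runs (Seq p q) s (t + t') s''"
| branch_empty: "s r = [] \<Longrightarrow> runs p s t s' \<Longrightarrow> runs (Branch r p q0 q1) s (t + 1) s'"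
| branch_zero: "s r = 0 # w \<Longrightarrow> runs q0 s t s' \<Longrightarrow> runs (Branch r p q0 q1) s (t + 1) s'"
| branch_one: "s r = 1 # w \<Longrightarrow> runs q1 s t s' \<Longrightarrow> runs (Branch r p q0 q1) s (t + 1) s'"
| while_stop: "s r = [] \<Longrightarrow> runs (While r p) s 1 s"
| while_step: "s r \<noteq> [] \<Longrightarrow> runs p s t s' \<Longrightarrow> runs (While r p) s' t' s'' \<Longrightarrow>
    runs (While r p) s (t + t' + 1) s''"

definition load :: "bit list list \<Rightarrow> nat \<Rightarrow> bit list" where
  "load ws r = (if r < length ws then ws ! r else [])"

text \<open>One program maps the input tuple \<open>inp i\<close> to \<open>res i\<close>, for every \<open>i \<in> I\<close>, in time polynomial
  in the total length of \<open>inp i\<close>.\<close>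

definition poly_time :: "'i set \<Rightarrow> ('i \<Rightarrow> bit list list) \<Rightarrow> ('i \<Rightarrow> bit list) \<Rightarrow> bool" where
  "poly_time I inp res \<longleftrightarrow>
     (\<exists>p a b. \<forall>i\<in>I. \<exists>t s.
        runs p (load (inp i)) t s \<and> s 0 = res i \<and>
        t \<le> a * sum_list (map length (inp i)) ^ b + a)"

definition unary :: "nat \<Rightarrow> bit list" where
  "unary n = replicate n 1"


section \<open>The ingredients of the construction\<close>

text \<open>\<open>A n 1, \<dots>, A n n\<close> are the matrices for block length \<open>n\<close>. Efficient computability: their
  entries are listed in time polynomial in \<open>n\<close>.\<close>

definition deor_matrices :: "(nat \<Rightarrow> nat \<Rightarrow> bit mat) \<Rightarrow> bool" where
  "deor_matrices A \<longleftrightarrow>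
     (\<forall>n. (\<forall>i\<in>{1..n}. A n i \<in> carrier_mat n n) \<and>
          (\<forall>S. S \<subseteq> {1..n} \<and> S \<noteq> {} \<longrightarrow> vec_space.rank n (mat_sum n (A n) S) = n)) \<and>
     poly_time UNIV (\<lambda>n. [unary n])
       (\<lambda>n. concat (map (\<lambda>i. concat (map (\<lambda>r. list_of_vec (row (A n i) r)) [0..<n])) [1..<Suc n]))"

text \<open>A family of seeded extractors against quantum knowledge with the guarantees of De, Portmann,
  Vidick and Renner. The parameters are the block length \<open>n\<close>, an integer entropy bound \<open>k\<close> and the
  error \<open>2\<^sup>-\<^sup>e\<close>; integers rather than reals, as they are part of the input of an algorithm. The
  seed length is \<open>d n k e\<close>, the output length \<open>l n k e\<close>, and \<open>a\<close>, \<open>b\<close> are the constants implied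
  by the \<open>O\<close>-notation.\<close>

definition explicit_seeded_extractors ::
  "real \<Rightarrow> real \<Rightarrow> (nat \<Rightarrow> nat \<Rightarrow> nat \<Rightarrow> bit list \<Rightarrow> bit list \<Rightarrow> bit list) \<Rightarrow>
   (nat \<Rightarrow> nat \<Rightarrow> nat \<Rightarrow> nat) \<Rightarrow> (nat \<Rightarrow> nat \<Rightarrow> nat \<Rightarrow> nat) \<Rightarrow> bool" where
  "explicit_seeded_extractors a b ES d l \<longleftrightarrow>
     (\<forall>n k e. 1 \<le> k \<and> k \<le> n \<and> 1 \<le> e \<longrightarrow>
        seeded_extractor n (d n k e) (l n k e) (real k) (1 / 2 ^ e) (ES n k e) \<and>
        real (d n k e) \<le> a * (log 2 (real n * 2 ^ e)) ^ 3 \<and>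
        real (l n k e) \<ge> real (d n k e) + real k - 8 * log 2 (real k) - 8 * real e - b) \<and>
     poly_time {(n, k, e). 1 \<le> k \<and> k \<le> n \<and> 1 \<le> e}
       (\<lambda>(n, k, e). [unary n, unary k, unary e]) (\<lambda>(n, k, e). unary (d n k e)) \<and>
     poly_time {(n, k, e, x, u). 1 \<le> k \<and> k \<le> n \<and> 1 \<le> e \<and> x \<in> bits n \<and> u \<in> bits (d n k e)}
       (\<lambda>(n, k, e, x, u). [unary n, unary k, unary e, x, u]) (\<lambda>(n, k, e, x, u). ES n k e x u)"


section \<open>The construction\<close>

definition E_D :: "(nat \<Rightarrow> nat \<Rightarrow> bit mat) \<Rightarrow> nat \<Rightarrow> nat \<Rightarrow> bit list \<Rightarrow> bit list \<Rightarrow> bit list" where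
  "E_D A n L x y = map (\<lambda>i. scalar_prod (A n i *\<^sub>v vec_of_list x) (vec_of_list y)) [1..<Suc L]"

definition extend_seed ::
  "nat \<Rightarrow> (bit list \<Rightarrow> bit list \<Rightarrow> bit list) \<Rightarrow> bit list \<Rightarrow> bit list \<Rightarrow> bit list" where
  "extend_seed d F x u = F x (take d u) @ drop d u"

text \<open>\<open>L\<close> is the output length of \<^const>\<open>E_D\<close>, and \<open>sw\<close> says to which of the two sources the
  seeded extractor with parameters \<open>k\<close>, \<open>e\<close> is applied.\<close>

definition deor ::
  "(nat \<Rightarrow> nat \<Rightarrow> bit mat) \<Rightarrow> (nat \<Rightarrow> nat \<Rightarrow> nat \<Rightarrow> bit list \<Rightarrow> bit list \<Rightarrow> bit list) \<Rightarrow>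
   (nat \<Rightarrow> nat \<Rightarrow> nat \<Rightarrow> nat) \<Rightarrow> nat \<Rightarrow> nat \<Rightarrow> nat \<Rightarrow> nat \<Rightarrow> bool \<Rightarrow> nat \<Rightarrow>
   bit list \<Rightarrow> bit list \<Rightarrow> bit list" where
  "deor A ES d n k e L sw m x y =
     take m (extend_seed (d n k e) (ES n k e) (if sw then y else x) (E_D A n L x y))"

definition deor_params ::
  "(nat \<Rightarrow> nat \<Rightarrow> nat \<Rightarrow> nat) \<Rightarrow> (nat \<Rightarrow> nat \<Rightarrow> nat \<Rightarrow> nat) \<Rightarrow>
   (nat \<times> nat \<times> nat \<times> nat \<times> bool \<times> nat) set" where
  "deor_params d l = {(n, k, e, L, sw, m). 1 \<le> k \<and> k \<le> n \<and> 1 \<le> e \<and> e \<le> n \<and>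
     d n k e \<le> L \<and> L \<le> n \<and> m \<le> l n k e + (L - d n k e)}"

text \<open>A single algorithm evaluates the construction for all parameters, in time polynomial in \<open>n\<close>
  and the output length \<open>m\<close>: on \<^const>\<open>deor_params\<close> the remaining parameters are at most \<open>n\<close>.\<close>

definition deor_explicit ::
  "(nat \<Rightarrow> nat \<Rightarrow> bit mat) \<Rightarrow> (nat \<Rightarrow> nat \<Rightarrow> nat \<Rightarrow> bit list \<Rightarrow> bit list \<Rightarrow> bit list) \<Rightarrow>
   (nat \<Rightarrow> nat \<Rightarrow> nat \<Rightarrow> nat) \<Rightarrow> (nat \<Rightarrow> nat \<Rightarrow> nat \<Rightarrow> nat) \<Rightarrow> bool" where
  "deor_explicit A ES d l \<longleftrightarrow>
     poly_time {((n, k, e, L, sw, m), x, y).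
         (n, k, e, L, sw, m) \<in> deor_params d l \<and> x \<in> bits n \<and> y \<in> bits n}
       (\<lambda>((n, k, e, L, sw, m), x, y).
         [unary n, unary k, unary e, unary L, [of_bool sw], unary m, x, y])
       (\<lambda>((n, k, e, L, sw, m), x, y). deor A ES d n k e L sw m x y)"

end

theory Submission
  imports Defs
begin

text \<open>For Hermitian \<open>M\<close>, twice the trace norm is the largest \<open>Re tr (M T)\<close> over contractions
  \<open>-1 \<le> T \<le> 1\<close>, so all closeness statements are families of linear inequalities.

  \<open>E\<^sub>D\<close> is a strong extractor: its output is close to uniform given \<open>x\<close> and \<open>\<sigma>\<^sub>y\<close>. Expanding in
  characters, this reduces to bounding \<open>\<Sum>\<^sub>x\<^sub>,\<^sub>y p(x) q(y) (-1)\<^bsup>Bx\<cdot>y\<^esup> tr (\<sigma>\<^sub>y T\<^sub>x)\<close> for nonsingular \<open>B\<close> and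
  contractions \<open>T\<^sub>x\<close>. For \<open>F\<^sub>y = \<Sum>\<^sub>x p(x) (-1)\<^bsup>Bx\<cdot>y\<^esup> T\<^sub>x\<close> orthogonality of the characters gives
  \<open>\<Sum>\<^sub>y F\<^sub>y\<^sup>2 \<le> 2\<^bsup>n - k1\<^esup>\<close>; so the normalised \<open>F\<^sub>y\<^sup>2\<close> form an incomplete POVM guessing \<open>y\<close>, its success
  probability is at most \<open>2\<^bsup>- k2\<^esup>\<close>, and the sum is at most \<open>2\<^bsup>(n - k1 - k2)/2\<^esup>\<close>. With \<open>L\<close> output bits the
  error is \<open>2\<^sup>L\<close> times that. So the seed \<open>E\<^sub>D(x, y)\<close> may be replaced by a uniform one even when \<open>x\<close> is
  kept, and the seeded extractor does the rest; the roles of \<open>x\<close> and \<open>y\<close> are exchanged by transposing \<open>B\<close>.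

  Explicitness: the given programs are run one after another, each on a copy of its arguments in a
  fresh set of stacks.\<close>

text \<open>Independence lets the side information on the two sources be removed one at a time. A
  test on both systems, contracted with the state of the first source, is a test on the second
  system that depends on x; since \<open>E_D\<close> is strong, it fools such tests. Once the seed
  is uniform, the second source is averaged into a test on the first system, and the seeded
  extractor applies. The operators \<open>F y\<close> are signed and cannot serve as measurement
  operators; their squares can, which is why a second moment is estimated. Passing from single
  parities to L output bits sums over all nontrivial characters and costs the factor 2^L, which
  limits L to a fraction of \<kappa> = k1 + k2 - n. The choice \<kappa>/4 keeps the seed error below
  2^(-\<kappa>/4). The seed takes at most \<kappa>/12 of these bits, and the other \<kappa>/6, up to
  rounding, reach the output unchanged: this is the 1/6 in the output length. The given programs may
  use any stack and leave anything behind, and input and output share stack 0; hence they need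
  private stacks, and results have to be carried over explicitly.\<close>

text \<open>These rules turn \<^typ>\<open>bit\<close> arithmetic into bit operations and hide the field structure.\<close>

declare add_bit_eq_xor [simp del] mult_bit_eq_and [simp del]


section \<open>Polynomial-time computations\<close>

text \<open>A single exponent over a base that is at least 2 absorbs multiplicative and additive
  constants, so sums, products and compositions keep the same shape.\<close>

definition poly_bounded :: "'i set \<Rightarrow> ('i \<Rightarrow> nat) \<Rightarrow> ('i \<Rightarrow> nat) \<Rightarrow> bool" where
  "poly_bounded I N T \<longleftrightarrow> (\<exists>c. \<forall>i\<in>I. T i \<le> (N i + 2) ^ c)"

lemma poly_boundedI: "(\<And>i. i \<in> I \<Longrightarrow> T i \<le> (N i + 2) ^ c) \<Longrightarrow> poly_bounded I N T"
  unfolding poly_bounded_def by blast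

lemma poly_bounded_mono:
  assumes "poly_bounded I N T" "\<And>i. i \<in> I \<Longrightarrow> T' i \<le> T i"
  shows "poly_bounded I N T'"
  using assms unfolding poly_bounded_def by (meson order_trans)

lemma poly_bounded_const: "poly_bounded I N (\<lambda>_. a)"
proof (rule poly_boundedI[of _ _ _ a])
  fix i
  have "a \<le> 2 ^ a" by (simp add: less_imp_le)
  also have "(2::nat) ^ a \<le> (N i + 2) ^ a" by (rule power_mono) auto
  finally show "a \<le> (N i + 2) ^ a" .
qed

lemma poly_bounded_size: "poly_bounded I N N"
  by (rule poly_boundedI[of _ _ _ 1]) auto

lemma poly_bounded_add:
  assumes "poly_bounded I N T" "poly_bounded I N T'"
  shows "poly_bounded I N (\<lambda>i. T i + T' i)"
proof -
  obtain c c' where c: "\<And>i. i \<in> I \<Longrightarrow> T i \<le> (N i + 2) ^ c" "\<And>i. i \<in> I \<Longrightarrow> T' i \<le> (N i + 2) ^ c'"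
    using assms unfolding poly_bounded_def by blast
  show ?thesis
  proof (rule poly_boundedI[of _ _ _ "c + c' + 1"])
    fix i assume i: "i \<in> I"
    have "(N i + 2) ^ c \<le> (N i + 2) ^ (c + c')" "(N i + 2) ^ c' \<le> (N i + 2) ^ (c + c')"
      by (rule power_increasing; simp)+
    hence "T i + T' i \<le> 2 * (N i + 2) ^ (c + c')"
      using c[OF i] by linarith
    also have "\<dots> \<le> (N i + 2) ^ (c + c' + 1)"
      by simp
    finally show "T i + T' i \<le> (N i + 2) ^ (c + c' + 1)" .
  qed
qed

lemma poly_bounded_mult:
  assumes "poly_bounded I N T" "poly_bounded I N T'"
  shows "poly_bounded I N (\<lambda>i. T i * T' i)"
proof -
  obtain c c' where c: "\<And>i. i \<in> I \<Longrightarrow> T i \<le> (N i + 2) ^ c" "\<And>i. i \<in> I \<Longrightarrow> T' i \<le> (N i + 2) ^ c'"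
    using assms unfolding poly_bounded_def by blast
  show ?thesis
    by (rule poly_boundedI[of _ _ _ "c + c'"]) (simp add: power_add del: add_2_eq_Suc' add_2_eq_Suc, intro mult_mono c; simp)
qed

text \<open>The time of a called program is bounded in the size of its own input; this turns it into
  a bound in the size of the caller's input.\<close>

lemma poly_bounded_comp:
  assumes T: "poly_bounded I N' T" and N': "poly_bounded I N N'"
  shows "poly_bounded I N T"
proof -
  obtain c where c: "\<And>i. i \<in> I \<Longrightarrow> T i \<le> (N' i + 2) ^ c"
    using T unfolding poly_bounded_def by blast
  obtain c' where c': "\<And>i. i \<in> I \<Longrightarrow> N' i + 2 \<le> (N i + 2) ^ c'"
    using poly_bounded_add[OF N' poly_bounded_const[of _ _ 2]] unfolding poly_bounded_def by blast
  show ?thesis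
  proof (rule poly_boundedI[of _ _ _ "c' * c"])
    fix i assume i: "i \<in> I"
    have "T i \<le> (N' i + 2) ^ c" by (rule c[OF i])
    also have "\<dots> \<le> ((N i + 2) ^ c') ^ c" by (rule power_mono[OF c'[OF i]]) simp
    finally show "T i \<le> (N i + 2) ^ (c' * c)" by (simp add: power_mult)
  qed
qed

lemmas poly_bounded_intros =
  poly_bounded_const poly_bounded_size poly_bounded_add poly_bounded_mult

lemma poly_bounded_power_iff:
  "poly_bounded I N T \<longleftrightarrow> (\<exists>a b. \<forall>i\<in>I. T i \<le> a * N i ^ b + a)"
proof
  assume "poly_bounded I N T"
  then obtain c where c: "\<And>i. i \<in> I \<Longrightarrow> T i \<le> (N i + 2) ^ c"
    unfolding poly_bounded_def by blast
  have "T i \<le> 4 ^ c * N i ^ c + 4 ^ c" if i: "i \<in> I" for i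
  proof -
    have "T i \<le> (4 * max (N i) 1) ^ c"
      by (rule order_trans[OF c[OF i]]) (rule power_mono; simp add: max_def)
    also have "\<dots> \<le> 4 ^ c * N i ^ c + 4 ^ c"
      unfolding power_mult_distrib max_def by (cases "N i") auto
    finally show ?thesis .
  qed
  thus "\<exists>a b. \<forall>i\<in>I. T i \<le> a * N i ^ b + a" by blast
next
  assume "\<exists>a b. \<forall>i\<in>I. T i \<le> a * N i ^ b + a"
  then obtain a b where ab: "\<And>i. i \<in> I \<Longrightarrow> T i \<le> a * N i ^ b + a" by blast
  have "poly_bounded I N (\<lambda>i. N i ^ b)"
    by (rule poly_boundedI[of _ _ _ b]) (rule power_mono; simp)
  hence "poly_bounded I N (\<lambda>i. a * N i ^ b + a)"
    by (intro poly_bounded_intros)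
  thus "poly_bounded I N T" by (rule poly_bounded_mono) (rule ab)
qed

section \<open>Upper bounds on running times\<close>

abbreviation input_size :: "bit list list \<Rightarrow> nat" where
  "input_size ws \<equiv> sum_list (map length ws)"

definition runs_within :: "prog \<Rightarrow> (nat \<Rightarrow> bit list) \<Rightarrow> nat \<Rightarrow> (nat \<Rightarrow> bit list) \<Rightarrow> bool" where
  "runs_within p s T s' \<longleftrightarrow> (\<exists>t\<le>T. runs p s t s')"

lemma runs_within_mono: "runs_within p s T s' \<Longrightarrow> T \<le> T' \<Longrightarrow> s' = s'' \<Longrightarrow> runs_within p s T' s''"
  unfolding runs_within_def by (meson order_trans)

lemma runs_within_seq: "runs_within p s T s' \<Longrightarrow> runs_within q s' T' s'' \<Longrightarrow> runs_within (Seq p q) s (T + T') s''"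
  unfolding runs_within_def by (meson add_mono runs.seq)

lemma runs_within_skip: "runs_within Skip s 1 s"
  unfolding runs_within_def using runs.skip by blast

lemma runs_within_push: "runs_within (Push r b) s 1 (s(r := b # s r))"
  unfolding runs_within_def using runs.push by blast

lemma runs_within_pop: "runs_within (Pop r) s 1 (s(r := tl (s r)))"
  unfolding runs_within_def using runs.pop by blast

lemma runs_within_branch_empty:
  "s r = [] \<Longrightarrow> runs_within p s T s' \<Longrightarrow> runs_within (Branch r p q0 q1) s (T + 1) s'"
  unfolding runs_within_def by (metis add_le_mono1 runs.branch_empty)

lemma runs_within_branch:
  assumes "s r = x # w" "runs_within (if x = 0 then q0 else q1) s T s'"
  shows "runs_within (Branch r p q0 q1) s (T + 1) s'"
proof -
  obtain t where t: "t \<le> T" "runs (if x = 0 then q0 else q1) s t s'"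
    using assms(2) by (auto simp: runs_within_def)
  have "runs (Branch r p q0 q1) s (t + 1) s'"
  proof (cases "x = 0")
    case True
    thus ?thesis using t assms(1) by (intro runs.branch_zero) simp_all
  next
    case False
    thus ?thesis using t assms(1) by (intro runs.branch_one) simp_all
  qed
  thus ?thesis using t(1) by (auto simp: runs_within_def)
qed

text \<open>The loop is described by the explicit trajectory \<open>St\<close> of its states, which
  takes the place of an invariant.\<close>

lemma runs_within_while:
  assumes "\<And>j. j < m \<Longrightarrow> St j r \<noteq> [] \<and> runs_within p (St j) T (St (Suc j))" "St m r = []"
  shows "runs_within (While r p) (St 0) (m * (T + 1) + 1) (St m)"
  using assms
proof (induction m arbitrary: St)
  case 0
  thus ?case using runs.while_stop by (auto simp: runs_within_def)
next
  case (Suc m)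
  have "runs_within (While r p) ((St \<circ> Suc) 0) (m * (T + 1) + 1) ((St \<circ> Suc) m)"
    by (rule Suc.IH) (use Suc.prems in auto)
  then obtain t' where t': "runs (While r p) (St 1) t' (St (Suc m))" "t' \<le> m * (T + 1) + 1"
    by (auto simp: runs_within_def)
  obtain t where t: "runs p (St 0) t (St 1)" "t \<le> T" "St 0 r \<noteq> []"
    using Suc.prems(1)[of 0] by (auto simp: runs_within_def)
  have "runs (While r p) (St 0) (t + t' + 1) (St (Suc m))"
    by (rule runs.while_step[OF t(3,1) t'(1)])
  moreover have "t + t' + 1 \<le> Suc m * (T + 1) + 1"
    using t(2) t'(2) by simp
  ultimately show ?case by (auto simp: runs_within_def)
qed

text \<open>A step lengthens a stack by at most one bit. Hence values computed in polynomial time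
  have polynomial length, as is needed when they become inputs of further programs.\<close>

lemma runs_within_length: "runs_within p s T s' \<Longrightarrow> length (s' r) \<le> length (s r) + T"
proof -
  have "runs p s t s' \<Longrightarrow> length (s' r) \<le> length (s r) + t" for t
    by (induction rule: runs.induct) auto
  thus "runs_within p s T s' \<Longrightarrow> ?thesis" unfolding runs_within_def by fastforce
qed

lemma poly_time_iff:
  "poly_time I inp res \<longleftrightarrow> (\<exists>p T. poly_bounded I (\<lambda>i. input_size (inp i)) T \<and>
     (\<forall>i\<in>I. \<exists>s. runs_within p (load (inp i)) (T i) s \<and> s 0 = res i))"
proof
  assume "poly_time I inp res"
  then obtain p a b where "\<And>i. i \<in> I \<Longrightarrow> \<exists>t s. runs p (load (inp i)) t s \<and> s 0 = res i \<and>
        t \<le> a * input_size (inp i) ^ b + a"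
    unfolding poly_time_def by blast
  hence "\<forall>i\<in>I. \<exists>s. runs_within p (load (inp i)) (a * input_size (inp i) ^ b + a) s \<and> s 0 = res i"
    unfolding runs_within_def by blast
  moreover have "poly_bounded I (\<lambda>i. input_size (inp i)) (\<lambda>i. a * input_size (inp i) ^ b + a)"
    unfolding poly_bounded_power_iff by blast
  ultimately show "\<exists>p T. poly_bounded I (\<lambda>i. input_size (inp i)) T \<and>
     (\<forall>i\<in>I. \<exists>s. runs_within p (load (inp i)) (T i) s \<and> s 0 = res i)" by blast
next
  assume "\<exists>p T. poly_bounded I (\<lambda>i. input_size (inp i)) T \<and>
     (\<forall>i\<in>I. \<exists>s. runs_within p (load (inp i)) (T i) s \<and> s 0 = res i)"
  then obtain p T a b where "\<And>i. i \<in> I \<Longrightarrow> T i \<le> a * input_size (inp i) ^ b + a"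
     "\<And>i. i \<in> I \<Longrightarrow> \<exists>s. runs_within p (load (inp i)) (T i) s \<and> s 0 = res i"
    unfolding poly_bounded_power_iff by blast
  hence "\<And>i. i \<in> I \<Longrightarrow> \<exists>t s. runs p (load (inp i)) t s \<and> s 0 = res i \<and> t \<le> a * input_size (inp i) ^ b + a"
    unfolding runs_within_def by (meson order_trans)
  thus "poly_time I inp res"
    unfolding poly_time_def by blast
qed

lemma poly_timeI:
  assumes "\<And>i. i \<in> I \<Longrightarrow> runs_within p (load (inp i)) (T i) (s i)" "\<And>i. i \<in> I \<Longrightarrow> s i 0 = res i"
    and "poly_bounded I (\<lambda>i. input_size (inp i)) T"
  shows "poly_time I inp res"
  unfolding poly_time_iff using assms by blast

lemma poly_time_reindex:
  assumes "poly_time J inp res" "\<And>i. i \<in> I \<Longrightarrow> \<phi> i \<in> J"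
    "\<And>i. i \<in> I \<Longrightarrow> inp' i = inp (\<phi> i)" "\<And>i. i \<in> I \<Longrightarrow> res' i = res (\<phi> i)"
  shows "poly_time I inp' res'"
proof -
  obtain p a b where "\<And>i. i \<in> J \<Longrightarrow> \<exists>t s. runs p (load (inp i)) t s \<and> s 0 = res i \<and>
        t \<le> a * input_size (inp i) ^ b + a"
    using assms(1) unfolding poly_time_def by blast
  from this[OF assms(2)] show ?thesis
    unfolding poly_time_def using assms(3,4) by (metis (no_types, lifting))
qed

section \<open>Renaming the stacks of a program\<close>

primrec rename :: "(nat \<Rightarrow> nat) \<Rightarrow> prog \<Rightarrow> prog" where
  "rename f Skip = Skip"
| "rename f (Push r b) = Push (f r) b"
| "rename f (Pop r) = Pop (f r)"
| "rename f (Seq p q) = Seq (rename f p) (rename f q)"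
| "rename f (Branch r p q0 q1) = Branch (f r) (rename f p) (rename f q0) (rename f q1)"
| "rename f (While r p) = While (f r) (rename f p)"

text \<open>The stacks in the range of \<open>f\<close> hold the private memory \<open>s\<close> of
  a renamed program, all others the surrounding memory \<open>S\<close>, which the program cannot
  touch.\<close>

definition embed :: "(nat \<Rightarrow> nat) \<Rightarrow> (nat \<Rightarrow> bit list) \<Rightarrow> (nat \<Rightarrow> bit list) \<Rightarrow> nat \<Rightarrow> bit list" where
  "embed f S s r = (if r \<in> range f then s (inv_into UNIV f r) else S r)"

lemma embed_apply [simp]: "inj f \<Longrightarrow> embed f S s (f r) = s r" "r \<notin> range f \<Longrightarrow> embed f S s r = S r"
  by (simp_all add: embed_def)

lemma embed_upd: "inj f \<Longrightarrow> embed f S (s(r := w)) = (embed f S s)(f r := w)"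
  by (rule ext) (auto simp: embed_def)

lemma runs_rename:
  assumes "runs p s t s'" and f: "inj f"
  shows "runs (rename f p) (embed f S s) t (embed f S s')"
  using assms(1)
proof (induction rule: runs.induct)
  case (skip s)
  show ?case using runs.skip by simp
next
  case (push r b s)
  show ?case unfolding rename.simps embed_upd[OF f]
    using runs.push[of "f r" b "embed f S s"] by (simp only: embed_apply(1)[OF f])
next
  case (pop r s)
  show ?case unfolding rename.simps embed_upd[OF f]
    using runs.pop[of "f r" "embed f S s"] by (simp only: embed_apply(1)[OF f])
next
  case seq
  thus ?case by (simp add: runs.seq)
next
  case (branch_empty s r p t s' q0 q1)
  show ?case unfolding rename.simps
    by (rule runs.branch_empty[OF _ branch_empty.IH]) (use branch_empty.hyps f in simp)
next
  case (branch_zero s r w q0 t s' p q1)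
  show ?case unfolding rename.simps
    by (rule runs.branch_zero[OF _ branch_zero.IH]) (use branch_zero.hyps f in simp)
next
  case (branch_one s r w q1 t s' p q0)
  show ?case unfolding rename.simps
    by (rule runs.branch_one[OF _ branch_one.IH]) (use branch_one.hyps f in simp)
next
  case (while_stop s r p)
  show ?case unfolding rename.simps
    by (rule runs.while_stop) (use while_stop f in simp)
next
  case (while_step s r p t s' t' s'')
  show ?case unfolding rename.simps
    by (rule runs.while_step[OF _ while_step.IH(1) while_step.IH(2)[unfolded rename.simps]])
       (use while_step.hyps f in simp)
qed

lemma runs_within_rename:
  "runs_within p s T s' \<Longrightarrow> inj f \<Longrightarrow> runs_within (rename f p) (embed f S s) T (embed f S s')"
  unfolding runs_within_def using runs_rename by blast

section \<open>Moving and copying stacks\<close>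

definition push_all :: "nat list \<Rightarrow> bit \<Rightarrow> prog" where
  "push_all bs x = foldr (\<lambda>b. Seq (Push b x)) bs Skip"

definition pop_bit :: "nat \<Rightarrow> nat list \<Rightarrow> prog" where
  "pop_bit a bs = Branch a Skip (Seq (Pop a) (push_all bs 0)) (Seq (Pop a) (push_all bs 1))"

definition move :: "nat \<Rightarrow> nat list \<Rightarrow> prog" where
  "move a bs = While a (pop_bit a bs)"

lemma runs_within_push_all:
  "distinct bs \<Longrightarrow> runs_within (push_all bs x) s (length bs + 1) (\<lambda>r. if r \<in> set bs then x # s r else s r)"
proof (induction bs arbitrary: s)
  case Nil
  show ?case using runs_within_skip[of s] by (simp add: push_all_def)
next
  case (Cons b bs)
  have *: "push_all (b # bs) x = Seq (Push b x) (push_all bs x)" by (simp add: push_all_def)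
  show ?case unfolding *
    by (rule runs_within_mono[OF runs_within_seq[OF runs_within_push Cons.IH]]) (use Cons.prems in auto)
qed

lemma runs_within_pop_bit:
  assumes "s a = x # w" "a \<notin> set bs" "distinct bs"
  shows "runs_within (pop_bit a bs) s (length bs + 3)
    (\<lambda>r. if r = a then w else if r \<in> set bs then x # s r else s r)"
proof -
  have "runs_within (Seq (Pop a) (push_all bs x)) s (length bs + 2)
      (\<lambda>r. if r = a then w else if r \<in> set bs then x # s r else s r)"
    by (rule runs_within_mono[OF runs_within_seq[OF runs_within_pop runs_within_push_all]]) (use assms in auto)
  hence "runs_within (pop_bit a bs) s (length bs + 2 + 1)
      (\<lambda>r. if r = a then w else if r \<in> set bs then x # s r else s r)"
    unfolding pop_bit_def by (intro runs_within_branch[of s a x w, OF assms(1)]) (cases x, auto)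
  thus ?thesis by (rule runs_within_mono) simp_all
qed

text \<open>Popping one stack and pushing onto others reverses the word. Transfers and copies that
  keep the order therefore pass through the empty stack \<open>tmp\<close> and reverse
  twice.\<close>

lemma runs_within_move:
  assumes "a \<notin> set bs" "distinct bs"
  shows "runs_within (move a bs) s (length (s a) * (length bs + 4) + 1)
    (\<lambda>r. if r = a then [] else if r \<in> set bs then rev (s a) @ s r else s r)"
proof -
  define St where "St j r = (if r = a then drop j (s a) else if r \<in> set bs then rev (take j (s a)) @ s r else s r)" for j r
  have "runs_within (While a (pop_bit a bs)) (St 0) (length (s a) * ((length bs + 3) + 1) + 1) (St (length (s a)))"
  proof (rule runs_within_while)
    fix j assume j: "j < length (s a)"
    have "runs_within (pop_bit a bs) (St j) (length bs + 3) (St (Suc j))"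
      by (rule runs_within_mono[OF runs_within_pop_bit[where x = "s a ! j" and w = "drop (Suc j) (s a)"]])
         (use j assms in \<open>auto simp: St_def fun_eq_iff Cons_nth_drop_Suc take_Suc_conv_app_nth\<close>)
    thus "St j a \<noteq> [] \<and> runs_within (pop_bit a bs) (St j) (length bs + 3) (St (Suc j))"
      using j by (simp add: St_def)
  qed (simp add: St_def)
  moreover have "St 0 = s" by (auto simp: St_def)
  ultimately have "runs_within (While a (pop_bit a bs)) s (length (s a) * ((length bs + 3) + 1) + 1) (St (length (s a)))"
    by simp
  thus ?thesis unfolding move_def
    by (rule runs_within_mono) (auto simp: St_def)
qed

definition clear :: "nat \<Rightarrow> prog" where
  "clear a = move a []"

lemma runs_within_clear: "runs_within (clear a) s (4 * length (s a) + 1) (s(a := []))"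
  unfolding clear_def by (rule runs_within_mono[OF runs_within_move]) auto

definition transfer_reg :: "nat \<Rightarrow> nat \<Rightarrow> nat \<Rightarrow> prog" where
  "transfer_reg tmp a b = Seq (move a [tmp]) (move tmp [b])"

lemma runs_within_transfer_reg:
  assumes "a \<noteq> tmp" "b \<noteq> tmp" "a \<noteq> b" "s tmp = []"
  shows "runs_within (transfer_reg tmp a b) s (10 * length (s a) + 2) (s(a := [], b := s a @ s b))"
  unfolding transfer_reg_def
  by (rule runs_within_mono[OF runs_within_seq[OF runs_within_move runs_within_move]])
     (use assms in \<open>auto simp: fun_eq_iff\<close>)

definition copy_reg :: "nat \<Rightarrow> nat \<Rightarrow> nat \<Rightarrow> prog" where
  "copy_reg tmp a b = Seq (move a [tmp]) (move tmp [a, b])"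

lemma runs_within_copy_reg:
  assumes "a \<noteq> tmp" "b \<noteq> tmp" "a \<noteq> b" "s tmp = []"
  shows "runs_within (copy_reg tmp a b) s (11 * length (s a) + 2) (s(b := s a @ s b))"
  unfolding copy_reg_def
  by (rule runs_within_mono[OF runs_within_seq[OF runs_within_move runs_within_move]])
     (use assms in \<open>auto simp: fun_eq_iff\<close>)

primrec copy_regs :: "nat \<Rightarrow> (nat \<Rightarrow> nat) \<Rightarrow> nat list \<Rightarrow> prog" where
  "copy_regs tmp f [] = Skip"
| "copy_regs tmp f (j # js) = Seq (copy_reg tmp j (f 0)) (copy_regs tmp (f \<circ> Suc) js)"

lemma runs_within_copy_regs:
  assumes "inj f" "\<And>j. j \<in> set js \<Longrightarrow> j \<noteq> tmp \<and> j \<notin> range f" "tmp \<notin> range f"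
    "s tmp = []" "\<And>i. s (f i) = []"
  shows "runs_within (copy_regs tmp f js) s (11 * input_size (map s js) + 2 * length js + 1)
    (embed f s (load (map s js)))"
  using assms
proof (induction js arbitrary: f s)
  case Nil
  have "s = embed f s (load [])"
    using Nil by (auto simp: embed_def load_def fun_eq_iff)
  thus ?case using runs_within_skip[of s] by simp
next
  case (Cons j js)
  let ?s = "s(f 0 := s j @ s (f 0))"
  have f: "f (Suc i) \<noteq> f 0" for i
    using Cons.prems(1) by (auto dest: injD)
  have j: "j \<noteq> tmp" "tmp \<notin> range f" "j \<notin> range f"
    using Cons.prems by auto
  have r: "runs_within (copy_reg tmp j (f 0)) s (11 * length (s j) + 2) ?s"
    by (rule runs_within_copy_reg) (use Cons.prems j in auto)
  have inj: "inj (f \<circ> Suc)" by (intro inj_compose Cons.prems) simp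
  have js: "map ?s js = map s js"
    using Cons.prems(2) by (auto intro!: map_cong)
  have "runs_within (copy_regs tmp (f \<circ> Suc) js) ?s (11 * input_size (map ?s js) + 2 * length js + 1)
      (embed (f \<circ> Suc) ?s (load (map ?s js)))"
    by (rule Cons.IH[OF inj]) (use Cons.prems j f in \<open>auto simp: image_iff\<close>)
  moreover have "embed (f \<circ> Suc) ?s (load (map s js)) = embed f s (load (map s (j # js)))"
  proof
    fix r
    consider "r = f 0" | i where "r = f (Suc i)" | "r \<notin> range f"
      by (metis image_iff not0_implies_Suc)
    thus "embed (f \<circ> Suc) ?s (load (map s js)) r = embed f s (load (map s (j # js))) r"
    proof cases
      case 1
      hence "r \<notin> range (f \<circ> Suc)" using f by (auto simp: image_iff) metis
      thus ?thesis using 1 Cons.prems by (simp add: load_def)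
    next
      case (2 i)
      have "embed (f \<circ> Suc) ?s (load (map s js)) ((f \<circ> Suc) i) = load (map s js) i"
        using inj by (rule embed_apply)
      thus ?thesis using 2 Cons.prems by (simp add: load_def)
    next
      case 3
      moreover from this have "r \<notin> range (f \<circ> Suc)" "r \<noteq> f 0" by auto
      ultimately show ?thesis by simp
    qed
  qed
  ultimately have "runs_within (copy_regs tmp (f \<circ> Suc) js) ?s (11 * input_size (map s js) + 2 * length js + 1)
      (embed f s (load (map s (j # js))))" unfolding js by simp
  from runs_within_seq[OF r this] show ?case
    unfolding copy_regs.simps by (rule runs_within_mono) auto
qed

section \<open>Subroutine calls\<close>

lemma map_load: "length ws = k \<Longrightarrow> map (load ws) [0..<k] = ws"
  by (auto simp: load_def intro: nth_equalityI)

lemma load_ge: "length ws \<le> r \<Longrightarrow> load ws r = []"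
  by (simp add: load_def)

lemma load_simps [simp]:
  "load (w # ws) 0 = w" "load (w # ws) (Suc r) = load ws r" "load [] r = []"
  "load (w # ws) (numeral k) = load ws (pred_numeral k)"
  by (simp_all add: load_def numeral_eq_Suc)

lemma load_length_le: "length (load ws r) \<le> input_size ws"
  by (auto simp: load_def intro!: member_le_sum_list)

text \<open>The arguments are copied, so the caller keeps them; the callee finds them in
  \<open>f 0\<close>, \<open>f 1\<close>, and so on, as \<open>load\<close> requires. What it leaves
  behind stays in the range of \<open>f\<close>, so a second call needs another range.\<close>

definition call :: "prog \<Rightarrow> nat \<Rightarrow> (nat \<Rightarrow> nat) \<Rightarrow> nat list \<Rightarrow> nat \<Rightarrow> prog" where
  "call p tmp f js b =
     Seq (copy_regs tmp f js) (Seq (rename f p) (Seq (clear b) (transfer_reg tmp (f 0) b)))"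

lemma runs_within_call:
  assumes p: "runs_within p (load (map s js)) T s'"
    and f: "inj f" "\<And>j. j \<in> set js \<Longrightarrow> j \<noteq> tmp \<and> j \<notin> range f" "tmp \<notin> range f" "b \<notin> range f" "b \<noteq> tmp"
    and s: "s tmp = []" "\<And>i. s (f i) = []"
  obtains S where "runs_within (call p tmp f js b) s
      (21 * input_size (map s js) + 2 * length js + 11 * T + 4 * length (s b) + 4) S"
    "S b = s' 0" "\<And>r. r \<notin> range f \<Longrightarrow> r \<noteq> b \<Longrightarrow> S r = s r"
proof -
  let ?S = "embed f s s'"
  let ?S' = "?S(b := [])"
  have ne: "f 0 \<noteq> tmp" "f 0 \<noteq> b" using f(3,4) by auto
  have r1: "runs_within (transfer_reg tmp (f 0) b) ?S' (10 * length (?S' (f 0)) + 2)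
      (?S'(f 0 := [], b := ?S' (f 0) @ ?S' b))"
    by (rule runs_within_transfer_reg) (use ne f s in auto)
  have "length (s' 0) \<le> input_size (map s js) + T"
    using runs_within_length[OF p, of 0] load_length_le[of "map s js" 0] by linarith
  hence "runs_within (call p tmp f js b) s
      (21 * input_size (map s js) + 2 * length js + 11 * T + 4 * length (s b) + 4) (?S'(f 0 := [], b := s' 0))"
    unfolding call_def
    by (intro runs_within_mono[OF runs_within_seq[OF runs_within_copy_regs[OF f(1-3) s]
          runs_within_seq[OF runs_within_rename[OF p f(1)] runs_within_seq[OF runs_within_clear r1]]]])
       (use ne f in auto)
  thus ?thesis by (rule that) (use f in auto)
qed

text \<open>Composition in the form of a let-binding: \<open>f i\<close>, computed from the inputs
  selected by \<open>js\<close>, is appended to the inputs and stays available to all that follows.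
  Chains of such bindings assemble the whole algorithm.\<close>

lemma poly_time_let:
  assumes pf: "poly_time I inp' f" and pg: "poly_time I (\<lambda>i. inp i @ [f i]) g"
    and inp': "\<And>i. i \<in> I \<Longrightarrow> inp' i = map ((!) (inp i)) js"
    and k: "\<And>i. i \<in> I \<Longrightarrow> length (inp i) = k" "0 < k" and js: "set js \<subseteq> {..<k}"
  shows "poly_time I inp g"
proof -
  obtain p T where p: "poly_bounded I (\<lambda>i. input_size (inp' i)) T"
    "\<And>i. i \<in> I \<Longrightarrow> \<exists>s. runs_within p (load (inp' i)) (T i) s \<and> s 0 = f i"
    using pf unfolding poly_time_iff by blast
  obtain q T' where q: "poly_bounded I (\<lambda>i. input_size (inp i @ [f i])) T'"
    "\<And>i. i \<in> I \<Longrightarrow> \<exists>s. runs_within q (load (inp i @ [f i])) (T' i) s \<and> s 0 = g i"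
    using pg unfolding poly_time_iff by blast
  define N where "N i = input_size (inp i)" for i
  define n where "n = length js"
  have size: "input_size (inp' i) \<le> n * N i" if i: "i \<in> I" for i
  proof -
    have "input_size (inp' i) = (\<Sum>j\<leftarrow>js. length (inp i ! j))"
      using inp'[OF i] by (simp add: comp_def)
    also have "\<dots> \<le> (\<Sum>j\<leftarrow>js. N i)"
      using js k(1)[OF i] unfolding N_def by (intro sum_list_mono) (auto intro!: member_le_sum_list)
    finally show ?thesis by (simp add: n_def sum_list_triv)
  qed
  have "poly_bounded I N (\<lambda>i. n * N i)"
    by (intro poly_bounded_intros)
  hence "poly_bounded I N (\<lambda>i. input_size (inp' i))"
    by (rule poly_bounded_mono) (rule size)
  hence T: "poly_bounded I N T"
    by (rule poly_bounded_comp[OF p(1)])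
  have fle: "length (f i) \<le> n * N i + T i" if i: "i \<in> I" for i
  proof -
    obtain s where "runs_within p (load (inp' i)) (T i) s" "s 0 = f i" using p(2)[OF i] by blast
    thus ?thesis
      using runs_within_length[of p "load (inp' i)" "T i" s 0] load_length_le[of "inp' i" 0] size[OF i] by simp
  qed
  have "poly_bounded I N (\<lambda>i. N i + (n * N i + T i))"
    using T by (intro poly_bounded_intros)
  hence "poly_bounded I N (\<lambda>i. input_size (inp i @ [f i]))"
    by (rule poly_bounded_mono) (use fle in \<open>auto simp: N_def\<close>)
  hence T': "poly_bounded I N T'"
    by (rule poly_bounded_comp[OF q(1)])
  \<comment> \<open>Stacks below \<open>k\<close> keep the inputs, \<open>k\<close> is the scratch
    stack and \<open>k + 1\<close> receives \<open>f i\<close>. The two calls get the stacks of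
    either parity from \<open>k + 2\<close> on, infinitely many each.\<close>
  define \<alpha> \<beta> where "\<alpha> r = k + 2 + 2 * r" and "\<beta> r = k + 3 + 2 * r" for r :: nat
  have inj: "inj \<alpha>" "inj \<beta>" by (auto simp: \<alpha>_def \<beta>_def inj_def)
  have \<alpha>: "r \<notin> range \<alpha>" if "r < k + 2" for r using that by (auto simp: \<alpha>_def)
  have \<beta>: "r \<notin> range \<beta>" if "r < k + 2" for r using that by (auto simp: \<beta>_def)
  have \<alpha>\<beta>: "\<beta> r \<notin> range \<alpha>" for r by (auto simp: \<alpha>_def \<beta>_def) presburger
  define P where "P = Seq (call p k \<alpha> js (k + 1)) (call q k \<beta> ([0..<k] @ [k + 1]) 0)"
  define B where "B i = 42 * (n * N i) + 25 * N i + 32 * T i + 11 * T' i + (2 * n + 2 * k + 10)" for i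
  have "\<exists>s. runs_within P (load (inp i)) (B i) s \<and> s 0 = g i" if i: "i \<in> I" for i
  proof -
    note k' = k(1)[OF i]
    let ?s = "load (inp i)"
    obtain s' where s': "runs_within p (load (inp' i)) (T i) s'" "s' 0 = f i" using p(2)[OF i] by blast
    obtain t' where t': "runs_within q (load (inp i @ [f i])) (T' i) t'" "t' 0 = g i" using q(2)[OF i] by blast
    have inp'_load: "map ?s js = inp' i"
      unfolding inp'[OF i] using js k' by (auto simp: load_def)
    obtain S where S: "runs_within (call p k \<alpha> js (k + 1)) ?s
        (21 * input_size (map ?s js) + 2 * length js + 11 * T i + 4 * length (?s (k + 1)) + 4) S"
      "S (k + 1) = f i" "\<And>r. r \<notin> range \<alpha> \<Longrightarrow> r \<noteq> k + 1 \<Longrightarrow> S r = ?s r"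
      by (rule runs_within_call[of p ?s js "T i" s' \<alpha> k "k + 1"])
         (use s' inj js k' inp'_load in \<open>auto simp: load_ge \<alpha>_def\<close>)
    have "map S [0..<k] = map ?s [0..<k]"
      by (intro map_cong refl S(3) \<alpha>) auto
    hence S': "map S ([0..<k] @ [k + 1]) = inp i @ [f i]"
      using S(2) by (simp add: map_load[OF k'])
    have len: "length (S 0) \<le> N i"
      using k(2) S(3)[OF \<alpha>, of 0] load_length_le[of "inp i" 0] by (simp add: N_def)
    obtain S2 where S2: "runs_within (call q k \<beta> ([0..<k] @ [k + 1]) 0) S
        (21 * input_size (map S ([0..<k] @ [k + 1])) + 2 * length ([0..<k] @ [k + 1]) + 11 * T' i + 4 * length (S 0) + 4) S2"
      "S2 0 = g i"
    proof (rule runs_within_call[of q S "[0..<k] @ [k + 1]" "T' i" t' \<beta> k 0])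
      show "S (\<beta> j) = []" for j
        using S(3)[OF \<alpha>\<beta>, of j] k' by (simp add: load_ge \<beta>_def)
      show "S k = []" using S(3)[OF \<alpha>, of k] k' by (simp add: load_ge)
      show "runs_within q (load (map S ([0..<k] @ [k + 1]))) (T' i) t'" unfolding S' by (rule t'(1))
      show "j \<noteq> k \<and> j \<notin> range \<beta>" if "j \<in> set ([0..<k] @ [k + 1])" for j
        using that \<beta>[of j] by auto
    qed (use t'(2) inj \<beta>[of 0] \<beta>[of k] k(2) in auto)
    have "runs_within P ?s (B i) S2" unfolding P_def
      by (rule runs_within_mono[OF runs_within_seq[OF S(1) S2(1)]])
         (use len fle[OF i] size[OF i] k' in
           \<open>simp_all only: S' inp'_load n_def[symmetric], simp_all add: B_def N_def load_ge\<close>)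
    with S2(2) show ?thesis by blast
  qed
  moreover have "poly_bounded I (\<lambda>i. input_size (inp i)) B"
    using T T' unfolding B_def N_def[symmetric] by (intro poly_bounded_intros)
  ultimately show ?thesis unfolding poly_time_iff by blast
qed

text \<open>The end of a chain of bindings: the result is the value bound last.\<close>

lemma poly_time_last:
  assumes "\<And>i. i \<in> I \<Longrightarrow> length (inp i) = k" "0 < k"
  shows "poly_time I (\<lambda>i. inp i @ [f i]) f"
proof (rule poly_timeI)
  fix i assume i: "i \<in> I"
  let ?s = "load (inp i @ [f i])"
  have "?s k = f i" "?s (Suc k) = []" using assms(1)[OF i] by (simp_all add: load_def nth_append)
  thus "runs_within (Seq (clear 0) (transfer_reg (Suc k) k 0)) ?s (14 * input_size (inp i @ [f i]) + 3)
      (?s(0 := f i, k := []))"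
    by (intro runs_within_mono[OF runs_within_seq[OF runs_within_clear runs_within_transfer_reg]])
       (use load_length_le[of "inp i @ [f i]" 0] assms(2) in \<open>auto simp: fun_eq_iff\<close>)
qed (use assms(2) in \<open>simp, intro poly_bounded_intros\<close>)


section \<open>Bilinear forms in polynomial time\<close>

lemma bit_cases: obtains "x = (0::bit)" | "x = 1"
  by (cases x) auto

lemma poly_time_append: "poly_time I (\<lambda>i. [u i, v i]) (\<lambda>i. u i @ v i)"
proof (rule poly_timeI)
  fix i
  let ?s = "load [u i, v i]"
  show "runs_within (Seq (move 0 [2]) (Seq (move 1 [3]) (Seq (move 3 [0]) (move 2 [0])))) ?s
     (10 * input_size [u i, v i] + 4) (?s(0 := u i @ v i, 1 := []))"
    by (rule runs_within_mono[OF runs_within_seq[OF runs_within_move runs_within_seq[OF runs_within_move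
      runs_within_seq[OF runs_within_move runs_within_move]]]]) (auto simp: fun_eq_iff)
qed (simp, intro poly_bounded_intros)

text \<open>Stack 0 acts as a unary counter. Both parts of stack 1 survive, the prefix reversed on
  stack 2, so one loop serves \<open>take\<close> and \<open>drop\<close>.\<close>

lemma runs_within_take:
  "runs_within (While 0 (Seq (Pop 0) (pop_bit 1 [2]))) s (length (s 0) * 6 + 1)
     (s(0 := [], 1 := drop (length (s 0)) (s 1), 2 := rev (take (length (s 0)) (s 1)) @ s 2))"
proof -
  define St where "St j = s(0 := drop j (s 0), 1 := drop j (s 1), 2 := rev (take j (s 1)) @ s 2)" for j
  have "runs_within (While 0 (Seq (Pop 0) (pop_bit 1 [2]))) (St 0) (length (s 0) * (5 + 1) + 1) (St (length (s 0)))"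
  proof (rule runs_within_while)
    show "St (length (s 0)) 0 = []" by (simp add: St_def)
    fix j assume j: "j < length (s 0)"
    have "runs_within (pop_bit 1 [2]) ((St j)(0 := drop (Suc j) (s 0))) 4 (St (Suc j))"
    proof (cases "j < length (s 1)")
      case True
      show ?thesis
        by (rule runs_within_mono[OF runs_within_pop_bit[where x = "s 1 ! j" and w = "drop (Suc j) (s 1)"]])
           (use True in \<open>auto simp: St_def fun_eq_iff Cons_nth_drop_Suc take_Suc_conv_app_nth\<close>)
    next
      \<comment> \<open>The counter outlasts the word: \<open>pop_bit\<close> leaves an empty stack
        alone, in accordance with \<open>take\<close> and \<open>drop\<close> beyond the
        length.\<close>
      case False
      show ?thesis unfolding pop_bit_def
        by (rule runs_within_mono[OF runs_within_branch_empty[OF _ runs_within_skip]])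
           (use False in \<open>auto simp: St_def fun_eq_iff\<close>)
    qed
    moreover have "runs_within (Pop 0) (St j) 1 ((St j)(0 := drop (Suc j) (s 0)))"
      by (rule runs_within_mono[OF runs_within_pop]) (auto simp: St_def drop_Suc tl_drop)
    ultimately have "runs_within (Seq (Pop 0) (pop_bit 1 [2])) (St j) (1 + 4) (St (Suc j))"
      by (intro runs_within_seq)
    thus "St j 0 \<noteq> [] \<and> runs_within (Seq (Pop 0) (pop_bit 1 [2])) (St j) 5 (St (Suc j))"
      using j by (simp add: St_def)
  qed
  moreover have "St 0 = s" "St (length (s 0)) =
      s(0 := [], 1 := drop (length (s 0)) (s 1), 2 := rev (take (length (s 0)) (s 1)) @ s 2)"
    by (auto simp: St_def)
  ultimately show ?thesis
    by simp
qed

lemma poly_time_take: "poly_time I (\<lambda>i. [u i, w i]) (\<lambda>i. take (length (u i)) (w i))"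
proof (rule poly_timeI)
  fix i
  let ?s = "load [u i, w i]"
  show "runs_within (Seq (While 0 (Seq (Pop 0) (pop_bit 1 [2]))) (move 2 [0])) ?s
     (6 * input_size [u i, w i] + 2) (?s(0 := take (length (u i)) (w i), 1 := drop (length (u i)) (w i)))"
    by (rule runs_within_mono[OF runs_within_seq[OF runs_within_take runs_within_move]])
       (auto simp: fun_eq_iff)
qed (simp, intro poly_bounded_intros)

lemma poly_time_drop: "poly_time I (\<lambda>i. [u i, w i]) (\<lambda>i. drop (length (u i)) (w i))"
proof (rule poly_timeI)
  fix i
  let ?s = "load [u i, w i]"
  show "runs_within (Seq (While 0 (Seq (Pop 0) (pop_bit 1 [2]))) (transfer_reg 3 1 0)) ?s
     (10 * input_size [u i, w i] + 3) (?s(0 := drop (length (u i)) (w i), 1 := [], 2 := rev (take (length (u i)) (w i))))"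
    by (rule runs_within_mono[OF runs_within_seq[OF runs_within_take runs_within_transfer_reg]])
       (auto simp: fun_eq_iff)
qed (simp, intro poly_bounded_intros)

lemma poly_time_if: "poly_time I (\<lambda>i. [[of_bool (c i)], u i, v i]) (\<lambda>i. if c i then u i else v i)"
proof (rule poly_timeI)
  fix i
  let ?s = "load [[of_bool (c i)], u i, v i]" and ?j = "if c i then 1 else 2 :: nat"
    and ?q = "\<lambda>j. Seq (Pop 0) (transfer_reg 3 j 0)"
  have "runs_within (?q ?j) ?s (10 * input_size [[of_bool (c i)], u i, v i] + 3) (?s(0 := ?s ?j, ?j := []))"
    by (rule runs_within_mono[OF runs_within_seq[OF runs_within_pop runs_within_transfer_reg]])
       (auto simp: fun_eq_iff)
  thus "runs_within (Branch 0 Skip (?q 2) (?q 1)) ?s (10 * input_size [[of_bool (c i)], u i, v i] + 3 + 1)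
      (?s(0 := ?s ?j, ?j := []))"
    by (intro runs_within_branch[where x = "of_bool (c i)" and w = "[]"]) auto
qed (simp, intro poly_bounded_intros)

section \<open>Bilinear forms over GF(2) on stacks\<close>

definition bdot :: "nat \<Rightarrow> bit list \<Rightarrow> bit list \<Rightarrow> bit" where
  "bdot n u v = (\<Sum>j<n. u ! j * v ! j)"

definition toggle :: "nat \<Rightarrow> prog" where
  "toggle a = Branch a Skip (Seq (Pop a) (Push a 1)) (Seq (Pop a) (Push a 0))"

lemma runs_within_toggle:
  assumes "s a = x # w"
  shows "runs_within (toggle a) s 3 (s(a := (x + 1) # w))"
proof -
  have "runs_within (Seq (Pop a) (Push a (x + 1))) s 2 (s(a := (x + 1) # w))"
    by (rule runs_within_mono[OF runs_within_seq[OF runs_within_pop runs_within_push]])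
       (use assms in auto)
  note step = this
  have "runs_within (toggle a) s (2 + 1) (s(a := (x + 1) # w))"
    unfolding toggle_def by (rule runs_within_branch[of s a x w, OF assms], cases x rule: bit_cases) (use step in simp_all)
  thus ?thesis by simp
qed

text \<open>Stack 0 holds the matrix entries still to be read, stacks 2 and 3 the strings \<open>x\<close> and \<open>y\<close>, whose
  bits are moved to stacks 4 and 5 while they are read, and the top of stack 6 accumulates a sum
  modulo 2. In \<open>bilinear_all\<close>, stack 1 counts the matrices.\<close>

definition row_step :: "bool \<Rightarrow> prog" where
  "row_step c = Seq (if c then Branch 0 Skip Skip (Branch 2 Skip Skip (toggle 6)) else Skip)
     (Seq (Pop 0) (pop_bit 2 [4]))"

lemma runs_within_row_step:
  assumes "s 0 = z # M" "s 2 = x # X" "s 6 = a # w"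
  shows "runs_within (row_step c) s 10
     (s(0 := M, 2 := X, 4 := x # s 4, 6 := (a + of_bool c * (z * x)) # w))"
proof -
  let ?s = "s(6 := (a + of_bool c * (z * x)) # w)"
  let ?b = "if c then Branch 0 Skip Skip (Branch 2 Skip Skip (toggle 6)) else Skip"
  have sk: "runs_within Skip s 3 s"
    by (rule runs_within_mono[OF runs_within_skip]) auto
  have 1: "runs_within (Branch 2 Skip Skip (toggle 6)) s (3 + 1) (s(6 := (a + x) # w))"
    by (rule runs_within_branch[of s 2 x X, OF assms(2)], cases x rule: bit_cases)
       (use sk runs_within_toggle[of s 6 a w, OF assms(3)] assms(3) in \<open>simp_all add: fun_upd_idem\<close>)
  have "runs_within (Branch 0 Skip Skip (Branch 2 Skip Skip (toggle 6))) s (4 + 1) (s(6 := (a + z * x) # w))"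
    by (rule runs_within_branch[of s 0 z M, OF assms(1)], cases z rule: bit_cases)
       (use 1 runs_within_mono[OF sk, of 4] assms(3) in \<open>simp_all add: fun_upd_idem\<close>)
  hence "runs_within ?b s 5 ?s"
    using runs_within_mono[OF sk, of 5] assms(3) by (cases c) (simp_all add: fun_upd_idem)
  moreover have "runs_within (Seq (Pop 0) (pop_bit 2 [4])) ?s (1 + 4) (?s(0 := M, 2 := X, 4 := x # s 4))"
  proof (rule runs_within_seq)
    show "runs_within (Pop 0) ?s 1 (?s(0 := M))"
      by (rule runs_within_mono[OF runs_within_pop]) (use assms in auto)
    show "runs_within (pop_bit 2 [4]) (?s(0 := M)) 4 (?s(0 := M, 2 := X, 4 := x # s 4))"
      by (rule runs_within_mono[OF runs_within_pop_bit]) (use assms in auto)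
  qed
  ultimately show ?thesis unfolding row_step_def
    by (rule runs_within_mono[OF runs_within_seq]) (auto simp: fun_eq_iff)
qed

text \<open>The flag \<open>c\<close> is the bit of \<open>y\<close> that belongs to the row. Also
  for \<open>c = False\<close> the entries are consumed, so that stack 0 advances to the next
  row.\<close>

definition add_row :: "bool \<Rightarrow> prog" where
  "add_row c = Seq (While 2 (row_step c)) (move 4 [2])"

lemma runs_within_add_row:
  assumes "length (s 2) = n" "n \<le> length (s 0)" "s 4 = []" "s 6 = a # w"
  shows "runs_within (add_row c) s (16 * n + 2)
     (s(0 := drop n (s 0), 6 := (a + of_bool c * bdot n (s 0) (s 2)) # w))"
proof -
  define St where "St j = s(0 := drop j (s 0), 2 := drop j (s 2), 4 := rev (take j (s 2)),
    6 := (a + of_bool c * bdot j (s 0) (s 2)) # w)" for j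
  have "runs_within (While 2 (row_step c)) (St 0) (n * (10 + 1) + 1) (St n)"
  proof (rule runs_within_while)
    show "St n 2 = []" using assms by (simp add: St_def)
    fix j assume j: "j < n"
    have "runs_within (row_step c) (St j) 10 (St (Suc j))"
      by (rule runs_within_mono[OF runs_within_row_step[where z = "s 0 ! j" and M = "drop (Suc j) (s 0)"
            and x = "s 2 ! j" and X = "drop (Suc j) (s 2)" and a = "a + of_bool c * bdot j (s 0) (s 2)" and w = w]])
         (use j assms in \<open>auto simp: St_def fun_eq_iff Cons_nth_drop_Suc take_Suc_conv_app_nth bdot_def\<close>)
    thus "St j 2 \<noteq> [] \<and> runs_within (row_step c) (St j) 10 (St (Suc j))"
      using j assms by (simp add: St_def)
  qed
  moreover have "St 0 = s" using assms by (auto simp: St_def bdot_def)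
  ultimately have 1: "runs_within (While 2 (row_step c)) s (n * (10 + 1) + 1) (St n)" by simp
  show ?thesis unfolding add_row_def
    by (rule runs_within_mono[OF runs_within_seq[OF 1 runs_within_move]])
       (use assms in \<open>auto simp: St_def fun_eq_iff\<close>)
qed

definition bilinear_step :: prog where
  "bilinear_step = Seq (Branch 3 Skip (add_row False) (add_row True)) (pop_bit 3 [5])"

definition bilinear :: prog where
  "bilinear = Seq (While 3 bilinear_step) (move 5 [3])"

text \<open>The bilinear form of the \<open>m\<close> by \<open>n\<close> matrix listed row by row
  in \<open>M\<close>, with \<open>y\<close> on the left and \<open>x\<close> on the right. Entries
  beyond the first \<open>m * n\<close> are ignored, so \<open>M\<close> may continue with further
  matrices.\<close>

definition bform :: "nat \<Rightarrow> nat \<Rightarrow> bit list \<Rightarrow> bit list \<Rightarrow> bit list \<Rightarrow> bit" where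
  "bform n m M x y = (\<Sum>r<m. y ! r * bdot n (drop (r * n) M) x)"

lemma runs_within_bilinear:
  assumes "length (s 2) = n" "length (s 3) = m" "m * n \<le> length (s 0)" "s 4 = []" "s 5 = []" "s 6 = a # w"
  shows "runs_within bilinear s (m * (16 * n + 14) + 2)
     (s(0 := drop (m * n) (s 0), 6 := (a + bform n m (s 0) (s 2) (s 3)) # w))"
proof -
  define St where "St j = s(0 := drop (j * n) (s 0), 3 := drop j (s 3), 5 := rev (take j (s 3)),
    6 := (a + bform n j (s 0) (s 2) (s 3)) # w)" for j
  have "runs_within (While 3 bilinear_step) (St 0) (m * ((16 * n + 7) + 1) + 1) (St m)"
  proof (rule runs_within_while)
    show "St m 3 = []" using assms by (simp add: St_def)
    fix j assume j: "j < m"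
    have jn: "n \<le> length (s 0) - j * n"
    proof -
      have "Suc j * n \<le> m * n" using j by (intro mult_right_mono) auto
      thus ?thesis using assms(3) by simp
    qed
    let ?y = "s 3 ! j"
    let ?s = "(St j)(0 := drop (Suc j * n) (s 0), 6 := (a + bform n (Suc j) (s 0) (s 2) (s 3)) # w)"
    have y: "St j 3 = ?y # drop (Suc j) (s 3)"
      using j assms by (simp add: St_def Cons_nth_drop_Suc)
    have r: "runs_within (add_row (?y = 1)) (St j) (16 * n + 2) ?s"
    proof (rule runs_within_mono[OF runs_within_add_row[where n = n and a = "a + bform n j (s 0) (s 2) (s 3)" and w = w]])
      have y': "of_bool (?y = 1) = ?y" by (cases ?y rule: bit_cases) auto
      have "a + bform n j (s 0) (s 2) (s 3) + ?y * bdot n (drop (j * n) (s 0)) (s 2) =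
          a + bform n (Suc j) (s 0) (s 2) (s 3)"
        unfolding bform_def by (simp only: sum.lessThan_Suc add.assoc)
      thus "(St j)(0 := drop n (St j 0), 6 := (a + bform n j (s 0) (s 2) (s 3) +
          of_bool (?y = 1) * bdot n (St j 0) (St j 2)) # w) = ?s"
        unfolding y' by (simp add: St_def fun_eq_iff)
    qed (use assms jn in \<open>auto simp: St_def\<close>)
    have 1: "runs_within (Branch 3 Skip (add_row False) (add_row True)) (St j) (16 * n + 2 + 1) ?s"
      by (rule runs_within_branch[of "St j" 3 ?y "drop (Suc j) (s 3)", OF y], cases ?y rule: bit_cases)
         (use r in simp_all)
    have "runs_within bilinear_step (St j) (16 * n + 7) (St (Suc j))"
      unfolding bilinear_step_def
      by (rule runs_within_mono[OF runs_within_seq[OF 1 runs_within_pop_bit[where x = ?y and w = "drop (Suc j) (s 3)"]]])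
         (use y j assms in \<open>auto simp: St_def fun_eq_iff take_Suc_conv_app_nth\<close>)
    thus "St j 3 \<noteq> [] \<and> runs_within bilinear_step (St j) (16 * n + 7) (St (Suc j))"
      using y by simp
  qed
  moreover have "St 0 = s" using assms by (auto simp: St_def bform_def)
  ultimately have 1: "runs_within (While 3 bilinear_step) s (m * ((16 * n + 7) + 1) + 1) (St m)" by simp
  show ?thesis unfolding bilinear_def
    by (rule runs_within_mono[OF runs_within_seq[OF 1 runs_within_move]])
       (use assms in \<open>auto simp: St_def fun_eq_iff algebra_simps\<close>)
qed

definition bilinear_all :: prog where
  "bilinear_all = Seq (While 1 (Seq (Pop 1) (Seq (Push 6 0) bilinear))) (Seq (clear 0) (move 6 [0]))"

lemma runs_within_bilinear_all:
  assumes "length (s 2) = n" "length (s 3) = m" "length (s 1) * (m * n) \<le> length (s 0)"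
    "s 4 = []" "s 5 = []" "s 6 = []"
  shows "runs_within bilinear_all s (length (s 1) * (m * (16 * n + 14) + 10) + 4 * length (s 0) + 3)
     (s(0 := map (\<lambda>i. bform n m (drop (i * (m * n)) (s 0)) (s 2) (s 3)) [0..<length (s 1)], 1 := []))"
proof -
  let ?f = "\<lambda>i. bform n m (drop (i * (m * n)) (s 0)) (s 2) (s 3)"
  let ?L = "length (s 1)"
  define St where "St j = s(0 := drop (j * (m * n)) (s 0), 1 := drop j (s 1), 6 := rev (map ?f [0..<j]))" for j
  let ?p = "Seq (Pop 1) (Seq (Push 6 0) bilinear)"
  have "runs_within (While 1 ?p) (St 0) (?L * ((1 + (1 + (m * (16 * n + 14) + 2))) + 1) + 1) (St ?L)"
  proof (rule runs_within_while)
    show "St ?L 1 = []" by (simp add: St_def)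
    fix j assume j: "j < ?L"
    have le: "m * n \<le> length (s 0) - j * (m * n)"
    proof -
      have "Suc j * (m * n) \<le> ?L * (m * n)" using j by (intro mult_right_mono) auto
      thus ?thesis using assms(3) by simp
    qed
    let ?s = "(St j)(1 := drop (Suc j) (s 1))"
    have 1: "runs_within (Pop 1) (St j) 1 ?s"
      by (rule runs_within_mono[OF runs_within_pop]) (auto simp: St_def drop_Suc tl_drop)
    have 2: "runs_within (Push 6 0) ?s 1 (?s(6 := 0 # St j 6))"
      by (rule runs_within_mono[OF runs_within_push]) auto
    have 3: "runs_within bilinear (?s(6 := 0 # St j 6)) (m * (16 * n + 14) + 2) (St (Suc j))"
      by (rule runs_within_mono[OF runs_within_bilinear[where n = n and m = m and a = 0 and w = "St j 6"]])
         (use assms le in \<open>auto simp: St_def fun_eq_iff algebra_simps\<close>)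
    show "St j 1 \<noteq> [] \<and> runs_within ?p (St j) (1 + (1 + (m * (16 * n + 14) + 2))) (St (Suc j))"
      using runs_within_seq[OF 1 runs_within_seq[OF 2 3]] j by (simp add: St_def)
  qed
  moreover have "St 0 = s" using assms by (auto simp: St_def)
  ultimately have 1: "runs_within (While 1 ?p) s (?L * ((1 + (1 + (m * (16 * n + 14) + 2))) + 1) + 1) (St ?L)" by simp
  show ?thesis unfolding bilinear_all_def
    by (rule runs_within_mono[OF runs_within_seq[OF 1 runs_within_seq[OF runs_within_clear runs_within_move]]])
       (use assms in \<open>auto simp: St_def fun_eq_iff rev_map algebra_simps\<close>)
qed

lemma poly_time_bilinear_all:
  assumes "\<And>i. i \<in> I \<Longrightarrow> length (x i) = n i \<and> length (y i) = m i \<and> L i * (m i * n i) \<le> length (M i)"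
  shows "poly_time I (\<lambda>i. [M i, unary (L i), x i, y i])
     (\<lambda>i. map (\<lambda>j. bform (n i) (m i) (drop (j * (m i * n i)) (M i)) (x i) (y i)) [0..<L i])"
proof (rule poly_timeI)
  let ?N = "\<lambda>i. input_size [M i, unary (L i), x i, y i]"
  \<comment> \<open>Every length in the bound of \<open>runs_within_bilinear_all\<close> is at most
    the total input size and is replaced by it.\<close>
  show "poly_bounded I ?N (\<lambda>i. ?N i * (?N i * (16 * ?N i + 14) + 10) + 4 * ?N i + 3)"
    by (intro poly_bounded_intros)
  fix i assume i: "i \<in> I"
  let ?s = "load [M i, unary (L i), x i, y i]"
  let ?r = "map (\<lambda>j. bform (n i) (m i) (drop (j * (m i * n i)) (M i)) (x i) (y i)) [0..<L i]"
  show "runs_within bilinear_all ?s (?N i * (?N i * (16 * ?N i + 14) + 10) + 4 * ?N i + 3)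
      (?s(0 := ?r, 1 := []))"
  proof (rule runs_within_mono[OF runs_within_bilinear_all[of ?s "n i" "m i"]])
    show "length (?s 1) * (m i * (16 * n i + 14) + 10) + 4 * length (?s 0) + 3
      \<le> ?N i * (?N i * (16 * ?N i + 14) + 10) + 4 * ?N i + 3"
      using assms[OF i] by (intro add_mono mult_mono) (auto simp: unary_def)
  qed (use assms[OF i] in \<open>auto simp: unary_def\<close>)
qed auto

section \<open>Reading the bilinear forms off the list of matrix entries\<close>

lemma length_concat_const: "(\<And>j. j < k \<Longrightarrow> length (f j) = q) \<Longrightarrow> length (concat (map f [0..<k])) = k * q"
  by (induction k) auto

lemma nth_concat_equal_length:
  assumes "\<And>j. j < k \<Longrightarrow> length (f j) = q" "i < k" "r < q"
  shows "concat (map f [0..<k]) ! (i * q + r) = f i ! r"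
  using assms
proof (induction k)
  case (Suc k)
  have len: "length (concat (map f [0..<k])) = k * q"
    by (rule length_concat_const) (use Suc.prems(1) in auto)
  show ?case
  proof (cases "i = k")
    case False
    hence "i < k" using Suc.prems by simp
    moreover have "i * q + r < k * q"
    proof -
      have "Suc i * q \<le> k * q" using \<open>i < k\<close> by (intro mult_right_mono) auto
      thus ?thesis using Suc.prems(3) by simp
    qed
    ultimately show ?thesis using Suc len by (simp add: nth_append)
  qed (use len in \<open>simp add: nth_append\<close>)
qed simp

definition matrix_entries :: "(nat \<Rightarrow> bit mat) \<Rightarrow> nat \<Rightarrow> bit list" where
  "matrix_entries A n =
     concat (map (\<lambda>i. concat (map (\<lambda>r. list_of_vec (row (A i) r)) [0..<n])) [1..<Suc n])"

text \<open>Matrix, row and column act as the digits of a position, the matrix being the most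
  significant. The matrices are numbered from 1, hence \<open>Suc j\<close>.\<close>

lemma
  assumes A: "\<And>i. i \<in> {1..n} \<Longrightarrow> A i \<in> carrier_mat n n"
  shows length_matrix_entries: "length (matrix_entries A n) = n * (n * n)"
    and nth_matrix_entries: "j < n \<Longrightarrow> r < n \<Longrightarrow> c < n \<Longrightarrow>
      matrix_entries A n ! (j * (n * n) + (r * n + c)) = A (Suc j) $$ (r, c)"
proof -
  let ?g = "\<lambda>j r. list_of_vec (row (A (Suc j)) r)"
  let ?f = "\<lambda>j. concat (map (?g j) [0..<n])"
  have eq: "matrix_entries A n = concat (map ?f [0..<n])"
    unfolding matrix_entries_def map_Suc_upt[symmetric] One_nat_def by (simp add: comp_def)
  have dim: "dim_row (A (Suc j)) = n" "dim_col (A (Suc j)) = n" if "j < n" for j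
    using A[of "Suc j"] that by auto
  have g: "length (?g j r) = n" if "j < n" for j r
    using dim[OF that] by simp
  have f: "length (?f j) = n * n" if "j < n" for j
    using g[OF that] by (intro length_concat_const) auto
  show "length (matrix_entries A n) = n * (n * n)"
    unfolding eq by (rule length_concat_const) (rule f)
  assume j: "j < n" and r: "r < n" and c: "c < n"
  have "Suc r * n \<le> n * n" using r by (intro mult_right_mono) auto
  hence rc: "r * n + c < n * n" using c by simp
  have "matrix_entries A n ! (j * (n * n) + (r * n + c)) = ?f j ! (r * n + c)"
    unfolding eq by (rule nth_concat_equal_length[OF f j rc])
  also have "\<dots> = ?g j r ! c"
    by (rule nth_concat_equal_length[OF g[OF j] r c])
  also have "\<dots> = A (Suc j) $$ (r, c)"
    using dim[OF j] r c by (simp add: list_of_vec_index)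
  finally show "matrix_entries A n ! (j * (n * n) + (r * n + c)) = A (Suc j) $$ (r, c)" .
qed

lemma mat_bilinear_form:
  fixes A :: "'a::comm_semiring_0 mat"
  assumes "A \<in> carrier_mat n n" "length x = n" "length y = n"
  shows "(A *\<^sub>v vec_of_list x) \<bullet> vec_of_list y = (\<Sum>r<n. y ! r * (\<Sum>c<n. A $$ (r, c) * x ! c))"
  using assms by (simp add: scalar_prod_def vec_of_list_index lessThan_atLeast0 mult.commute)

lemma E_D_eq_bform:
  assumes A: "\<And>i. i \<in> {1..n} \<Longrightarrow> A n i \<in> carrier_mat n n" and "L \<le> n" "length x = n" "length y = n"
  shows "E_D A n L x y = map (\<lambda>j. bform n n (drop (j * (n * n)) (matrix_entries (A n) n)) x y) [0..<L]"
proof -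
  have "(A n (Suc j) *\<^sub>v vec_of_list x) \<bullet> vec_of_list y =
      bform n n (drop (j * (n * n)) (matrix_entries (A n) n)) x y" if "j < L" for j
  proof -
    have j: "j < n" using that assms(2) by simp
    have e: "drop (r * n) (drop (j * (n * n)) (matrix_entries (A n) n)) ! c = A n (Suc j) $$ (r, c)"
      if "r < n" "c < n" for r c
    proof -
      have "Suc r * n \<le> n * n" "Suc j * (n * n) \<le> n * (n * n)"
        using that j by (intro mult_right_mono; simp)+
      hence "j * (n * n) + r * n \<le> length (matrix_entries (A n) n)"
        using length_matrix_entries[of n "A n", OF A] by simp
      thus ?thesis
        using nth_matrix_entries[of n "A n", OF A j that] by (simp add: ac_simps)
    qed
    have "bform n n (drop (j * (n * n)) (matrix_entries (A n) n)) x y =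
        (\<Sum>r<n. y ! r * (\<Sum>c<n. A n (Suc j) $$ (r, c) * x ! c))"
      unfolding bform_def bdot_def using e by (intro sum.cong refl arg_cong2[of _ _ _ _ "(*)"]) auto
    also have "\<dots> = (A n (Suc j) *\<^sub>v vec_of_list x) \<bullet> vec_of_list y"
      using A[of "Suc j"] assms(3,4) j by (intro mat_bilinear_form[symmetric]) auto
    finally show ?thesis ..
  qed
  thus ?thesis
    unfolding E_D_def map_Suc_upt[symmetric] One_nat_def by simp
qed

lemma poly_time_deor:
  assumes A: "deor_matrices A" and ES: "explicit_seeded_extractors a b ES d l"
  shows "deor_explicit A ES d l"
proof -
  define I where "I = {((n, k, e, L, sw, m), x, y).
         (n, k, e, L, sw, m) \<in> deor_params d l \<and> x \<in> bits n \<and> y \<in> bits n}"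
  define n k e L sw m x y where "n i = fst (fst i)" and "k i = fst (snd (fst i))" and "e i = fst (snd (snd (fst i)))"
    and "L i = fst (snd (snd (snd (fst i))))" and "sw i = fst (snd (snd (snd (snd (fst i)))))"
    and "m i = snd (snd (snd (snd (snd (fst i)))))" and "x i = fst (snd i)" and "y i = snd (snd i)"
    for i :: "(nat \<times> nat \<times> nat \<times> nat \<times> bool \<times> nat) \<times> bit list \<times> bit list"
  note defs = n_def k_def e_def L_def m_def sw_def x_def y_def
  define D where "D i = d (n i) (k i) (e i)" for i
  define inp where "inp i = [unary (n i), unary (k i), unary (e i), unary (L i), [of_bool (sw i)], unary (m i), x i, y i]" for i
  define M where "M i = matrix_entries (A (n i)) (n i)" for i
  define w where "w i = E_D A (n i) (L i) (x i) (y i)" for i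
  define u u' where "u i = take (length (unary (D i))) (w i)" and "u' i = drop (length (unary (D i))) (w i)" for i
  define src where "src i = (if sw i then y i else x i)" for i
  define r where "r i = ES (n i) (k i) (e i) (src i) (u i)" for i
  have I: "1 \<le> k i" "k i \<le> n i" "1 \<le> e i" "e i \<le> n i" "D i \<le> L i" "L i \<le> n i" "length (x i) = n i" "length (y i) = n i"
    if "i \<in> I" for i
    using that unfolding I_def defs D_def deor_params_def bits_def by auto
  have A': "A n i \<in> carrier_mat n n" if "i \<in> {1..n}" for n i
    using A that unfolding deor_matrices_def by blast
  have lw: "length (w i) = L i" for i
    by (simp add: w_def E_D_def)
  let ?res = "\<lambda>i. take (length (unary (m i))) (r i @ u' i)"
  \<comment> \<open>Positions in the growing input list, to which the lists \<open>js\<close> below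
    refer: 0 to 7 the original inputs, 8 the matrix entries, 9 the seed length, 10 the output of
    \<open>E_D\<close>, 11 and 12 its seed part and surplus, 13 the chosen source, 14 the extractor
    output, 15 the result before truncation.\<close>
  define p1 where "p1 = (\<lambda>i. inp i @ [M i])"
  define p2 where "p2 = (\<lambda>i. p1 i @ [unary (D i)])"
  define p3 where "p3 = (\<lambda>i. p2 i @ [w i])"
  define p4 where "p4 = (\<lambda>i. p3 i @ [u i])"
  define p5 where "p5 = (\<lambda>i. p4 i @ [u' i])"
  define p6 where "p6 = (\<lambda>i. p5 i @ [src i])"
  define p7 where "p7 = (\<lambda>i. p6 i @ [r i])"
  define p8 where "p8 = (\<lambda>i. p7 i @ [r i @ u' i])"
  note p_defs = inp_def p1_def p2_def p3_def p4_def p5_def p6_def p7_def p8_def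
  have M: "poly_time I (\<lambda>i. [unary (n i)]) M"
    by (rule poly_time_reindex[where \<phi> = n])
       (use A in \<open>auto simp: deor_matrices_def M_def matrix_entries_def\<close>)
  have D: "poly_time I (\<lambda>i. [unary (n i), unary (k i), unary (e i)]) (\<lambda>i. unary (D i))"
  proof (rule poly_time_reindex[where \<phi> = "\<lambda>i. (n i, k i, e i)"])
    show "poly_time {(n, k, e). 1 \<le> k \<and> k \<le> n \<and> 1 \<le> e}
      (\<lambda>(n, k, e). [unary n, unary k, unary e]) (\<lambda>(n, k, e). unary (d n k e))"
      using ES unfolding explicit_seeded_extractors_def by blast
  qed (use I in \<open>auto simp: D_def\<close>)
  have "poly_time I (\<lambda>i. [M i, unary (L i), x i, y i])
     (\<lambda>i. map (\<lambda>j. bform (n i) (n i) (drop (j * (n i * n i)) (M i)) (x i) (y i)) [0..<L i])"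
  proof (rule poly_time_bilinear_all)
    fix i assume i: "i \<in> I"
    show "length (x i) = n i \<and> length (y i) = n i \<and> L i * (n i * n i) \<le> length (M i)"
      using I[OF i] length_matrix_entries[of "n i" "A (n i)", OF A'] by (simp add: M_def)
  qed
  hence w: "poly_time I (\<lambda>i. [M i, unary (L i), x i, y i]) w"
    by (rule poly_time_reindex[where \<phi> = id])
       (simp, simp, unfold w_def M_def id_apply, rule E_D_eq_bform[where A = A, OF A' I(6-8)])
  have r: "poly_time I (\<lambda>i. [unary (n i), unary (k i), unary (e i), src i, u i]) r"
  proof (rule poly_time_reindex[where \<phi> = "\<lambda>i. (n i, k i, e i, src i, u i)"])
    show "poly_time {(n, k, e, x, u). 1 \<le> k \<and> k \<le> n \<and> 1 \<le> e \<and> x \<in> bits n \<and> u \<in> bits (d n k e)}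
      (\<lambda>(n, k, e, x, u). [unary n, unary k, unary e, x, u]) (\<lambda>(n, k, e, x, u). ES n k e x u)"
      using ES unfolding explicit_seeded_extractors_def by blast
  qed (use I lw in \<open>auto simp: D_def[symmetric] bits_def src_def u_def unary_def r_def\<close>)
  \<comment> \<open>From here on the bindings are discharged, the last one first.\<close>
  have "poly_time I (\<lambda>i. p8 i @ [?res i]) ?res"
    by (rule poly_time_last[where k = 16]) (simp_all add: p_defs)
  hence "poly_time I p8 ?res"
    by (rule poly_time_let[where js = "[5, 15]" and k = 16, OF poly_time_take]) (auto simp: p_defs)
  hence "poly_time I p7 ?res" unfolding p8_def
    by (rule poly_time_let[where js = "[14, 12]" and k = 15, OF poly_time_append]) (auto simp: p_defs)
  hence "poly_time I p6 ?res" unfolding p7_def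
    by (rule poly_time_let[where js = "[0, 1, 2, 13, 11]" and k = 14, OF r]) (auto simp: p_defs)
  hence "poly_time I p5 ?res" unfolding p6_def src_def
    by (rule poly_time_let[where js = "[4, 7, 6]" and k = 13, OF poly_time_if]) (auto simp: p_defs)
  hence "poly_time I p4 ?res" unfolding p5_def u'_def
    by (rule poly_time_let[where js = "[9, 10]" and k = 12, OF poly_time_drop]) (auto simp: p_defs)
  hence "poly_time I p3 ?res" unfolding p4_def u_def
    by (rule poly_time_let[where js = "[9, 10]" and k = 11, OF poly_time_take]) (auto simp: p_defs)
  hence "poly_time I p2 ?res" unfolding p3_def
    by (rule poly_time_let[where js = "[8, 3, 6, 7]" and k = 10, OF w]) (auto simp: p_defs)
  hence "poly_time I p1 ?res" unfolding p2_def
    by (rule poly_time_let[where js = "[0, 1, 2]" and k = 9, OF D]) (auto simp: p_defs)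
  hence t: "poly_time I inp ?res" unfolding p1_def
    by (rule poly_time_let[where js = "[0]" and k = 8, OF M]) (auto simp: p_defs)
  show ?thesis
    unfolding deor_explicit_def I_def[symmetric]
    by (rule poly_time_reindex[OF t, where \<phi> = id])
       (auto simp: inp_def defs r_def u_def u'_def src_def w_def D_def unary_def deor_def extend_seed_def)
qed


section \<open>Quadratic forms and contractions\<close>

text \<open>Matrices are represented by functions of two indices, so that the index set of a bipartite
  system can be a product.\<close>

definition qform :: "'i set \<Rightarrow> ('i \<Rightarrow> 'i \<Rightarrow> complex) \<Rightarrow> ('i \<Rightarrow> complex) \<Rightarrow> complex" where
  "qform I A v = (\<Sum>i\<in>I. \<Sum>j\<in>I. cnj (v i) * A i j * v j)"

definition pos_form :: "'i set \<Rightarrow> ('i \<Rightarrow> 'i \<Rightarrow> complex) \<Rightarrow> bool" where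
  "pos_form I A \<longleftrightarrow> (\<forall>v. 0 \<le> qform I A v)"

definition id_form :: "'i \<Rightarrow> 'i \<Rightarrow> complex" where
  "id_form i j = of_bool (i = j)"

definition contraction :: "'i set \<Rightarrow> ('i \<Rightarrow> 'i \<Rightarrow> complex) \<Rightarrow> bool" where
  "contraction I T \<longleftrightarrow> pos_form I (\<lambda>i j. id_form i j - T i j) \<and> pos_form I (\<lambda>i j. id_form i j + T i j)"

text \<open>The trace of the matrix product of \<open>A\<close> and \<open>B\<close>.\<close>

definition trp :: "'i set \<Rightarrow> ('i \<Rightarrow> 'i \<Rightarrow> complex) \<Rightarrow> ('i \<Rightarrow> 'i \<Rightarrow> complex) \<Rightarrow> complex" where
  "trp I A B = (\<Sum>i\<in>I. \<Sum>j\<in>I. A i j * B j i)"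

definition hermitian_form :: "'i set \<Rightarrow> ('i \<Rightarrow> 'i \<Rightarrow> complex) \<Rightarrow> bool" where
  "hermitian_form I A \<longleftrightarrow> (\<forall>i\<in>I. \<forall>j\<in>I. A j i = cnj (A i j))"

lemma hermitian_formD: "hermitian_form I A \<Longrightarrow> i \<in> I \<Longrightarrow> j \<in> I \<Longrightarrow> cnj (A i j) = A j i"
  unfolding hermitian_form_def by (rule sym) blast

abbreviation ip :: "'i set \<Rightarrow> ('i \<Rightarrow> complex) \<Rightarrow> ('i \<Rightarrow> complex) \<Rightarrow> complex" where
  "ip I u v \<equiv> \<Sum>i\<in>I. cnj (u i) * v i"

abbreviation sqnorm :: "'i set \<Rightarrow> ('i \<Rightarrow> complex) \<Rightarrow> real" where
  "sqnorm I v \<equiv> \<Sum>i\<in>I. (cmod (v i))\<^sup>2"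

lemma qform_add: "qform I (\<lambda>i j. A i j + B i j) v = qform I A v + qform I B v"
  by (simp add: qform_def algebra_simps sum.distrib)

lemma qform_diff: "qform I (\<lambda>i j. A i j - B i j) v = qform I A v - qform I B v"
  by (simp add: qform_def algebra_simps sum_subtractf)

lemma qform_scale: "qform I (\<lambda>i j. c * A i j) v = c * qform I A v"
  by (simp add: qform_def sum_distrib_left mult.assoc mult.left_commute)

lemma cnj_mult_self: "cnj z * z = of_real ((cmod z)\<^sup>2)"
  by (subst complex_norm_square) (rule mult.commute)

lemma qform_id: "finite I \<Longrightarrow> qform I id_form v = (\<Sum>i\<in>I. complex_of_real ((cmod (v i))\<^sup>2))"
  unfolding qform_def id_form_def of_bool_def
  by (simp add: if_distrib[of "\<lambda>x. _ * x"] if_distrib[of "\<lambda>x. x * _"] cnj_mult_self cong: if_cong)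

lemma qform_cong: "(\<And>i j. i \<in> I \<Longrightarrow> j \<in> I \<Longrightarrow> A i j = B i j) \<Longrightarrow> (\<And>i. i \<in> I \<Longrightarrow> v i = w i) \<Longrightarrow> qform I A v = qform I B w"
  unfolding qform_def by (intro sum.cong refl) auto

lemma pos_form_cong: "(\<And>i j. i \<in> I \<Longrightarrow> j \<in> I \<Longrightarrow> A i j = B i j) \<Longrightarrow> pos_form I A \<longleftrightarrow> pos_form I B"
proof -
  assume "\<And>i j. i \<in> I \<Longrightarrow> j \<in> I \<Longrightarrow> A i j = B i j"
  hence "qform I A v = qform I B v" for v by (intro qform_cong) auto
  thus ?thesis by (simp add: pos_form_def)
qed

lemma trp_cong: "(\<And>i j. i \<in> I \<Longrightarrow> j \<in> I \<Longrightarrow> A i j = A' i j) \<Longrightarrow> (\<And>i j. i \<in> I \<Longrightarrow> j \<in> I \<Longrightarrow> B i j = B' i j) \<Longrightarrow>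
  trp I A B = trp I A' B'"
  unfolding trp_def by (intro sum.cong refl) auto

lemma trp_add_right: "trp I A (\<lambda>i j. B i j + C i j) = trp I A B + trp I A C"
  by (simp add: trp_def algebra_simps sum.distrib)

lemma trp_diff_right: "trp I A (\<lambda>i j. B i j - C i j) = trp I A B - trp I A C"
  by (simp add: trp_def algebra_simps sum_subtractf)

lemma trp_scale_right: "trp I A (\<lambda>i j. c * B i j) = c * trp I A B"
  by (simp add: trp_def sum_distrib_left mult.left_commute)

lemma trp_sum_right: "trp I A (\<lambda>i j. \<Sum>k\<in>K. B k i j) = (\<Sum>k\<in>K. trp I A (B k))"
  unfolding trp_def sum_distrib_left sum.swap[where A = I and B = K] ..

lemma trp_comm: "trp I A B = trp I B A"
  unfolding trp_def by (subst sum.swap) (simp add: mult.commute)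

lemma trp_scale_left: "trp I (\<lambda>i j. c * A i j) B = c * trp I A B"
  using trp_scale_right[of I B c A] by (simp add: trp_comm)

lemma trp_diff_left: "trp I (\<lambda>i j. A i j - C i j) B = trp I A B - trp I C B"
  using trp_diff_right[of I B A C] by (simp add: trp_comm)

lemma trp_sum_left: "trp I (\<lambda>i j. \<Sum>k\<in>K. A k i j) B = (\<Sum>k\<in>K. trp I (A k) B)"
  using trp_sum_right[of I B A K] by (simp add: trp_comm)

lemma trp_id: "finite I \<Longrightarrow> trp I A id_form = (\<Sum>i\<in>I. A i i)"
  unfolding trp_def id_form_def of_bool_def by (simp add: if_distrib cong: if_cong)

lemma trp_rank_one: "trp I (\<lambda>i j. u i * cnj (u j)) B = qform I B u"
  unfolding trp_def qform_def by (subst sum.swap) (simp add: mult_ac)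

lemma qform_sum: "qform I (\<lambda>i j. \<Sum>k\<in>K. A k i j) v = (\<Sum>k\<in>K. qform I (A k) v)"
  unfolding trp_rank_one[symmetric] by (rule trp_sum_right)

lemma sum_in_subset:
  assumes "finite I" "\<And>i. i \<in> I \<Longrightarrow> i \<notin> J \<Longrightarrow> f i = 0" "J \<subseteq> I"
  shows "sum f I = sum f J"
  using assms by (intro sum.mono_neutral_right) auto

lemma qform_two_points:
  assumes "finite I" "i \<in> I" "j \<in> I" "i \<noteq> j"
  shows "qform I A (\<lambda>k. if k = i then a else if k = j then b else 0) =
     cnj a * A i i * a + cnj a * A i j * b + cnj b * A j i * a + cnj b * A j j * b"
proof -
  let ?v = "\<lambda>k. if k = i then a else if k = j then b else 0"
  have "qform I A ?v = (\<Sum>x\<in>{i, j}. \<Sum>y\<in>{i, j}. cnj (?v x) * A x y * ?v y)"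
    unfolding qform_def using assms
    by (subst sum_in_subset[of I "{i, j}"], simp, simp, simp,
        intro sum.cong refl sum_in_subset) auto
  thus ?thesis using assms(4) by simp
qed

lemma qform_one_point:
  assumes "finite I" "i \<in> I"
  shows "qform I A (\<lambda>k. of_bool (k = i)) = A i i"
  using assms unfolding qform_def of_bool_def
  by (simp add: if_distrib[of "\<lambda>x. _ * x"] if_distrib[of "\<lambda>x. x * _"] if_distrib[of cnj] cong: if_cong)

text \<open>Polarisation: testing \<open>A\<close> on \<open>e\<^sub>i + e\<^sub>j\<close> and \<open>e\<^sub>i + \<i> e\<^sub>j\<close>.\<close>

lemma real_form_hermitian:
  assumes "finite I" "\<And>v. qform I A v \<in> \<real>"
  shows "hermitian_form I A"
  unfolding hermitian_form_def
proof (intro ballI)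
  fix i j assume ij: "i \<in> I" "j \<in> I"
  have d: "Im (A k k) = 0" if "k \<in> I" for k
    using assms(2)[of "\<lambda>l. of_bool (l = k)"] qform_one_point[OF assms(1) that, of A]
    by (simp add: complex_is_Real_iff)
  show "A j i = cnj (A i j)"
  proof (cases "i = j")
    case True
    thus ?thesis using d[of j] ij by (simp add: complex_eq_iff)
  next
    case False
    from assms(2)[of "\<lambda>k. if k = i then 1 else if k = j then 1 else 0"]
      assms(2)[of "\<lambda>k. if k = i then 1 else if k = j then \<i> else 0"]
    have "Im (A i j + A j i) = 0" "Im (A i j * \<i> - \<i> * A j i) = 0"
      unfolding qform_two_points[OF assms(1) ij False] complex_is_Real_iff using d ij by simp_all
    thus ?thesis by (simp add: complex_eq_iff)
  qed
qed

lemma hermitian_form_real: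
  assumes "hermitian_form I A"
  shows "qform I A v \<in> \<real>"
proof -
  have "cnj (qform I A v) = (\<Sum>i\<in>I. \<Sum>j\<in>I. cnj (v j) * A j i * v i)"
    unfolding qform_def by (simp add: hermitian_formD[OF assms] mult_ac cong: sum.cong)
  also have "\<dots> = qform I A v"
    unfolding qform_def by (rule sum.swap)
  finally show ?thesis by (simp add: Reals_cnj_iff)
qed

lemma pos_form_hermitian: "finite I \<Longrightarrow> pos_form I A \<Longrightarrow> hermitian_form I A"
  by (rule real_form_hermitian) (auto simp: pos_form_def intro: nonnegative_complex_is_real)

text \<open>The form in which contractions are checked: the values of a Hermitian form are real, and
  the two order bounds merge into one bound on the absolute value.\<close>

lemma contraction_iff:
  assumes "finite I"
  shows "contraction I T \<longleftrightarrow> hermitian_form I T \<and> (\<forall>v. \<bar>Re (qform I T v)\<bar> \<le> sqnorm I v)"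
proof -
  have id: "qform I id_form v = of_real (sqnorm I v)" for v
    by (simp add: qform_id[OF assms])
  have real: "(\<forall>v. qform I T v \<in> \<real>) \<longleftrightarrow> hermitian_form I T"
    using real_form_hermitian[OF assms] hermitian_form_real by blast
  have "contraction I T \<longleftrightarrow> (\<forall>v. qform I T v \<in> \<real> \<and> \<bar>Re (qform I T v)\<bar> \<le> sqnorm I v)"
  proof -
    have "0 \<le> complex_of_real s - q \<and> 0 \<le> complex_of_real s + q \<longleftrightarrow> q \<in> \<real> \<and> \<bar>Re q\<bar> \<le> s" for s q
      by (auto simp: less_eq_complex_def complex_is_Real_iff)
    thus ?thesis
      unfolding contraction_def pos_form_def qform_diff qform_add id all_conj_distrib[symmetric] by presburger
  qed
  thus ?thesis using real by blast
qed

definition apply_form :: "'i set \<Rightarrow> ('i \<Rightarrow> 'i \<Rightarrow> complex) \<Rightarrow> ('i \<Rightarrow> complex) \<Rightarrow> 'i \<Rightarrow> complex" where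
  "apply_form I A v i = (\<Sum>j\<in>I. A i j * v j)"

lemma qform_apply: "qform I A v = ip I v (apply_form I A v)"
  by (simp add: qform_def apply_form_def sum_distrib_left mult.assoc)

lemma hermitian_apply_swap:
  assumes "hermitian_form I A"
  shows "ip I w (apply_form I A v) = ip I (apply_form I A w) v"
proof -
  have "ip I w (apply_form I A v) = (\<Sum>i\<in>I. \<Sum>j\<in>I. cnj (w i) * A i j * v j)"
    by (simp add: apply_form_def sum_distrib_left mult.assoc)
  also have "\<dots> = (\<Sum>j\<in>I. \<Sum>i\<in>I. cnj (w i) * A i j * v j)"
    by (rule sum.swap)
  also have "\<dots> = ip I (apply_form I A w) v"
    by (simp add: apply_form_def sum_distrib_right sum_distrib_left hermitian_formD[OF assms] mult_ac cong: sum.cong)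
  finally show ?thesis .
qed


section \<open>The spectral theorem\<close>

lemma mat_mult_entry:
  assumes "A \<in> carrier_mat n m" "B \<in> carrier_mat m k" "i < n" "j < k"
  shows "(A * B) $$ (i, j) = (\<Sum>l<m. A $$ (i, l) * B $$ (l, j))"
  using assms by (simp add: scalar_prod_def lessThan_atLeast0)

lemma mat_trace_mult_trp:
  assumes "A \<in> carrier_mat D D" "B \<in> carrier_mat D D"
  shows "mat_trace (A * B) = trp {..<D} (\<lambda>i j. A $$ (i, j)) (\<lambda>i j. B $$ (i, j))"
  unfolding mat_trace_def trp_def using assms
  by (intro sum.cong) (auto simp: scalar_prod_def lessThan_atLeast0)

lemma mat_trace_mult_comm:
  assumes "A \<in> carrier_mat D D" "B \<in> carrier_mat D D"
  shows "mat_trace (A * B) = mat_trace (B * A :: complex mat)"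
  using assms by (simp add: mat_trace_mult_trp trp_comm)

text \<open>If all eigenvalues vanish, the Schur form of \<open>A\<close> is strictly upper triangular, hence
  \<open>tr (A\<^sup>2) = 0\<close>; but \<open>tr (A\<^sup>2)\<close> is the sum of the squared moduli of the entries of \<open>A\<close>.\<close>

lemma hermitian_nonzero_eigenvector:
  fixes A :: "complex mat"
  assumes A: "A \<in> carrier_mat n n" and h: "hermitian_form {..<n} (\<lambda>i j. A $$ (i, j))"
    and nz: "A \<noteq> 0\<^sub>m n n"
  shows "\<exists>e v. e \<noteq> 0 \<and> v \<in> carrier_vec n \<and> v \<noteq> 0\<^sub>v n \<and> A *\<^sub>v v = e \<cdot>\<^sub>v v"
proof (rule ccontr)
  assume no: "\<not> ?thesis"
  obtain es where es: "char_poly A = (\<Prod>e \<leftarrow> es. [:- e, 1:])"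
    using char_poly_factorized[OF A] by auto
  have es0: "e = 0" if "e \<in> set es" for e
  proof (rule ccontr)
    assume "e \<noteq> 0"
    have "poly (char_poly A) e = 0"
      unfolding es using that by (auto simp: poly_prod_list prod_list_zero_iff comp_def image_iff)
    hence "eigenvalue A e" using eigenvalue_root_char_poly[OF A] by simp
    then obtain v where "eigenvector A v e" unfolding eigenvalue_def by blast
    thus False using no \<open>e \<noteq> 0\<close> A unfolding eigenvector_def by auto
  qed
  obtain B P Q where "schur_decomposition A es = (B, P, Q)" by (cases "schur_decomposition A es") auto
  from schur_decomposition[OF A es this]
  have sim: "similar_mat_wit A B P Q" and ut: "upper_triangular B" and diag: "diag_mat B = es" by auto
  note c = similar_mat_witD2[OF A sim]
  have B0: "B $$ (i, j) * B $$ (j, i) = 0" if "i < n" "j < n" for i j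
  proof -
    have "B $$ (i, i) = 0" using diag es0 that c unfolding diag_mat_def by force
    moreover have "B $$ (i, j) = 0" if "j < i" "i < n" for i j
      using upper_triangularD[OF ut that(1)] that c by auto
    ultimately show ?thesis using that by (cases i j rule: linorder_cases) auto
  qed
  have BB: "mat_trace (B * B) = 0"
    unfolding mat_trace_def using c B0 by (auto intro!: sum.neutral simp: scalar_prod_def)
  have "mat_trace (A * A) = mat_trace (B * B)"
  proof -
    have "A * A = P * (B * B * Q)"
    proof -
      have QP: "Q * (P * (B * Q)) = B * Q"
        using c assoc_mult_mat[of Q n n P n "B * Q" n] by simp
      have "A * A = P * B * Q * (P * B * Q)" using c by simp
      also have "\<dots> = P * (B * (Q * (P * (B * Q))))"
        using c by (simp add: assoc_mult_mat[of _ n n _ n _ n])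
      also have "\<dots> = P * (B * B * Q)"
        unfolding QP using c by (simp add: assoc_mult_mat[of _ n n _ n _ n])
      finally show ?thesis .
    qed
    hence "mat_trace (A * A) = mat_trace (B * B * Q * P)"
      using c by (simp add: mat_trace_mult_comm[of P n])
    also have "B * B * Q * P = B * B"
      using c by (simp add: assoc_mult_mat[of _ n n _ n _ n])
    finally show ?thesis .
  qed
  moreover have "mat_trace (A * A) = of_real (\<Sum>i<n. \<Sum>j<n. (cmod (A $$ (i, j)))\<^sup>2)"
    unfolding mat_trace_mult_trp[OF A A] trp_def of_real_sum complex_norm_square
    using hermitian_formD[OF h] by (intro sum.cong refl) simp
  ultimately have "(\<Sum>i<n. \<Sum>j<n. (cmod (A $$ (i, j)))\<^sup>2) = 0"
    using BB by (metis of_real_eq_0_iff)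
  hence "A $$ (i, j) = 0" if "i < n" "j < n" for i j
    using that by (simp add: sum_nonneg_eq_0_iff sum_nonneg)
  hence "A = 0\<^sub>m n n" using A by (intro eq_matI) auto
  with nz show False ..
qed

text \<open>The eigenvalue is real because its product with the squared norm \<open>N\<close> of the
  eigenvector is a value of the quadratic form.\<close>

lemma hermitian_form_nonzero_eigenvector:
  fixes A :: "nat \<Rightarrow> nat \<Rightarrow> complex"
  assumes h: "hermitian_form {..<n} A" and nz: "i < n" "j < n" "A i j \<noteq> 0"
  shows "\<exists>e::real. \<exists>v. e \<noteq> 0 \<and> sqnorm {..<n} v = 1 \<and>
    (\<forall>i<n. apply_form {..<n} A v i = of_real e * v i)"
proof -
  define M where "M = Matrix.mat n n (\<lambda>(i, j). A i j)"
  have M: "M \<in> carrier_mat n n" by (simp add: M_def)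
  have "hermitian_form {..<n} (\<lambda>i j. M $$ (i, j))"
    using hermitian_formD[OF h] by (simp add: hermitian_form_def M_def)
  moreover have "M \<noteq> 0\<^sub>m n n"
    using nz by (auto simp: M_def dest: arg_cong[of _ _ "\<lambda>M. M $$ (i, j)"])
  ultimately obtain e w where e: "e \<noteq> 0" "w \<in> carrier_vec n" "w \<noteq> 0\<^sub>v n" "M *\<^sub>v w = e \<cdot>\<^sub>v w"
    using hermitian_nonzero_eigenvector[OF M] by blast
  have ap: "apply_form {..<n} A (($) w) i = e * w $ i" if "i < n" for i
  proof -
    have "(M *\<^sub>v w) $ i = e * w $ i" using e that by simp
    thus ?thesis using that e(2) by (simp add: M_def apply_form_def scalar_prod_def lessThan_atLeast0)
  qed
  define N where "N = (\<Sum>i<n. (cmod (w $ i))\<^sup>2)"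
  have N: "N > 0"
  proof -
    obtain i where "i < n" "w $ i \<noteq> 0"
      using e(2,3) by (metis eq_vecI index_zero_vec carrier_vecD)
    thus ?thesis unfolding N_def by (intro sum_pos2[of _ i]) auto
  qed
  have "qform {..<n} A (($) w) = e * of_real N"
    unfolding qform_apply N_def using ap
    by (simp add: sum_distrib_left complex_norm_square[unfolded of_real_power] mult_ac)
  moreover have "qform {..<n} A (($) w) \<in> \<real>" by (rule hermitian_form_real[OF h])
  ultimately have "e \<in> \<real>"
    using N by (simp add: complex_is_Real_iff)
  then obtain r where r: "e = of_real r" by (auto elim: Reals_cases)
  define v where "v i = w $ i / of_real (sqrt N)" for i
  have "sqnorm {..<n} v = (\<Sum>i<n. (cmod (w $ i))\<^sup>2 / N)"
    using N by (simp add: v_def norm_divide power_divide)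
  also have "\<dots> = 1" using N by (simp add: sum_divide_distrib[symmetric] N_def[symmetric])
  finally have "sqnorm {..<n} v = 1" .
  moreover have "apply_form {..<n} A v i = of_real r * v i" if "i < n" for i
  proof -
    have "apply_form {..<n} A v i = apply_form {..<n} A (($) w) i / of_real (sqrt N)"
      by (simp add: apply_form_def v_def sum_divide_distrib)
    thus ?thesis using ap[OF that] by (simp add: v_def r)
  qed
  moreover have "r \<noteq> 0" using e r by simp
  ultimately show ?thesis by blast
qed

text \<open>Parseval: orthogonality leaves only the diagonal terms of the expanded squares. The case
  \<open>N = 1\<close> gives Bessel's inequality, the case of sign vectors the second-moment bound
  for the operators \<open>F y\<close>.\<close>

lemma sum_orthogonal_sq:
  fixes \<psi> :: "'x \<Rightarrow> 'y \<Rightarrow> complex" and b :: "'x \<Rightarrow> complex"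
  assumes X: "finite X"
    and orth: "\<And>x x'. x \<in> X \<Longrightarrow> x' \<in> X \<Longrightarrow> (\<Sum>y\<in>Y. cnj (\<psi> x y) * \<psi> x' y) = (if x = x' then of_real N else 0)"
  shows "(\<Sum>y\<in>Y. (cmod (\<Sum>x\<in>X. \<psi> x y * b x))\<^sup>2) = N * sqnorm X b"
proof -
  have "complex_of_real (\<Sum>y\<in>Y. (cmod (\<Sum>x\<in>X. \<psi> x y * b x))\<^sup>2) =
    (\<Sum>y\<in>Y. \<Sum>x\<in>X. \<Sum>x'\<in>X. cnj (\<psi> x y) * \<psi> x' y * (cnj (b x) * b x'))"
    unfolding of_real_sum cnj_mult_self[symmetric] cnj_sum sum_product by (intro sum.cong refl) simp
  also have "\<dots> = (\<Sum>x\<in>X. \<Sum>x'\<in>X. \<Sum>y\<in>Y. cnj (\<psi> x y) * \<psi> x' y * (cnj (b x) * b x'))"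
    unfolding sum.swap[where A = Y and B = X] ..
  also have "\<dots> = (\<Sum>x\<in>X. \<Sum>x'\<in>X. if x' = x then of_real N * (cnj (b x) * b x) else 0)"
    unfolding sum_distrib_right[symmetric] by (intro sum.cong refl) (simp add: orth)
  also have "\<dots> = of_real (N * sqnorm X b)"
    unfolding cnj_mult_self using X by (simp add: sum_distrib_left)
  finally show ?thesis unfolding of_real_eq_iff .
qed

definition orthonormal :: "nat \<Rightarrow> nat \<Rightarrow> (nat \<Rightarrow> nat \<Rightarrow> complex) \<Rightarrow> bool" where
  "orthonormal n r w \<longleftrightarrow> (\<forall>k<r. \<forall>l<r. ip {..<n} (w k) (w l) = of_bool (k = l))"

lemma orthonormal_norm:
  assumes "orthonormal n r w" "k < r"
  shows "sqnorm {..<n} (w k) = 1"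
proof -
  have "complex_of_real (sqnorm {..<n} (w k)) = ip {..<n} (w k) (w k)"
    unfolding cnj_mult_self by simp
  also have "\<dots> = 1" using assms by (simp add: orthonormal_def)
  finally show ?thesis unfolding of_real_eq_1_iff .
qed

text \<open>Here \<open>u\<close> is the projection of \<open>v\<close> to the span of the
  \<open>w k\<close>, and the claim is that \<open>v - u\<close> has a nonnegative squared
  norm.\<close>

lemma bessel:
  assumes w: "orthonormal n r w"
  shows "(\<Sum>k<r. (cmod (ip {..<n} (w k) v))\<^sup>2) \<le> sqnorm {..<n} v"
proof -
  define c where "c k = ip {..<n} (w k) v" for k
  define u where "u i = (\<Sum>k<r. c k * w k i)" for i
  have cu: "ip {..<n} u v = ip {..<r} c c"
  proof -
    have "ip {..<n} u v = (\<Sum>i<n. \<Sum>k<r. cnj (c k) * (cnj (w k i) * v i))"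
      by (simp add: u_def sum_distrib_right sum_distrib_left mult_ac)
    also have "\<dots> = ip {..<r} c c"
      by (subst sum.swap) (simp add: c_def sum_distrib_left)
    finally show ?thesis .
  qed
  have "sqnorm {..<n} u = 1 * sqnorm {..<r} c"
    unfolding u_def mult.commute[of "c _"] by (rule sum_orthogonal_sq) (use w in \<open>simp_all add: orthonormal_def\<close>)
  hence uu: "ip {..<n} u u = ip {..<r} c c"
    unfolding cnj_mult_self of_real_sum[symmetric] by simp
  have "0 \<le> (\<Sum>i<n. (cmod (v i - u i))\<^sup>2)" by (intro sum_nonneg) auto
  also have "(\<Sum>i<n. (cmod (v i - u i))\<^sup>2) = Re (\<Sum>i<n. cnj (v i - u i) * (v i - u i))"
    unfolding cnj_mult_self by simp
  also have "\<dots> = Re (ip {..<n} v v - ip {..<n} u v - cnj (ip {..<n} u v) + ip {..<n} u u)"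
    by (simp add: algebra_simps sum.distrib sum_subtractf)
  also have "\<dots> = sqnorm {..<n} v - sqnorm {..<r} c"
    unfolding cu uu unfolding cnj_mult_self by simp
  finally show ?thesis by (simp add: c_def)
qed

text \<open>Bessel's inequality for every standard basis vector, summed over the basis. It bounds
  the number of deflation steps.\<close>

lemma orthonormal_le:
  assumes w: "orthonormal n r w"
  shows "r \<le> n"
proof -
  have "(\<Sum>k<r. (cmod (w k i))\<^sup>2) \<le> 1" if i: "i < n" for i
    using bessel[OF w, of "\<lambda>j. of_bool (j = i)"] i
    by (simp add: of_bool_def if_distrib[of "\<lambda>x. _ * x"] if_distrib[of "\<lambda>x. (cmod x)\<^sup>2"] cong: if_cong)
  hence "(\<Sum>i<n. \<Sum>k<r. (cmod (w k i))\<^sup>2) \<le> (\<Sum>i<n. 1)" by (intro sum_mono) auto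
  also have "(\<Sum>i<n. \<Sum>k<r. (cmod (w k i))\<^sup>2) = (\<Sum>k<r. \<Sum>i<n. (cmod (w k i))\<^sup>2)" by (rule sum.swap)
  also have "\<dots> = (\<Sum>k<r. 1)"
    using orthonormal_norm[OF w] by simp
  finally show ?thesis by simp
qed

text \<open>A sum of weighted rank-one projections. The vectors \<open>w k\<close> need not form a
  basis, so the kernel of a matrix never has to be diagonalised.\<close>

definition spectral :: "nat \<Rightarrow> (nat \<Rightarrow> nat \<Rightarrow> complex) \<Rightarrow> (nat \<Rightarrow> real) \<Rightarrow> nat \<Rightarrow> nat \<Rightarrow> complex" where
  "spectral r w lam i j = (\<Sum>k<r. of_real (lam k) * (w k i * cnj (w k j)))"

text \<open>Deflation: as long as the remainder \<open>R\<close> is not zero, it has an eigenvector \<open>v\<close> with nonzero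
  eigenvalue \<open>e\<close>, orthogonal to the kernel of \<open>R\<close>; and \<open>R - e v v\<^sup>*\<close> annihilates \<open>v\<close> and that kernel.\<close>

lemma spectral_aux:
  assumes "orthonormal n r w" "hermitian_form {..<n} R"
    "\<And>k i. k < r \<Longrightarrow> i < n \<Longrightarrow> apply_form {..<n} R (w k) i = 0"
    "\<And>i j. i < n \<Longrightarrow> j < n \<Longrightarrow> A i j = spectral r w lam i j + R i j"
  shows "\<exists>r w lam. orthonormal n r w \<and> (\<forall>i<n. \<forall>j<n. A i j = spectral r w lam i j)"
  using assms
proof (induction "n - r" arbitrary: r w lam R rule: less_induct)
  case less
  show ?case
  proof (cases "\<forall>i<n. \<forall>j<n. R i j = 0")
    case True
    thus ?thesis using less.prems(1,4) by (intro exI[of _ r] exI[of _ w] exI[of _ lam]) simp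
  next
    case False
    then obtain i0 j0 where "i0 < n" "j0 < n" "R i0 j0 \<noteq> 0" by blast
    from hermitian_form_nonzero_eigenvector[OF less.prems(2) this]
    obtain e :: real and v where e: "e \<noteq> 0" and v1: "sqnorm {..<n} v = 1"
      and ev: "\<And>i. i < n \<Longrightarrow> apply_form {..<n} R v i = of_real e * v i" by blast
    have vv: "ip {..<n} v v = 1"
      unfolding cnj_mult_self of_real_sum[symmetric] v1 by simp
    have orth: "ip {..<n} (w k) v = 0" if "k < r" for k
    proof -
      have "of_real e * ip {..<n} (w k) v = ip {..<n} (w k) (apply_form {..<n} R v)"
        using ev by (simp add: sum_distrib_left mult_ac)
      also have "\<dots> = ip {..<n} (apply_form {..<n} R (w k)) v"
        by (rule hermitian_apply_swap[OF less.prems(2)])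
      also have "\<dots> = 0" using less.prems(3)[OF that] by simp
      finally show ?thesis using e by simp
    qed
    have orth': "ip {..<n} v (w k) = 0" if "k < r" for k
    proof -
      have "ip {..<n} v (w k) = cnj (ip {..<n} (w k) v)" by (simp add: mult.commute)
      thus ?thesis using orth[OF that] by simp
    qed
    let ?w = "w(r := v)" and ?lam = "lam(r := e)"
    have w: "orthonormal n (Suc r) ?w"
      using less.prems(1) orth orth' vv unfolding orthonormal_def by (auto simp: less_Suc_eq)
    define R1 where "R1 i j = R i j - of_real e * v i * cnj (v j)" for i j
    have ap: "apply_form {..<n} R1 f i = apply_form {..<n} R f i - of_real e * v i * ip {..<n} v f" for f i
      by (simp add: apply_form_def R1_def algebra_simps sum_subtractf sum_distrib_left)
    show ?thesis
    proof (rule less.hyps[OF _ w])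
      show "n - Suc r < n - r"
        using orthonormal_le[OF w] by simp
      show "hermitian_form {..<n} R1"
        unfolding hermitian_form_def R1_def by (simp add: hermitian_formD[OF less.prems(2)] mult_ac)
      show "apply_form {..<n} R1 (?w k) i = 0" if "k < Suc r" "i < n" for k i
        using that less.prems(3) orth' ev vv unfolding ap by (auto simp: less_Suc_eq)
      show "A i j = spectral (Suc r) ?w ?lam i j + R1 i j" if "i < n" "j < n" for i j
        using less.prems(4)[OF that] by (simp add: spectral_def R1_def)
    qed
  qed
qed

lemma hermitian_spectral:
  assumes "hermitian_form {..<n} A"
  obtains r w lam where "orthonormal n r w" "\<And>i j. i < n \<Longrightarrow> j < n \<Longrightarrow> A i j = spectral r w lam i j"
  using spectral_aux[of n 0 "\<lambda>_ _. 0" A A "\<lambda>_. 0"] assms by (auto simp: orthonormal_def spectral_def)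


section \<open>The trace norm\<close>

abbreviation ent :: "complex mat \<Rightarrow> nat \<Rightarrow> nat \<Rightarrow> complex" where
  "ent A \<equiv> \<lambda>i j. A $$ (i, j)"

lemma qform_rank_one: "qform I (\<lambda>i j. u i * cnj (u j)) v = of_real ((cmod (ip I u v))\<^sup>2)"
proof -
  have "qform I (\<lambda>i j. u i * cnj (u j)) v = ip I v u * ip I u v"
    unfolding qform_def sum_product by (simp add: mult_ac)
  also have "ip I v u = cnj (ip I u v)"
    by (simp add: mult.commute)
  also have "\<dots> * ip I u v = of_real ((cmod (ip I u v))\<^sup>2)"
    by (rule cnj_mult_self)
  finally show ?thesis .
qed

lemma qform_spectral:
  "qform {..<n} (spectral r w lam) v = of_real (\<Sum>k<r. lam k * (cmod (ip {..<n} (w k) v))\<^sup>2)"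
  unfolding spectral_def by (simp only: qform_sum qform_scale qform_rank_one of_real_sum of_real_mult)

lemma qform_spectral_basis:
  assumes "orthonormal n r w" "k < r"
  shows "qform {..<n} (spectral r w lam) (w k) = of_real (lam k)"
proof -
  have "(\<Sum>l<r. lam l * (cmod (ip {..<n} (w l) (w k)))\<^sup>2) = (\<Sum>l<r. if l = k then lam k else 0)"
    using assms unfolding orthonormal_def by (intro sum.cong) auto
  thus ?thesis unfolding qform_spectral using assms(2) by simp
qed

text \<open>Functional calculus on a fixed orthonormal family. It yields the square of
  \<open>T\<close> in \<open>contraction_norm\<close> and the square of the absolute value of
  \<open>A\<close> in \<open>tr_norm_spectral\<close>.\<close>

lemma spectral_mult:
  assumes "orthonormal n r w"
  shows "(\<Sum>l<n. spectral r w a i l * spectral r w b l j) = spectral r w (\<lambda>k. a k * b k) i j"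
proof -
  have "(\<Sum>l<n. spectral r w a i l * spectral r w b l j) =
     (\<Sum>l<n. \<Sum>k<r. \<Sum>m<r. of_real (a k * b m) * (w k i * cnj (w m j)) * (cnj (w k l) * w m l))"
    unfolding spectral_def sum_product by (intro sum.cong refl) simp
  also have "\<dots> = (\<Sum>k<r. \<Sum>m<r. \<Sum>l<n. of_real (a k * b m) * (w k i * cnj (w m j)) * (cnj (w k l) * w m l))"
    unfolding sum.swap[where A = "{..<n}" and B = "{..<r}"] ..
  also have "\<dots> = (\<Sum>k<r. \<Sum>m<r. of_real (a k * b m) * (w k i * cnj (w m j)) * of_bool (k = m))"
    using assms by (intro sum.cong refl) (simp add: orthonormal_def sum_distrib_left[symmetric])
  also have "\<dots> = (\<Sum>k<r. \<Sum>m<r. if m = k then of_real (a k * b k) * (w k i * cnj (w k j)) else 0)"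
    by (intro sum.cong refl) auto
  also have "\<dots> = spectral r w (\<lambda>k. a k * b k) i j"
    by (simp add: spectral_def)
  finally show ?thesis .
qed

lemma trp_spectral: "trp {..<n} (spectral r w lam) T = (\<Sum>k<r. of_real (lam k) * qform {..<n} T (w k))"
  unfolding spectral_def by (simp only: trp_sum_left trp_scale_left trp_rank_one)

text \<open>Diagonalising \<open>A\<close> turns the trace into a sum of nonnegative eigenvalues
  times values of the form \<open>B\<close>.\<close>

lemma trp_nonneg:
  fixes n :: nat
  assumes A: "pos_form {..<n} A" and B: "pos_form {..<n} B"
  shows "0 \<le> trp {..<n} A B"
proof -
  obtain r w lam where w: "orthonormal n r w" and eq: "\<And>i j. i < n \<Longrightarrow> j < n \<Longrightarrow> A i j = spectral r w lam i j"
    using hermitian_spectral[OF pos_form_hermitian[OF _ A]] by auto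
  have "lam k \<ge> 0" if "k < r" for k
  proof -
    have "0 \<le> qform {..<n} A (w k)" using A by (simp add: pos_form_def)
    also have "qform {..<n} A (w k) = qform {..<n} (spectral r w lam) (w k)"
      by (rule qform_cong) (use eq in auto)
    also have "\<dots> = of_real (lam k)" by (rule qform_spectral_basis[OF w that])
    finally show ?thesis by (simp add: less_eq_complex_def)
  qed
  moreover have "trp {..<n} A B = trp {..<n} (spectral r w lam) B"
    by (rule trp_cong) (use eq in auto)
  moreover have "0 \<le> qform {..<n} B (w k)" for k using B by (simp add: pos_form_def)
  ultimately show ?thesis unfolding trp_spectral
    by (auto intro!: sum_nonneg mult_nonneg_nonneg simp: less_eq_complex_def)
qed

lemma trp_mono:
  fixes n :: nat
  assumes "pos_form {..<n} A" "pos_form {..<n} (\<lambda>i j. C i j - B i j)"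
  shows "Re (trp {..<n} A B) \<le> Re (trp {..<n} A C)"
  using trp_nonneg[OF assms] unfolding trp_diff_right by (simp add: less_eq_complex_def)

lemma vec_qform:
  assumes "A \<in> carrier_mat D D" "v \<in> carrier_vec D"
  shows "(A *\<^sub>v v) \<bullet>c v = qform {..<D} (ent A) (\<lambda>i. v $ i)"
proof -
  have "(A *\<^sub>v v) \<bullet>c v = (\<Sum>i<D. (\<Sum>j<D. A $$ (i, j) * v $ j) * cnj (v $ i))"
    using assms by (simp add: scalar_prod_def lessThan_atLeast0)
  also have "\<dots> = qform {..<D} (ent A) (\<lambda>i. v $ i)"
    by (simp add: qform_def sum_distrib_right sum_distrib_left mult_ac)
  finally show ?thesis .
qed

lemma psd_iff: "psd D A \<longleftrightarrow> A \<in> carrier_mat D D \<and> pos_form {..<D} (ent A)"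
proof -
  have "(\<forall>v\<in>carrier_vec D. 0 \<le> (A *\<^sub>v v) \<bullet>c v) \<longleftrightarrow> pos_form {..<D} (ent A)"
    if A: "A \<in> carrier_mat D D"
  proof
    assume l: "\<forall>v\<in>carrier_vec D. 0 \<le> (A *\<^sub>v v) \<bullet>c v"
    show "pos_form {..<D} (ent A)"
      unfolding pos_form_def
    proof
      fix v :: "nat \<Rightarrow> complex"
      have "0 \<le> (A *\<^sub>v vec D v) \<bullet>c vec D v" using l by simp
      also have "\<dots> = qform {..<D} (ent A) (\<lambda>i. vec D v $ i)"
        by (rule vec_qform[OF A]) simp
      also have "\<dots> = qform {..<D} (ent A) v"
        by (rule qform_cong) auto
      finally show "0 \<le> qform {..<D} (ent A) v" .
    qed
  next
    assume "pos_form {..<D} (ent A)"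
    thus "\<forall>v\<in>carrier_vec D. 0 \<le> (A *\<^sub>v v) \<bullet>c v"
      unfolding pos_form_def by (simp add: vec_qform[OF A])
  qed
  thus ?thesis unfolding psd_def by blast
qed

lemma apply_form_comp:
  "apply_form I A (apply_form I B v) i = apply_form I (\<lambda>i j. \<Sum>k\<in>I. A i k * B k j) v i"
proof -
  have "apply_form I A (apply_form I B v) i = (\<Sum>k\<in>I. \<Sum>j\<in>I. A i k * B k j * v j)"
    by (simp add: apply_form_def sum_distrib_left mult.assoc)
  also have "\<dots> = (\<Sum>j\<in>I. \<Sum>k\<in>I. A i k * B k j * v j)"
    by (rule sum.swap)
  finally show ?thesis by (simp add: apply_form_def sum_distrib_right)
qed

lemma qform_square:
  assumes "hermitian_form I A"
  shows "qform I (\<lambda>i j. \<Sum>k\<in>I. A i k * A k j) v = ip I (apply_form I A v) (apply_form I A v)"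
  unfolding qform_apply apply_form_comp[symmetric] by (rule hermitian_apply_swap[OF assms])

text \<open>The bound on the form, tested on the eigenvectors, bounds all eigenvalues by 1 in
  absolute value, and Bessel's inequality does the rest. The second-moment estimate uses
  \<open>T\<^sup>2 \<le> 1\<close> in this shape.\<close>

lemma contraction_norm:
  fixes n :: nat
  assumes T: "contraction {..<n} T"
  shows "sqnorm {..<n} (apply_form {..<n} T v) \<le> sqnorm {..<n} v"
proof -
  have h: "hermitian_form {..<n} T" and le: "\<bar>Re (qform {..<n} T v)\<bar> \<le> sqnorm {..<n} v" for v
    using T by (auto simp: contraction_iff)
  obtain r w lam where w: "orthonormal n r w" and eq: "\<And>i j. i < n \<Longrightarrow> j < n \<Longrightarrow> T i j = spectral r w lam i j"
    using hermitian_spectral[OF h] by auto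
  have q: "qform {..<n} T u = qform {..<n} (spectral r w lam) u" for u
    by (rule qform_cong) (use eq in auto)
  have lam: "\<bar>lam k\<bar> \<le> 1" if "k < r" for k
    using le[of "w k"] by (simp add: q qform_spectral_basis[OF w that] orthonormal_norm[OF w that])
  have "complex_of_real (sqnorm {..<n} (apply_form {..<n} T v)) = qform {..<n} (\<lambda>i j. \<Sum>k<n. T i k * T k j) v"
    unfolding qform_square[OF h] cnj_mult_self by simp
  also have "\<dots> = qform {..<n} (spectral r w (\<lambda>k. lam k * lam k)) v"
    by (rule qform_cong) (simp_all add: eq spectral_mult[OF w])
  finally have "sqnorm {..<n} (apply_form {..<n} T v) =
      (\<Sum>k<r. lam k * lam k * (cmod (ip {..<n} (w k) v))\<^sup>2)"
    unfolding qform_spectral of_real_eq_iff .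
  also have "\<dots> \<le> (\<Sum>k<r. 1 * (cmod (ip {..<n} (w k) v))\<^sup>2)"
    using lam by (intro sum_mono mult_right_mono) (auto simp: abs_square_le_1 simp flip: power2_eq_square)
  also have "\<dots> \<le> sqnorm {..<n} v"
    using bessel[OF w] by simp
  finally show ?thesis .
qed

text \<open>A nonzero \<open>B - C\<close> has a unit eigenvector \<open>v\<close> with eigenvalue
  \<open>e\<close> different from 0. Equal squares give \<open>B v\<close> and \<open>C v\<close>
  the same norm; with \<open>B v = C v + e v\<close> this makes the sum of the two forms at
  \<open>v\<close> vanish. Both are nonnegative, so both vanish, although they differ by
  \<open>e\<close>.\<close>

lemma psd_sqrt_unique:
  assumes B: "psd n B" and C: "psd n C" and eq: "B * B = C * C"
  shows "B = C"
proof (rule ccontr)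
  assume "B \<noteq> C"
  note B' = B[unfolded psd_iff] and C' = C[unfolded psd_iff]
  let ?B = "ent B" and ?C = "ent C"
  let ?X = "\<lambda>i j. ?B i j - ?C i j"
  have hB: "hermitian_form {..<n} ?B" and hC: "hermitian_form {..<n} ?C"
    using pos_form_hermitian B' C' by auto
  have hX: "hermitian_form {..<n} ?X"
    unfolding hermitian_form_def by (simp add: hermitian_formD[OF hB] hermitian_formD[OF hC])
  obtain i j where "i < n" "j < n" "?X i j \<noteq> 0"
    using \<open>B \<noteq> C\<close> B' C' by (metis carrier_matD eq_matI eq_iff_diff_eq_0)
  from hermitian_form_nonzero_eigenvector[OF hX this] obtain e :: real and v where
    e: "e \<noteq> 0" "sqnorm {..<n} v = 1" "\<And>i. i < n \<Longrightarrow> apply_form {..<n} ?X v i = of_real e * v i"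
    by blast
  define b c where "b = apply_form {..<n} ?B v" and "c = apply_form {..<n} ?C v"
  have bc: "b i = c i + of_real e * v i" if "i < n" for i
    using e(3)[OF that] by (simp add: b_def c_def apply_form_def algebra_simps sum_subtractf)
  have sq: "(\<Sum>k<n. ?B i k * ?B k j) = (\<Sum>k<n. ?C i k * ?C k j)" if "i < n" "j < n" for i j
    using eq mat_mult_entry[of B n n B n i j] mat_mult_entry[of C n n C n i j] B' C' that by simp
  have "ip {..<n} b b = ip {..<n} c c"
    unfolding b_def c_def qform_square[OF hB, symmetric] qform_square[OF hC, symmetric]
    by (rule qform_cong) (use sq in auto)
  moreover have "ip {..<n} b b =
      (ip {..<n} c c) + of_real e * (ip {..<n} b v + ip {..<n} v c)"
  proof -
    have "ip {..<n} b b = (\<Sum>i<n. cnj (c i) * c i + of_real e * (cnj (b i) * v i + cnj (v i) * c i))"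
      using bc by (intro sum.cong) (auto simp: algebra_simps)
    thus ?thesis by (simp add: sum.distrib sum_distrib_left[symmetric])
  qed
  ultimately have "ip {..<n} b v + ip {..<n} v c = 0"
    using e(1) by simp
  moreover have "ip {..<n} b v = qform {..<n} ?B v"
    unfolding b_def qform_apply by (rule hermitian_apply_swap[OF hB, symmetric])
  moreover have "ip {..<n} v c = qform {..<n} ?C v"
    unfolding c_def qform_apply ..
  moreover have "0 \<le> qform {..<n} ?B v" "0 \<le> qform {..<n} ?C v"
    using B' C' by (auto simp: pos_form_def)
  ultimately have zero: "qform {..<n} ?B v = 0" "qform {..<n} ?C v = 0"
    by (auto simp: less_eq_complex_def complex_eq_iff)
  have "qform {..<n} ?B v - qform {..<n} ?C v = qform {..<n} ?X v"
    by (rule qform_diff[symmetric])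
  also have "\<dots> = of_real e * ip {..<n} v v"
    unfolding qform_apply using e(3) by (simp add: sum_distrib_left mult_ac)
  finally show False using e zero unfolding cnj_mult_self of_real_sum[symmetric] by simp
qed

lemma mat_adjoint_hermitian:
  assumes "A \<in> carrier_mat n n" "hermitian_form {..<n} (ent A)"
  shows "mat_adjoint A = A"
proof (rule eq_matI)
  fix i j assume "i < dim_row A" "j < dim_col A"
  hence ij: "i < n" "j < n" using assms(1) by auto
  have "mat_adjoint A $$ (i, j) = cnj (A $$ (j, i))"
    using assms(1) ij by (simp add: mat_adjoint_def mat_of_rows_index cols_nth)
  thus "mat_adjoint A $$ (i, j) = A $$ (i, j)"
    using hermitian_formD[OF assms(2), of j i] ij by simp
qed (use assms(1) in \<open>auto simp: mat_adjoint_def\<close>)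

text \<open>The absolute values of the eigenvalues give a positive square root of
  \<open>A * A\<close>, which by uniqueness is the one that \<open>psd_sqrt\<close> denotes.\<close>

lemma tr_norm_spectral:
  assumes A: "A \<in> carrier_mat n n" and w: "orthonormal n r w"
    and eq: "\<And>i j. i < n \<Longrightarrow> j < n \<Longrightarrow> A $$ (i, j) = spectral r w lam i j"
    and h: "hermitian_form {..<n} (ent A)"
  shows "tr_norm A = 1/2 * (\<Sum>k<r. \<bar>lam k\<bar>)"
proof -
  define B where "B = Matrix.mat n n (\<lambda>(i, j). spectral r w (\<lambda>k. \<bar>lam k\<bar>) i j)"
  have B: "B \<in> carrier_mat n n" by (simp add: B_def)
  have "pos_form {..<n} (ent B)"
    unfolding pos_form_def
  proof
    fix v
    have "qform {..<n} (ent B) v = qform {..<n} (spectral r w (\<lambda>k. \<bar>lam k\<bar>)) v"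
      by (rule qform_cong) (auto simp: B_def)
    also have "0 \<le> \<dots>"
      unfolding qform_spectral by (simp add: less_eq_complex_def sum_nonneg)
    finally show "0 \<le> qform {..<n} (ent B) v" .
  qed
  hence psdB: "psd n B" using B by (simp add: psd_iff)
  have BB: "B * B = A * A"
  proof (rule eq_matI)
    fix i j assume "i < dim_row (A * A)" "j < dim_col (A * A)"
    hence ij: "i < n" "j < n" using A by auto
    have "(B * B) $$ (i, j) = (\<Sum>l<n. spectral r w (\<lambda>k. \<bar>lam k\<bar>) i l * spectral r w (\<lambda>k. \<bar>lam k\<bar>) l j)"
      unfolding mat_mult_entry[OF B B ij] using ij by (intro sum.cong) (auto simp: B_def)
    also have "\<dots> = (\<Sum>l<n. spectral r w lam i l * spectral r w lam l j)"
      unfolding spectral_mult[OF w] by simp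
    also have "\<dots> = (A * A) $$ (i, j)"
      unfolding mat_mult_entry[OF A A ij] using ij eq by (intro sum.cong) auto
    finally show "(B * B) $$ (i, j) = (A * A) $$ (i, j)" .
  qed (use A B in auto)
  have "psd_sqrt (mat_adjoint A * A) = B"
    unfolding psd_sqrt_def mat_adjoint_hermitian[OF A h]
  proof (rule the_equality)
    show "psd (dim_row (A * A)) B \<and> B * B = A * A" using psdB BB A by simp
    fix C assume "psd (dim_row (A * A)) C \<and> C * C = A * A"
    thus "C = B" using psd_sqrt_unique[of n C B] psdB BB A by simp
  qed
  moreover have "mat_trace B = of_real (\<Sum>k<r. \<bar>lam k\<bar>)"
  proof -
    have "mat_trace B = (\<Sum>i<n. \<Sum>k<r. of_real \<bar>lam k\<bar> * (cnj (w k i) * w k i))"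
      unfolding mat_trace_def using B by (simp add: B_def spectral_def mult.commute)
    also have "\<dots> = (\<Sum>k<r. \<Sum>i<n. of_real \<bar>lam k\<bar> * (cnj (w k i) * w k i))"
      by (rule sum.swap)
    also have "\<dots> = (\<Sum>k<r. of_real \<bar>lam k\<bar>)"
      using w unfolding sum_distrib_left[symmetric] by (simp add: orthonormal_def)
    finally show ?thesis by simp
  qed
  ultimately show ?thesis unfolding tr_norm_def by simp
qed

lemma
  assumes A: "A \<in> carrier_mat n n" and h: "hermitian_form {..<n} (ent A)"
  shows trp_le_tr_norm: "contraction {..<n} T \<Longrightarrow> Re (trp {..<n} (ent A) T) \<le> 2 * tr_norm A"
    and tr_norm_leI: "(\<And>T. contraction {..<n} T \<Longrightarrow> Re (trp {..<n} (ent A) T) \<le> 2 * c) \<Longrightarrow> tr_norm A \<le> c"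
proof -
  obtain r w lam where w: "orthonormal n r w"
    and eq: "\<And>i j. i < n \<Longrightarrow> j < n \<Longrightarrow> A $$ (i, j) = spectral r w lam i j"
    using hermitian_spectral[OF h] by auto
  have tr: "trp {..<n} (ent A) T = (\<Sum>k<r. of_real (lam k) * qform {..<n} T (w k))" for T
    unfolding trp_spectral[symmetric] by (rule trp_cong) (use eq in auto)
  show "Re (trp {..<n} (ent A) T) \<le> 2 * tr_norm A" if T: "contraction {..<n} T"
  proof -
    have "lam k * Re (qform {..<n} T (w k)) \<le> \<bar>lam k\<bar>" if "k < r" for k
    proof -
      have "\<bar>Re (qform {..<n} T (w k))\<bar> \<le> 1"
        using T orthonormal_norm[OF w that] contraction_iff[of "{..<n}" T] by (metis finite_lessThan)
      hence "\<bar>lam k\<bar> * \<bar>Re (qform {..<n} T (w k))\<bar> \<le> \<bar>lam k\<bar> * 1" by (intro mult_left_mono) auto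
      thus ?thesis by (simp add: abs_mult[symmetric])
    qed
    hence "(\<Sum>k<r. lam k * Re (qform {..<n} T (w k))) \<le> (\<Sum>k<r. \<bar>lam k\<bar>)" by (intro sum_mono) auto
    thus ?thesis unfolding tr using tr_norm_spectral[OF A w eq h] by simp
  qed
  assume le: "\<And>T. contraction {..<n} T \<Longrightarrow> Re (trp {..<n} (ent A) T) \<le> 2 * c"
  \<comment> \<open>The sign of \<open>A\<close> attains the maximum over all contractions.\<close>
  let ?T = "spectral r w (\<lambda>k. sgn (lam k))"
  have "contraction {..<n} ?T"
    unfolding contraction_iff[OF finite_lessThan]
  proof (intro conjI allI)
    show "hermitian_form {..<n} ?T"
      by (rule real_form_hermitian) (auto simp: qform_spectral simp del: of_real_sum)
    fix v
    let ?x = "\<lambda>k. (cmod (ip {..<n} (w k) v))\<^sup>2"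
    have "\<bar>Re (qform {..<n} ?T v)\<bar> \<le> (\<Sum>k<r. \<bar>sgn (lam k) * ?x k\<bar>)"
      unfolding qform_spectral Re_complex_of_real by (rule sum_abs)
    also have "\<dots> \<le> (\<Sum>k<r. ?x k)"
      by (intro sum_mono) (auto simp: abs_mult sgn_if)
    also have "\<dots> \<le> sqnorm {..<n} v" by (rule bessel[OF w])
    finally show "\<bar>Re (qform {..<n} ?T v)\<bar> \<le> sqnorm {..<n} v" .
  qed
  from le[OF this] have "(\<Sum>k<r. lam k * sgn (lam k)) \<le> 2 * c"
    unfolding tr using qform_spectral_basis[OF w] by simp
  thus "tr_norm A \<le> c"
    using tr_norm_spectral[OF A w eq h] by (simp add: abs_sgn[symmetric])
qed

section \<open>Restriction and relabelling of forms\<close>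

lemma qform_pullback:
  assumes f: "inj_on f I" "f ` I \<subseteq> J" and J: "finite J"
  shows "qform I (\<lambda>i j. A (f i) (f j)) v = qform J A (\<lambda>k. if k \<in> f ` I then v (inv_into I f k) else 0)"
proof -
  let ?v = "\<lambda>k. if k \<in> f ` I then v (inv_into I f k) else 0"
  have "qform J A ?v = (\<Sum>i\<in>f ` I. \<Sum>j\<in>f ` I. cnj (?v i) * A i j * ?v j)"
  proof -
    have inner: "(\<Sum>j\<in>J. cnj (?v i) * A i j * ?v j) = (\<Sum>j\<in>f ` I. cnj (?v i) * A i j * ?v j)" for i
      by (rule sum_in_subset[OF J _ f(2)]) simp
    show ?thesis unfolding qform_def inner
      by (rule sum_in_subset[OF J _ f(2)]) simp
  qed
  also have "\<dots> = (\<Sum>i\<in>I. \<Sum>j\<in>I. cnj (?v (f i)) * A (f i) (f j) * ?v (f j))"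
    by (simp add: sum.reindex[OF f(1)])
  also have "\<dots> = qform I (\<lambda>i j. A (f i) (f j)) v"
    unfolding qform_def by (intro sum.cong refl) (simp add: inv_into_f_f[OF f(1)])
  finally show ?thesis ..
qed

lemma pos_form_pullback:
  assumes "inj_on f I" "f ` I \<subseteq> J" "finite J" "pos_form J A"
  shows "pos_form I (\<lambda>i j. A (f i) (f j))"
  using assms(4) unfolding pos_form_def qform_pullback[OF assms(1-3)] by blast

text \<open>Diagonal blocks, the passage from single indices to pairs and the exchange of tensor
  factors are all pullbacks along injections.\<close>

lemma contraction_pullback:
  assumes f: "inj_on f I" "f ` I \<subseteq> J" "finite J" and T: "contraction J T"
  shows "contraction I (\<lambda>i j. T (f i) (f j))"
proof -
  have id: "id_form i j = id_form (f i) (f j)" if "i \<in> I" "j \<in> I" for i j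
    using f(1) that by (auto simp: id_form_def dest: inj_onD)
  have "pos_form I (\<lambda>i j. id_form i j - T (f i) (f j)) = pos_form I (\<lambda>i j. id_form (f i) (f j) - T (f i) (f j))"
    "pos_form I (\<lambda>i j. id_form i j + T (f i) (f j)) = pos_form I (\<lambda>i j. id_form (f i) (f j) + T (f i) (f j))"
    by (intro pos_form_cong; simp add: id)+
  thus ?thesis
    using T pos_form_pullback[OF f, of "\<lambda>i j. id_form i j - T i j"]
      pos_form_pullback[OF f, of "\<lambda>i j. id_form i j + T i j"]
    by (simp add: contraction_def)
qed

text \<open>The weights may be signed, which covers Fourier coefficients as well as
  averages.\<close>

lemma contraction_combination:
  assumes I: "finite I" and T: "\<And>k. k \<in> K \<Longrightarrow> contraction I (T k)" and c: "(\<Sum>k\<in>K. \<bar>c k\<bar>) \<le> 1"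
  shows "contraction I (\<lambda>i j. \<Sum>k\<in>K. of_real (c k) * T k i j)"
  unfolding contraction_iff[OF I]
proof (intro conjI allI)
  have T': "hermitian_form I (T k)" "\<bar>Re (qform I (T k) v)\<bar> \<le> sqnorm I v" if "k \<in> K" for k v
    using T[OF that] unfolding contraction_iff[OF I] by auto
  have q: "qform I (\<lambda>i j. \<Sum>k\<in>K. of_real (c k) * T k i j) v = (\<Sum>k\<in>K. of_real (c k) * qform I (T k) v)" for v
    by (simp only: qform_sum qform_scale)
  show "hermitian_form I (\<lambda>i j. \<Sum>k\<in>K. of_real (c k) * T k i j)"
    by (rule real_form_hermitian[OF I]) (auto simp: q intro!: sum_in_Reals Reals_mult hermitian_form_real T')
  fix v
  let ?N = "\<Sum>i\<in>I. (cmod (v i))\<^sup>2"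
  have N: "0 \<le> ?N" by (intro sum_nonneg) auto
  have "\<bar>Re (qform I (\<lambda>i j. \<Sum>k\<in>K. of_real (c k) * T k i j) v)\<bar> \<le> (\<Sum>k\<in>K. \<bar>c k * Re (qform I (T k) v)\<bar>)"
    unfolding q by (simp add: sum_abs)
  also have "\<dots> \<le> (\<Sum>k\<in>K. \<bar>c k\<bar> * ?N)"
    unfolding abs_mult by (intro sum_mono mult_left_mono T') auto
  also have "\<dots> \<le> 1 * ?N"
    unfolding sum_distrib_right[symmetric] by (rule mult_right_mono[OF c N])
  finally show "\<bar>Re (qform I (\<lambda>i j. \<Sum>k\<in>K. of_real (c k) * T k i j) v)\<bar> \<le> ?N" by simp
qed


section \<open>Bit strings, characters and tensor products\<close>

lemma bits_0: "bits 0 = {[]}"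
  by (auto simp: bits_def)

lemma bits_Suc: "bits (Suc n) = (#) 0 ` bits n \<union> (#) 1 ` bits n"
proof (rule equalityI; rule subsetI)
  fix x :: "bit list" assume "x \<in> bits (Suc n)"
  then obtain b y where "x = b # y" "length y = n" by (auto simp: bits_def length_Suc_conv)
  thus "x \<in> (#) 0 ` bits n \<union> (#) 1 ` bits n" by (cases b rule: bit_cases) (auto simp: bits_def)
qed (auto simp: bits_def)

lemma finite_bits [simp]: "finite (bits n)"
  by (induction n) (auto simp: bits_0 bits_Suc)

lemma sum_bits_Suc:
  fixes f :: "bit list \<Rightarrow> 'a::comm_monoid_add"
  shows "(\<Sum>x\<in>bits (Suc n). f x) = (\<Sum>x\<in>bits n. f (0 # x)) + (\<Sum>x\<in>bits n. f (1 # x))"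
  unfolding bits_Suc by (subst sum.union_disjoint) (auto simp: sum.reindex)

lemma sum_bits_add:
  fixes f :: "bit list \<Rightarrow> 'a::comm_monoid_add"
  shows "(\<Sum>x\<in>bits (n + k). f x) = (\<Sum>u\<in>bits n. \<Sum>v\<in>bits k. f (u @ v))"
  by (induction n arbitrary: f) (simp_all add: bits_0 sum_bits_Suc)

lemma card_bits: "card (bits n) = 2 ^ n"
proof (induction n)
  case (Suc n)
  have "card (bits (Suc n)) = card (bits n) + card (bits n)"
    unfolding card_eq_sum by (rule sum_bits_Suc)
  thus ?case using Suc by simp
qed (simp add: bits_0)

lemma bit_index_less: "bit_index s < 2 ^ length s"
  by (induction s) auto

lemma bit_index_inj: "inj_on bit_index (bits n)"
proof (induction n)
  case (Suc n)
  have lt: "bit_index x < 2 ^ n" if "x \<in> bits n" for x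
    using bit_index_less[of x] that by (simp add: bits_def)
  have len: "length x = n" if "x \<in> bits n" for x using that by (simp add: bits_def)
  have dis: "bit_index (0 # x) \<noteq> bit_index (1 # y)" if "x \<in> bits n" "y \<in> bits n" for x y
    using lt[OF that(1)] len[OF that(2)] by simp
  show ?case unfolding bits_Suc
  proof (rule inj_onI)
    fix x y assume "x \<in> (#) 0 ` bits n \<union> (#) 1 ` bits n" "y \<in> (#) 0 ` bits n \<union> (#) 1 ` bits n"
      and eq: "bit_index x = bit_index y"
    then obtain b c x' y' where xy: "x = b # x'" "y = c # y'" "x' \<in> bits n" "y' \<in> bits n" by blast
    have "b = c"
      using dis[OF xy(3,4)] dis[OF xy(4,3)] eq xy(1,2)
      by (cases b rule: bit_cases; cases c rule: bit_cases) metis+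
    moreover have "bit_index x' = bit_index y'"
      using eq xy len \<open>b = c\<close> by simp
    ultimately show "x = y" using Suc xy by (auto dest: inj_onD)
  qed
qed (simp add: bits_0)

lemma bij_bit_index: "bij_betw bit_index (bits n) {..<2 ^ n}"
  unfolding bij_betw_def
proof
  show "bit_index ` bits n = {..<2 ^ n}"
  proof (rule card_subset_eq)
    show "bit_index ` bits n \<subseteq> {..<2 ^ n}"
      using bit_index_less by (auto simp: bits_def)
    show "card (bit_index ` bits n) = card {..<2 ^ n :: nat}"
      by (simp add: card_image[OF bit_index_inj] card_bits)
  qed simp
qed (rule bit_index_inj)

section \<open>Signs and characters\<close>

definition sg :: "bit \<Rightarrow> real" where
  "sg b = (if b = 1 then -1 else 1)"

lemma sg_simps [simp]: "sg 0 = 1" "sg 1 = -1"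
  by (simp_all add: sg_def)

lemma sg_add: "sg (a + b) = sg a * sg b"
  by (cases a rule: bit_cases; cases b rule: bit_cases) simp_all

lemma abs_sg [simp]: "\<bar>sg b\<bar> = 1"
  by (simp add: sg_def)

lemma bdot_Cons: "bdot (Suc n) (a # u) (b # v) = a * b + bdot n u v"
  unfolding bdot_def sum.lessThan_Suc_shift by simp

text \<open>The sum factorises over the coordinates: each bit \<open>b\<close> of \<open>c\<close>
  contributes \<open>1 + sg b\<close>, which is 2 or 0.\<close>

lemma sum_sg_bdot:
  assumes "c \<in> bits n"
  shows "(\<Sum>s\<in>bits n. sg (bdot n s c)) = (if c = replicate n 0 then 2 ^ n else 0)"
  using assms
proof (induction n arbitrary: c)
  case 0
  thus ?case by (simp add: bits_0 bdot_def)
next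
  case (Suc n)
  then obtain b c' where c: "c = b # c'" "c' \<in> bits n"
    by (auto simp: bits_def length_Suc_conv)
  have "(\<Sum>s\<in>bits (Suc n). sg (bdot (Suc n) s c)) = (1 + sg b) * (\<Sum>s\<in>bits n. sg (bdot n s c'))"
    unfolding sum_bits_Suc c(1) bdot_Cons sg_add
    by (simp add: distrib_right sum_distrib_left)
  thus ?case unfolding Suc.IH[OF c(2)] by (cases b rule: bit_cases) (auto simp: c(1))
qed

lemma bdot_add_right:
  assumes "length u = n" "length v = n"
  shows "bdot n s (map2 (+) u v) = bdot n s u + bdot n s v"
  unfolding bdot_def sum.distrib[symmetric] using assms by (intro sum.cong) (auto simp: distrib_left)

lemma bit_add_self [simp]: "(a::bit) + a = 0"
  by (cases a rule: bit_cases) auto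

lemma bit_add_eq_0_iff [simp]: "(a::bit) + b = 0 \<longleftrightarrow> a = b"
  by (cases a rule: bit_cases; cases b rule: bit_cases) auto

lemma sum_sg_bdot_mult:
  assumes "u \<in> bits n" "v \<in> bits n"
  shows "(\<Sum>s\<in>bits n. sg (bdot n s u) * sg (bdot n s v)) = (if u = v then 2 ^ n else 0)"
proof -
  have l: "length u = n" "length v = n" using assms by (auto simp: bits_def)
  have "(\<Sum>s\<in>bits n. sg (bdot n s u) * sg (bdot n s v)) = (\<Sum>s\<in>bits n. sg (bdot n s (map2 (+) u v)))"
    by (simp add: bdot_add_right[OF l] sg_add)
  also have "\<dots> = (if map2 (+) u v = replicate n 0 then 2 ^ n else 0)"
    by (rule sum_sg_bdot) (use l in \<open>simp add: bits_def\<close>)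
  also have "map2 (+) u v = replicate n 0 \<longleftrightarrow> u = v"
    using l by (auto simp: list_eq_iff_nth_eq)
  finally show ?thesis .
qed

section \<open>Tensor products, classical registers and partial traces\<close>

lemma sum_lessThan_mult:
  fixes g :: "nat \<Rightarrow> 'a::comm_monoid_add"
  shows "(\<Sum>x<p * q. g x) = (\<Sum>i<p. \<Sum>k<q. g (i * q + k))"
proof -
  have "(\<Sum>x<p * q. g x) = (\<Sum>i<p. sum g {i * q..<i * q + q})"
    by (rule sum.nat_group[symmetric])
  also have "\<dots> = (\<Sum>i<p. \<Sum>k<q. g (i * q + k))"
  proof (rule sum.cong[OF refl])
    fix i
    show "sum g {i * q..<i * q + q} = (\<Sum>k<q. g (i * q + k))"
      using sum.atLeastLessThan_shift_bounds[of g 0 "i * q" q]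
      by (simp add: comp_def lessThan_atLeast0 add.commute)
  qed
  finally show ?thesis .
qed

lemma mult_add_less: "i < p \<Longrightarrow> k < q \<Longrightarrow> i * q + k < p * (q :: nat)"
proof -
  assume "i < p" "k < q"
  hence "Suc i * q \<le> p * q" by (intro mult_right_mono) auto
  thus ?thesis using \<open>k < q\<close> by simp
qed

definition herm :: "nat \<Rightarrow> complex mat \<Rightarrow> bool" where
  "herm D A \<longleftrightarrow> A \<in> carrier_mat D D \<and> hermitian_form {..<D} (ent A)"

lemma ent_kron:
  assumes "A \<in> carrier_mat p p" "B \<in> carrier_mat q q" "i < p" "j < p" "k < q" "l < q"
  shows "ent (A \<otimes>\<^sub>m B) (i * q + k) (j * q + l) = ent A i j * ent B k l"
  using assms mult_add_less[OF assms(3,5)] mult_add_less[OF assms(4,6)] by (simp add: kron_def)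

lemma herm_kron:
  assumes "herm p A" "herm q B"
  shows "herm (p * q) (A \<otimes>\<^sub>m B)"
proof -
  have A: "A \<in> carrier_mat p p" "hermitian_form {..<p} (ent A)"
    and B: "B \<in> carrier_mat q q" "hermitian_form {..<q} (ent B)"
    using assms by (auto simp: herm_def)
  have "hermitian_form {..<p * q} (ent (A \<otimes>\<^sub>m B))"
    unfolding hermitian_form_def
  proof (intro ballI)
    fix x y assume "x \<in> {..<p * q}" "y \<in> {..<p * q}"
    hence xy: "x < p * q" "y < p * q" by auto
    hence "0 < q" by (cases q) auto
    hence "x div q < p" "y div q < p" "x mod q < q" "y mod q < q"
      using xy by (auto simp: less_mult_imp_div_less)
    thus "ent (A \<otimes>\<^sub>m B) y x = cnj (ent (A \<otimes>\<^sub>m B) x y)"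
      using xy A(1) B(1) hermitian_formD[OF A(2)] hermitian_formD[OF B(2)] by (simp add: kron_def)
  qed
  thus ?thesis using A B by (auto simp: herm_def kron_def)
qed

lemma trp_kron:
  assumes "A \<in> carrier_mat p p" "B \<in> carrier_mat q q"
  shows "trp {..<p * q} (ent (A \<otimes>\<^sub>m B)) T =
    (\<Sum>i<p. \<Sum>k<q. \<Sum>j<p. \<Sum>l<q. ent A i j * ent B k l * T (j * q + l) (i * q + k))"
  unfolding trp_def sum_lessThan_mult using assms
  by (intro sum.cong refl) (simp add: ent_kron)

lemma herm_ket_bra: "s \<in> bits m \<Longrightarrow> herm (2 ^ m) (ket_bra s)"
  by (auto simp: herm_def bits_def hermitian_form_def ket_bra_def)

lemma max_mixed_carrier: "max_mixed m \<in> carrier_mat (2 ^ m) (2 ^ m)"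
  by (simp add: max_mixed_def)

lemma ent_max_mixed: "i < 2 ^ m \<Longrightarrow> j < 2 ^ m \<Longrightarrow> ent (max_mixed m) i j = (if i = j then 1 / 2 ^ m else 0)"
  by (simp add: max_mixed_def)

lemma herm_max_mixed: "herm (2 ^ m) (max_mixed m)"
  by (auto simp: herm_def max_mixed_carrier hermitian_form_def ent_max_mixed)

lemma herm_dim: "herm D A \<Longrightarrow> dim_row A = D" "herm D A \<Longrightarrow> dim_col A = D"
  by (auto simp: herm_def)

lemma hermD: "herm D A \<Longrightarrow> i < D \<Longrightarrow> j < D \<Longrightarrow> ent A j i = cnj (ent A i j)"
  unfolding herm_def hermitian_form_def by blast

lemma hermI:
  assumes "A \<in> carrier_mat D D" "\<And>i j. i < D \<Longrightarrow> j < D \<Longrightarrow> ent A j i = cnj (ent A i j)"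
  shows "herm D A"
  using assms unfolding herm_def hermitian_form_def by blast

lemma herm_mat_sum:
  assumes "\<And>s. s \<in> S \<Longrightarrow> herm D (F s)"
  shows "herm D (mat_sum D F S)"
proof (rule hermI)
  fix i j assume "i < D" "j < D"
  thus "ent (mat_sum D F S) j i = cnj (ent (mat_sum D F S) i j)"
    using hermD[OF assms, of _ i j] by (simp add: mat_sum_def)
qed (simp add: mat_sum_def)

lemma herm_smult:
  assumes "herm D A"
  shows "herm D (complex_of_real c \<cdot>\<^sub>m A)"
proof (rule hermI)
  show "ent (complex_of_real c \<cdot>\<^sub>m A) j i = cnj (ent (complex_of_real c \<cdot>\<^sub>m A) i j)" if "i < D" "j < D" for i j
    using hermD[OF assms that] that by (simp add: herm_dim[OF assms])
qed (use assms in \<open>simp add: herm_def\<close>)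

lemma herm_minus:
  assumes A: "herm D A" and B: "herm D B"
  shows "herm D (A - B)"
proof (rule hermI)
  show "ent (A - B) j i = cnj (ent (A - B) i j)" if "i < D" "j < D" for i j
    using hermD[OF A that] hermD[OF B that] that by (simp add: herm_dim[OF A] herm_dim[OF B])
qed (use A B in \<open>auto simp: herm_def\<close>)

text \<open>The diagonal block of a test at the classical value \<open>z\<close>; a state that is
  classical in its first register sees nothing else of the test.\<close>

definition block :: "nat \<Rightarrow> (nat \<Rightarrow> nat \<Rightarrow> complex) \<Rightarrow> bit list \<Rightarrow> nat \<Rightarrow> nat \<Rightarrow> complex" where
  "block q T z k l = T (bit_index z * q + k) (bit_index z * q + l)"

lemma trp_diagonal_kron:
  assumes A: "A \<in> carrier_mat p p" "\<And>i j. i < p \<Longrightarrow> j < p \<Longrightarrow> ent A i j = (if j = i then a i else 0)"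
    and B: "B \<in> carrier_mat q q"
  shows "trp {..<p * q} (ent (A \<otimes>\<^sub>m B)) T = (\<Sum>i<p. a i * trp {..<q} (ent B) (\<lambda>k l. T (i * q + k) (i * q + l)))"
proof -
  have "trp {..<p * q} (ent (A \<otimes>\<^sub>m B)) T =
      (\<Sum>i<p. \<Sum>k<q. \<Sum>j<p. if j = i then (\<Sum>l<q. a i * (ent B k l * T (i * q + l) (i * q + k))) else 0)"
    unfolding trp_kron[OF A(1) B] by (intro sum.cong refl) (auto simp: A(2) mult.assoc)
  thus ?thesis by (simp add: trp_def sum_distrib_left)
qed

lemma trp_ket_bra_kron:
  assumes B: "B \<in> carrier_mat q q" and s: "s \<in> bits m"
  shows "trp {..<2 ^ m * q} (ent (ket_bra s \<otimes>\<^sub>m B)) T = trp {..<q} (ent B) (block q T s)"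
proof -
  have len: "length s = m" using s by (simp add: bits_def)
  have "trp {..<2 ^ m * q} (ent (ket_bra s \<otimes>\<^sub>m B)) T =
      (\<Sum>i<2 ^ m. of_bool (i = bit_index s) * trp {..<q} (ent B) (\<lambda>k l. T (i * q + k) (i * q + l)))"
    by (rule trp_diagonal_kron[OF _ _ B]) (simp_all add: ket_bra_def len)
  also have "\<dots> = (\<Sum>i<2 ^ m. if i = bit_index s then trp {..<q} (ent B) (block q T s) else 0)"
    by (intro sum.cong refl) (simp add: block_def[abs_def])
  finally show ?thesis using bit_index_less[of s] len by simp
qed

lemma trp_max_mixed_kron:
  assumes B: "B \<in> carrier_mat q q"
  shows "trp {..<2 ^ m * q} (ent (max_mixed m \<otimes>\<^sub>m B)) T = 1 / 2 ^ m * (\<Sum>z\<in>bits m. trp {..<q} (ent B) (block q T z))"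
proof -
  have "trp {..<2 ^ m * q} (ent (max_mixed m \<otimes>\<^sub>m B)) T =
      (\<Sum>i<2 ^ m. 1 / 2 ^ m * trp {..<q} (ent B) (\<lambda>k l. T (i * q + k) (i * q + l)))"
    by (rule trp_diagonal_kron[OF max_mixed_carrier _ B]) (simp add: ent_max_mixed)
  also have "\<dots> = (\<Sum>z\<in>bits m. 1 / 2 ^ m * trp {..<q} (ent B) (block q T z))"
    unfolding block_def by (rule sum.reindex_bij_betw[OF bij_bit_index, symmetric])
  finally show ?thesis by (simp add: sum_distrib_left)
qed

lemma contraction_block:
  assumes "contraction {..<2 ^ m * q} T" "z \<in> bits m"
  shows "contraction {..<q} (block q T z)"
  unfolding block_def
proof (rule contraction_pullback[OF _ _ _ assms(1)])
  have "bit_index z < 2 ^ m" using bit_index_less[of z] assms(2) by (simp add: bits_def)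
  thus "(\<lambda>k. bit_index z * q + k) ` {..<q} \<subseteq> {..<2 ^ m * q}"
    by (auto intro: mult_add_less)
qed (auto simp: inj_on_def)

text \<open>The partial trace over the first system of the product of \<open>A\<close>, acting
  there, with \<open>T\<close>. Contracting a test on two systems with a state of one leaves a test
  on the other.\<close>

definition ptrace :: "nat \<Rightarrow> (nat \<Rightarrow> nat \<Rightarrow> complex) \<Rightarrow> (nat \<times> nat \<Rightarrow> nat \<times> nat \<Rightarrow> complex) \<Rightarrow> nat \<Rightarrow> nat \<Rightarrow> complex" where
  "ptrace p A T l k = (\<Sum>i<p. \<Sum>j<p. A i j * T (j, l) (i, k))"

lemma trp_ptrace: "trp I B (ptrace p A T) = (\<Sum>i<p. \<Sum>j<p. A i j * trp I B (\<lambda>l k. T (j, l) (i, k)))"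
  unfolding ptrace_def by (simp only: trp_sum_right trp_scale_right)

text \<open>Both sides are the trace of \<open>T\<close> against the tensor product of
  \<open>A\<close> and \<open>B\<close>, so either system may be contracted first.\<close>

lemma trp_ptrace_swap:
  "trp {..<q} B (ptrace p A T) = trp {..<p} A (ptrace q B (\<lambda>(l, j) (k, i). T (j, l) (i, k)))"
  unfolding trp_ptrace[of "{..<q}" B] by (simp add: trp_def ptrace_def)

lemma trp_kron_ptrace:
  assumes "A \<in> carrier_mat p p" "B \<in> carrier_mat q q"
  shows "trp {..<p * q} (ent (A \<otimes>\<^sub>m B)) T =
    trp {..<q} (ent B) (ptrace p (ent A) (\<lambda>(j, l) (i, k). T (j * q + l) (i * q + k)))"
proof -
  have "trp {..<p * q} (ent (A \<otimes>\<^sub>m B)) T =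
      (\<Sum>i<p. \<Sum>j<p. \<Sum>k<q. \<Sum>l<q. ent A i j * ent B k l * T (j * q + l) (i * q + k))"
    unfolding trp_kron[OF assms] by (intro sum.cong refl sum.swap)
  thus ?thesis unfolding trp_ptrace by (simp add: trp_def sum_distrib_left mult.assoc)
qed

text \<open>For fixed \<open>v\<close>, evaluating \<open>T\<close> on product vectors gives a
  positive form \<open>M\<close> on the first system, and the value of the partial trace at
  \<open>v\<close> is the trace of \<open>A\<close> against \<open>M\<close>.\<close>

lemma pos_form_ptrace:
  assumes A: "pos_form {..<p} A" and T: "pos_form ({..<p} \<times> {..<q}) T"
  shows "pos_form {..<q} (ptrace p A T)"
  unfolding pos_form_def
proof
  fix v
  define M where "M j i = qform {..<q} (\<lambda>l k. T (j, l) (i, k)) v" for j i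
  have "qform {..<p} M u = qform ({..<p} \<times> {..<q}) T (\<lambda>(a, b). u a * v b)" for u
  proof -
    have "qform ({..<p} \<times> {..<q}) T (\<lambda>(a, b). u a * v b) =
        (\<Sum>j<p. \<Sum>l<q. \<Sum>i<p. \<Sum>k<q. cnj (u j) * (cnj (v l) * T (j, l) (i, k) * v k) * u i)"
      unfolding qform_def sum.cartesian_product' by (simp add: mult_ac)
    also have "\<dots> = (\<Sum>j<p. \<Sum>i<p. \<Sum>l<q. \<Sum>k<q. cnj (u j) * (cnj (v l) * T (j, l) (i, k) * v k) * u i)"
      by (intro sum.cong refl sum.swap)
    finally show ?thesis by (simp add: qform_def M_def sum_distrib_left sum_distrib_right)
  qed
  hence "pos_form {..<p} M" using T by (simp add: pos_form_def)
  hence "0 \<le> trp {..<p} A M" by (rule trp_nonneg[OF A])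
  also have "trp {..<p} A M = qform {..<q} (ptrace p A T) v"
    unfolding ptrace_def by (simp only: qform_sum qform_scale trp_def M_def)
  finally show "0 \<le> qform {..<q} (ptrace p A T) v" .
qed

lemma density_iff: "density D \<rho> \<longleftrightarrow> \<rho> \<in> carrier_mat D D \<and> pos_form {..<D} (ent \<rho>) \<and> (\<Sum>i<D. \<rho> $$ (i, i)) = 1"
  by (auto simp: density_def psd_iff mat_trace_def)

text \<open>Besides positivity this uses that contracting the identity with a matrix of trace 1
  gives the identity.\<close>

lemma contraction_ptrace:
  assumes \<rho>: "density p \<rho>" and T: "contraction ({..<p} \<times> {..<q}) T"
  shows "contraction {..<q} (ptrace p (ent \<rho>) T)"
proof -
  have id: "ptrace p (ent \<rho>) id_form = id_form"
  proof (intro ext)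
    fix l k
    have "ptrace p (ent \<rho>) id_form l k = trp {..<p} (ent \<rho>) (\<lambda>j i. id_form l k * id_form j i)"
      unfolding ptrace_def trp_def by (intro sum.cong refl) (auto simp: id_form_def)
    also have "\<dots> = id_form l k"
      using \<rho> unfolding trp_scale_right by (simp add: trp_id density_iff)
    finally show "ptrace p (ent \<rho>) id_form l k = id_form l k" .
  qed
  have "ptrace p (ent \<rho>) (\<lambda>x y. id_form x y - T x y) = (\<lambda>l k. id_form l k - ptrace p (ent \<rho>) T l k)"
    "ptrace p (ent \<rho>) (\<lambda>x y. id_form x y + T x y) = (\<lambda>l k. id_form l k + ptrace p (ent \<rho>) T l k)"
    unfolding id[symmetric] by (simp_all add: fun_eq_iff ptrace_def algebra_simps sum.distrib sum_subtractf)
  moreover have "pos_form {..<p} (ent \<rho>)" using \<rho> by (simp add: density_iff)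
  ultimately show ?thesis
    using T pos_form_ptrace[of p "ent \<rho>" q "\<lambda>x y. id_form x y - T x y"] pos_form_ptrace[of p "ent \<rho>" q "\<lambda>x y. id_form x y + T x y"]
    by (simp add: contraction_def)
qed

lemma contraction_unpair:
  fixes p q :: nat
  assumes "contraction {..<p * q} T"
  shows "contraction ({..<p} \<times> {..<q}) (\<lambda>(j, l) (i, k). T (j * q + l) (i * q + k))"
proof -
  have "contraction ({..<p} \<times> {..<q}) (\<lambda>x y. T ((\<lambda>(j, l). j * q + l) x) ((\<lambda>(j, l). j * q + l) y))"
  proof (rule contraction_pullback[OF _ _ _ assms])
    show "inj_on (\<lambda>(j, l). j * q + l) ({..<p} \<times> {..<q})"
    proof (rule inj_onI, clarsimp)
      fix j l j' l' assume *: "l < q" "l' < q" "j * q + l = j' * q + l'"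
      have "j = j'" using arg_cong[OF *(3), of "\<lambda>x. x div q"] *(1,2) by simp
      thus "j = j' \<and> l = l'" using *(3) by simp
    qed
    show "(\<lambda>(j, l). j * q + l) ` ({..<p} \<times> {..<q}) \<subseteq> {..<p * q}"
      by (auto intro: mult_add_less)
  qed simp
  thus ?thesis by (simp add: case_prod_beta')
qed

lemma contraction_swap:
  fixes p q :: nat
  assumes "contraction ({..<p} \<times> {..<q}) T"
  shows "contraction ({..<q} \<times> {..<p}) (\<lambda>(l, j) (k, i). T (j, l) (i, k))"
proof -
  have "contraction ({..<q} \<times> {..<p}) (\<lambda>x y. T (prod.swap x) (prod.swap y))"
    by (rule contraction_pullback[OF _ _ _ assms]) auto
  thus ?thesis by (simp add: case_prod_beta' prod.swap_def)
qed


section \<open>Signs with orthogonal rows\<close>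

definition expect :: "nat \<Rightarrow> complex mat \<Rightarrow> (nat \<Rightarrow> nat \<Rightarrow> complex) \<Rightarrow> real" where
  "expect D \<rho> T = Re (trp {..<D} (ent \<rho>) T)"

lemma expect_scale: "expect D \<rho> (\<lambda>i j. of_real c * T i j) = c * expect D \<rho> T"
  by (simp add: expect_def trp_scale_right)

lemma expect_sum: "expect D \<rho> (\<lambda>i j. \<Sum>k\<in>K. of_real (c k) * T k i j) = (\<Sum>k\<in>K. c k * expect D \<rho> (T k))"
  by (simp add: expect_def trp_sum_right trp_scale_right)

lemma expect_add: "expect D \<rho> (\<lambda>i j. S i j + T i j) = expect D \<rho> S + expect D \<rho> T"
  by (simp add: expect_def trp_add_right)

lemma expect_id: "density D \<rho> \<Longrightarrow> expect D \<rho> id_form = 1"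
  by (simp add: expect_def density_iff trp_id)

lemma expect_mono: "density D \<rho> \<Longrightarrow> pos_form {..<D} (\<lambda>i j. T i j - S i j) \<Longrightarrow> expect D \<rho> S \<le> expect D \<rho> T"
  unfolding expect_def by (rule trp_mono) (auto simp: density_iff)

text \<open>The advantage of the tests \<open>R\<close> at the output \<open>z\<close> over a
  uniform output. Closeness to uniform becomes a bound on its average for all families
  \<open>R\<close> of contractions.\<close>

definition bias :: "nat \<Rightarrow> nat \<Rightarrow> complex mat \<Rightarrow> (bit list \<Rightarrow> nat \<Rightarrow> nat \<Rightarrow> complex) \<Rightarrow> bit list \<Rightarrow> real" where
  "bias D m \<rho> R z = expect D \<rho> (R z) - 1 / 2 ^ m * (\<Sum>z\<in>bits m. expect D \<rho> (R z))"

text \<open>With \<open>F\<^sub>y = \<Sum>\<^sub>x p(x) \<psi>(x,y) T\<^sub>x\<close>, orthogonality of the rows of \<open>\<psi>\<close> and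
  \<open>T\<^sub>x\<^sup>2 \<le> 1\<close> give \<open>\<Sum>\<^sub>y F\<^sub>y\<^sup>2 \<le> N P\<close>, so the \<open>F\<^sub>y\<^sup>2 / (N P)\<close> form an incomplete POVM and guess \<open>y\<close> with
  probability at most \<open>G\<close>. The bound on the first moment follows from \<open>2 t F\<^sub>y \<le> F\<^sub>y\<^sup>2 + t\<^sup>2\<close>.\<close>

lemma orthogonal_signs_bound:
  fixes \<psi> :: "'x \<Rightarrow> 'y \<Rightarrow> real" and p :: "'x \<Rightarrow> real" and q :: "'y \<Rightarrow> real"
  assumes X: "finite X" and Y: "finite Y"
    and orth: "\<And>x x'. x \<in> X \<Longrightarrow> x' \<in> X \<Longrightarrow> (\<Sum>y\<in>Y. \<psi> x y * \<psi> x' y) = (if x = x' then N else 0)"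
    and p: "\<And>x. x \<in> X \<Longrightarrow> 0 \<le> p x \<and> p x \<le> P" "sum p X = 1"
    and q: "\<And>y. y \<in> Y \<Longrightarrow> 0 \<le> q y" "sum q Y = 1"
    and T: "\<And>x. x \<in> X \<Longrightarrow> contraction {..<D} (T x)"
    and \<sigma>: "\<And>y. y \<in> Y \<Longrightarrow> density D (\<sigma> y)"
    and guess: "\<And>M. (\<And>y. y \<in> Y \<Longrightarrow> pos_form {..<D} (M y)) \<Longrightarrow>
      pos_form {..<D} (\<lambda>i j. id_form i j - (\<Sum>y\<in>Y. M y i j)) \<Longrightarrow>
      (\<Sum>y\<in>Y. q y * expect D (\<sigma> y) (M y)) \<le> G"
    and pos: "0 < N" "0 < P" "0 < t" "N * P * G \<le> t\<^sup>2"
  shows "(\<Sum>x\<in>X. \<Sum>y\<in>Y. p x * q y * \<psi> x y * expect D (\<sigma> y) (T x)) \<le> t"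
proof -
  define F where "F y i j = (\<Sum>x\<in>X. of_real (p x * \<psi> x y) * T x i j)" for y i j
  define F2 where "F2 y i j = (\<Sum>k<D. F y i k * F y k j)" for y i j
  have T': "hermitian_form {..<D} (T x)" if "x \<in> X" for x
    using T[OF that] contraction_iff[of "{..<D}" "T x"] by auto
  have F: "hermitian_form {..<D} (F y)" for y
    unfolding hermitian_form_def F_def by (auto simp: hermitian_formD[OF T'] intro!: sum.cong)
  have qF2: "qform {..<D} (F2 y) v = of_real (sqnorm {..<D} (apply_form {..<D} (F y) v))" for y v
    unfolding F2_def qform_square[OF F] of_real_sum by (intro sum.cong refl) (simp add: cnj_mult_self)
  have F2: "pos_form {..<D} (F2 y)" for y
    unfolding pos_form_def qF2 by (simp add: less_eq_complex_def sum_nonneg)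
  have apF: "apply_form {..<D} (F y) v i = (\<Sum>x\<in>X. of_real (\<psi> x y) * (of_real (p x) * apply_form {..<D} (T x) v i))" for y v i
    unfolding apply_form_def F_def sum_distrib_right sum_distrib_left
    by (subst sum.swap) (simp add: mult_ac)
  have sumF2: "(\<Sum>y\<in>Y. sqnorm {..<D} (apply_form {..<D} (F y) v)) \<le> N * P * sqnorm {..<D} v" for v
  proof -
    have "(\<Sum>y\<in>Y. sqnorm {..<D} (apply_form {..<D} (F y) v)) =
        (\<Sum>i<D. \<Sum>y\<in>Y. (cmod (apply_form {..<D} (F y) v i))\<^sup>2)"
      by (rule sum.swap)
    \<comment> \<open>Orthogonality is applied in each coordinate \<open>i\<close> separately, with
      \<open>p x\<close> times the coordinate of \<open>T x\<close> applied to \<open>v\<close> as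
      coefficients.\<close>
    also have "\<dots> = (\<Sum>i<D. N * (\<Sum>x\<in>X. (cmod (of_real (p x) * apply_form {..<D} (T x) v i))\<^sup>2))"
      unfolding apF by (intro sum.cong refl sum_orthogonal_sq[OF X]) (simp add: orth flip: of_real_mult of_real_sum)
    also have "\<dots> = N * (\<Sum>x\<in>X. (p x)\<^sup>2 * sqnorm {..<D} (apply_form {..<D} (T x) v))"
      by (simp add: norm_mult power_mult_distrib sum_distrib_left[symmetric])
         (subst sum.swap, simp add: sum_distrib_left)
    also have "\<dots> \<le> N * (\<Sum>x\<in>X. (P * p x) * sqnorm {..<D} v)"
    proof (intro mult_left_mono sum_mono)
      fix x assume x: "x \<in> X"
      \<comment> \<open>One factor \<open>p x\<close> is bounded by \<open>P\<close>; the other is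
        kept, to sum to 1.\<close>
      have "(p x)\<^sup>2 \<le> P * p x"
        unfolding power2_eq_square using p(1)[OF x] by (intro mult_right_mono) auto
      thus "(p x)\<^sup>2 * sqnorm {..<D} (apply_form {..<D} (T x) v) \<le> P * p x * sqnorm {..<D} v"
        using contraction_norm[OF T[OF x]] p(1)[OF x] pos(2) by (intro mult_mono) (auto intro: sum_nonneg)
    qed (use pos(1) in simp)
    also have "\<dots> = N * P * sqnorm {..<D} v"
      using p(2) by (simp add: sum_distrib_right[symmetric] sum_distrib_left[symmetric] mult.assoc)
    finally show ?thesis .
  qed
  define M where "M y i j = of_real (1 / (N * P)) * F2 y i j" for y i j
  have "(\<Sum>y\<in>Y. q y * expect D (\<sigma> y) (M y)) \<le> G"
  proof (rule guess)
    show "pos_form {..<D} (M y)" for y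
      using F2 pos unfolding pos_form_def M_def qform_scale
      by (auto simp: less_eq_complex_def)
    show "pos_form {..<D} (\<lambda>i j. id_form i j - (\<Sum>y\<in>Y. M y i j))"
      unfolding pos_form_def
    proof
      fix v
      have "qform {..<D} (\<lambda>i j. id_form i j - (\<Sum>y\<in>Y. M y i j)) v =
        of_real (sqnorm {..<D} v - 1 / (N * P) * (\<Sum>y\<in>Y. sqnorm {..<D} (apply_form {..<D} (F y) v)))"
        unfolding qform_diff qform_sum M_def qform_scale qF2 by (simp add: qform_id sum_distrib_left)
      moreover have "1 / (N * P) * (\<Sum>y\<in>Y. sqnorm {..<D} (apply_form {..<D} (F y) v)) \<le> sqnorm {..<D} v"
        using sumF2[of v] pos by (simp add: field_simps)
      ultimately show "0 \<le> qform {..<D} (\<lambda>i j. id_form i j - (\<Sum>y\<in>Y. M y i j)) v"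
        by (simp only: less_eq_complex_def) simp
    qed
  qed
  moreover have "expect D (\<sigma> y) (M y) = expect D (\<sigma> y) (F2 y) / (N * P)" for y
    unfolding M_def expect_scale by simp
  ultimately have second: "(\<Sum>y\<in>Y. q y * expect D (\<sigma> y) (F2 y)) \<le> N * P * G"
    using pos by (simp add: sum_divide_distrib[symmetric] field_simps)
  have first: "2 * t * expect D (\<sigma> y) (F y) \<le> expect D (\<sigma> y) (F2 y) + t\<^sup>2" if y: "y \<in> Y" for y
  proof -
    \<comment> \<open>This form is the square of \<open>F y - t\<close>.\<close>
    have "pos_form {..<D} (\<lambda>i j. F2 y i j + of_real (t\<^sup>2) * id_form i j - of_real (2 * t) * F y i j)"
      unfolding pos_form_def
    proof
      fix v
      let ?w = "apply_form {..<D} (F y) v"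
      have r: "Re (qform {..<D} (F y) v) = (\<Sum>i<D. Re (cnj (v i) * ?w i))"
        unfolding qform_apply by simp
      have "qform {..<D} (F y) v = of_real (Re (qform {..<D} (F y) v))"
        using hermitian_form_real[OF F] by (simp add: of_real_Re)
      hence "qform {..<D} (\<lambda>i j. F2 y i j + of_real (t\<^sup>2) * id_form i j - of_real (2 * t) * F y i j) v =
        of_real (sqnorm {..<D} ?w + t\<^sup>2 * sqnorm {..<D} v - 2 * t * Re (qform {..<D} (F y) v))"
        unfolding qform_diff qform_add qform_scale qF2
        by (simp add: qform_id)
      also have "sqnorm {..<D} ?w + t\<^sup>2 * sqnorm {..<D} v - 2 * t * Re (qform {..<D} (F y) v)
        = (\<Sum>i<D. (cmod (?w i - of_real t * v i))\<^sup>2)"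
      proof -
        have "(cmod b)\<^sup>2 + t\<^sup>2 * (cmod a)\<^sup>2 - 2 * t * Re (cnj a * b) = (cmod (b - of_real t * a))\<^sup>2" for a b
          unfolding cmod_power2 by (simp add: power2_eq_square algebra_simps)
        thus ?thesis
          unfolding r sum_distrib_left sum.distrib[symmetric] sum_subtractf[symmetric] by simp
      qed
      finally show "0 \<le> qform {..<D} (\<lambda>i j. F2 y i j + of_real (t\<^sup>2) * id_form i j - of_real (2 * t) * F y i j) v"
        by (simp add: less_eq_complex_def sum_nonneg)
    qed
    from expect_mono[OF \<sigma>[OF y] this] show ?thesis
      unfolding expect_add expect_scale expect_id[OF \<sigma>[OF y]] by simp
  qed
  have "(\<Sum>x\<in>X. \<Sum>y\<in>Y. p x * q y * \<psi> x y * expect D (\<sigma> y) (T x)) = (\<Sum>y\<in>Y. q y * expect D (\<sigma> y) (F y))"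
  proof -
    have "expect D (\<sigma> y) (F y) = (\<Sum>x\<in>X. p x * \<psi> x y * expect D (\<sigma> y) (T x))" for y
      unfolding F_def by (rule expect_sum)
    thus ?thesis by (subst sum.swap) (simp add: sum_distrib_left mult_ac)
  qed
  also have "2 * t * \<dots> \<le> (\<Sum>y\<in>Y. q y * (expect D (\<sigma> y) (F2 y) + t\<^sup>2))"
    unfolding sum_distrib_left
  proof (rule sum_mono)
    fix y assume y: "y \<in> Y"
    show "2 * t * (q y * expect D (\<sigma> y) (F y)) \<le> q y * (expect D (\<sigma> y) (F2 y) + t\<^sup>2)"
      using mult_left_mono[OF first[OF y] q(1)[OF y]] by (simp add: mult_ac)
  qed
  also have "\<dots> = (\<Sum>y\<in>Y. q y * expect D (\<sigma> y) (F2 y)) + t\<^sup>2"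
    using q(2) by (simp add: distrib_left sum.distrib sum_distrib_right[symmetric])
  also have "\<dots> \<le> 2 * t * t"
    using second pos(4) by (simp add: power2_eq_square)
  finally show ?thesis using pos(3) by simp
qed

text \<open>Fourier expansion of the last argument of \<open>S\<close>; the trivial character contributes the average.\<close>

lemma fourier_bound:
  fixes e :: "'x \<Rightarrow> 'y \<Rightarrow> bit list" and D :: nat
  assumes X: "finite X" and Y: "finite Y"
    and e: "\<And>x y. x \<in> X \<Longrightarrow> y \<in> Y \<Longrightarrow> e x y \<in> bits L"
    and S: "\<And>x w. x \<in> X \<Longrightarrow> w \<in> bits L \<Longrightarrow> contraction {..<D} (S x w)"
    and bound: "\<And>s T. s \<in> bits L \<Longrightarrow> s \<noteq> replicate L 0 \<Longrightarrow> (\<And>x. x \<in> X \<Longrightarrow> contraction {..<D} (T x)) \<Longrightarrow>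
      (\<Sum>x\<in>X. \<Sum>y\<in>Y. p x * q y * sg (bdot L s (e x y)) * expect D (\<sigma> y) (T x)) \<le> t"
    and t: "0 \<le> t"
  shows "(\<Sum>x\<in>X. \<Sum>y\<in>Y. p x * q y * bias D L (\<sigma> y) (S x) (e x y)) \<le> 2 ^ L * t"
proof -
  \<comment> \<open>The Fourier coefficients of \<open>S x\<close>. Their weights have absolute
    values summing to 1, so they are contractions.\<close>
  define U where "U x s i j = (\<Sum>w\<in>bits L. of_real (sg (bdot L s w) / 2 ^ L) * S x w i j)" for x s i j
  let ?z = "replicate L (0::bit)"
  have z: "?z \<in> bits L" by (simp add: bits_def)
  have U: "contraction {..<D} (U x s)" if "x \<in> X" for x s
    unfolding U_def
    by (rule contraction_combination) (use S that in \<open>simp_all add: card_bits\<close>)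
  have rU: "expect D (\<sigma> y) (U x s) = (\<Sum>w\<in>bits L. sg (bdot L s w) / 2 ^ L * expect D (\<sigma> y) (S x w))" for x y s
    unfolding U_def by (rule expect_sum)
  have expand: "bias D L (\<sigma> y) (S x) (e x y) =
    (\<Sum>s\<in>bits L - {?z}. sg (bdot L s (e x y)) * expect D (\<sigma> y) (U x s))" if xy: "x \<in> X" "y \<in> Y" for x y
  proof -
    let ?f = "\<lambda>w. expect D (\<sigma> y) (S x w)"
    have "(\<Sum>s\<in>bits L. sg (bdot L s (e x y)) * expect D (\<sigma> y) (U x s)) =
        (\<Sum>s\<in>bits L. \<Sum>w\<in>bits L. sg (bdot L s (e x y)) * sg (bdot L s w) * (?f w / 2 ^ L))"
      unfolding rU by (simp add: sum_distrib_left mult_ac)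
    also have "\<dots> = (\<Sum>w\<in>bits L. \<Sum>s\<in>bits L. sg (bdot L s (e x y)) * sg (bdot L s w) * (?f w / 2 ^ L))"
      by (rule sum.swap)
    also have "\<dots> = (\<Sum>w\<in>bits L. if w = e x y then ?f (e x y) else 0)"
      unfolding sum_distrib_right[symmetric]
      by (intro sum.cong refl) (auto simp: sum_sg_bdot_mult e[OF xy])
    also have "\<dots> = ?f (e x y)" using e[OF xy] by simp
    finally have "?f (e x y) = (\<Sum>s\<in>bits L. sg (bdot L s (e x y)) * expect D (\<sigma> y) (U x s))" ..
    also have "\<dots> = sg (bdot L ?z (e x y)) * expect D (\<sigma> y) (U x ?z) +
        (\<Sum>s\<in>bits L - {?z}. sg (bdot L s (e x y)) * expect D (\<sigma> y) (U x s))"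
      by (rule sum.remove[OF finite_bits z])
    also have "bdot L ?z w = 0" for w by (simp add: bdot_def)
    finally show ?thesis unfolding rU by (simp add: bias_def bdot_def sum_divide_distrib)
  qed
  have "(\<Sum>x\<in>X. \<Sum>y\<in>Y. p x * q y * bias D L (\<sigma> y) (S x) (e x y)) =
    (\<Sum>x\<in>X. \<Sum>y\<in>Y. \<Sum>s\<in>bits L - {?z}. p x * q y * sg (bdot L s (e x y)) * expect D (\<sigma> y) (U x s))"
    by (intro sum.cong refl) (subst expand, assumption, assumption, simp add: sum_distrib_left mult.assoc)
  also have "\<dots> = (\<Sum>s\<in>bits L - {?z}. \<Sum>x\<in>X. \<Sum>y\<in>Y. p x * q y * sg (bdot L s (e x y)) * expect D (\<sigma> y) (U x s))"
    unfolding sum.swap[where A = Y and B = "bits L - {?z}"] by (rule sum.swap)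
  also have "\<dots> \<le> (\<Sum>s\<in>bits L - {?z}. t)"
    by (intro sum_mono bound U) auto
  also have "\<dots> \<le> 2 ^ L * t"
    using z t by (simp add: card_bits card_Diff_singleton mult_right_mono)
  finally show ?thesis .
qed

section \<open>Guessing probabilities\<close>

lemma sum_pmf_bits: "bit_source n X \<Longrightarrow> (\<Sum>x\<in>bits n. pmf X x) = 1"
  unfolding bit_source_def by (intro sum_pmf_eq_1) auto

lemma bits_nonempty: "replicate n 0 \<in> bits n"
  by (simp add: bits_def)

lemma pos_form_sum:
  assumes "\<And>k. k \<in> K \<Longrightarrow> pos_form I (A k)"
  shows "pos_form I (\<lambda>i j. \<Sum>k\<in>K. A k i j)"
  using assms unfolding pos_form_def qform_sum by (auto simp: less_eq_complex_def intro!: sum_nonneg)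

lemma pos_form_id: "finite I \<Longrightarrow> pos_form I id_form"
  by (auto simp: pos_form_def qform_id less_eq_complex_def intro!: sum_nonneg)

text \<open>The supremum in the guessing entropy ranges over complete measurements. An incomplete
  one is completed by assigning the missing part to one fixed string, which can only raise the
  success probability.\<close>

lemma guess_probability_le:
  assumes X: "bit_source n X" and \<rho>: "\<And>x. x \<in> bits n \<Longrightarrow> density D (\<rho> x)"
    and k: "k \<le> guess_entropy n D X \<rho>"
    and M: "\<And>x. x \<in> bits n \<Longrightarrow> pos_form {..<D} (M x)"
      "pos_form {..<D} (\<lambda>i j. id_form i j - (\<Sum>x\<in>bits n. M x i j))"
  shows "(\<Sum>x\<in>bits n. pmf X x * expect D (\<rho> x) (M x)) \<le> 2 powr - k"
proof -
  define V where "V = {\<Sum>x\<in>bits n. pmf X x * Re (mat_trace (M x * \<rho> x)) | M. povm n D M}"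
  have tr: "Re (mat_trace (N * \<rho> x)) = expect D (\<rho> x) (ent N)" if "x \<in> bits n" "N \<in> carrier_mat D D" for x N
    using \<rho>[OF that(1)] that(2) by (simp add: expect_def density_iff mat_trace_mult_trp trp_comm)
  have in_V: "(\<Sum>x\<in>bits n. pmf X x * expect D (\<rho> x) (M x)) \<in> V"
    if M: "\<And>x. x \<in> bits n \<Longrightarrow> pos_form {..<D} (M x)" "\<And>i j. (\<Sum>x\<in>bits n. M x i j) = id_form i j" for M
  proof -
    let ?N = "\<lambda>x. Matrix.mat D D (\<lambda>(i, j). M x i j)"
    have "pos_form {..<D} (ent (?N x)) = pos_form {..<D} (M x)" for x
      by (rule pos_form_cong) auto
    moreover have "mat_sum D ?N (bits n) = 1\<^sub>m D"
      using M(2) by (intro eq_matI) (auto simp: mat_sum_def id_form_def)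
    ultimately have "povm n D ?N" using M(1) by (simp add: povm_def psd_iff)
    moreover have "expect D (\<rho> x) (ent (?N x)) = expect D (\<rho> x) (M x)" for x
      unfolding expect_def by (intro arg_cong[of _ _ Re] trp_cong) auto
    ultimately show ?thesis
      unfolding V_def by (auto simp: tr intro!: exI[of _ ?N] sum.cong)
  qed
  have "(\<Sum>x\<in>bits n. pmf X x * Re (mat_trace (M x * \<rho> x))) \<le> 1" if povm: "povm n D M" for M
  proof -
    have M: "M x \<in> carrier_mat D D" "pos_form {..<D} (ent (M x))" if "x \<in> bits n" for x
      using povm that by (auto simp: povm_def psd_iff)
    have id: "(\<Sum>x\<in>bits n. ent (M x) i j) = id_form i j" if "i < D" "j < D" for i j
    proof -
      have "mat_sum D M (bits n) $$ (i, j) = 1\<^sub>m D $$ (i, j)" using povm by (simp add: povm_def)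
      thus ?thesis using that by (simp add: mat_sum_def id_form_def)
    qed
    have "Re (mat_trace (M x * \<rho> x)) \<le> 1" if x: "x \<in> bits n" for x
    proof -
      have "pos_form {..<D} (\<lambda>i j. \<Sum>y\<in>bits n - {x}. ent (M y) i j)"
        using M by (intro pos_form_sum) auto
      also have "pos_form {..<D} (\<lambda>i j. \<Sum>y\<in>bits n - {x}. ent (M y) i j) \<longleftrightarrow>
          pos_form {..<D} (\<lambda>i j. id_form i j - ent (M x) i j)"
        by (intro pos_form_cong) (simp add: id[symmetric] sum_diff1 x)
      finally have "expect D (\<rho> x) (ent (M x)) \<le> expect D (\<rho> x) id_form"
        by (rule expect_mono[OF \<rho>[OF x]])
      thus ?thesis by (simp add: tr[OF x M(1)[OF x]] expect_id[OF \<rho>[OF x]])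
    qed
    hence "(\<Sum>x\<in>bits n. pmf X x * Re (mat_trace (M x * \<rho> x))) \<le> (\<Sum>x\<in>bits n. pmf X x * 1)"
      by (intro sum_mono mult_left_mono) auto
    thus ?thesis using sum_pmf_bits[OF X] by simp
  qed
  hence bdd: "bdd_above V" unfolding V_def by (intro bdd_aboveI[of _ 1]) auto
  \<comment> \<open>Guessing uniformly without looking at the state shows that \<open>Sup V\<close>
    is positive; only then does the bound on its logarithm bound \<open>Sup V\<close>.\<close>
  have "(\<Sum>x\<in>bits n. pmf X x * expect D (\<rho> x) (\<lambda>i j. of_real (1 / 2 ^ n) * id_form i j)) \<in> V"
  proof (rule in_V)
    show "pos_form {..<D} (\<lambda>i j. of_real (1 / 2 ^ n) * id_form i j)"
      using pos_form_id[of "{..<D}"] unfolding pos_form_def qform_scale by (auto simp: less_eq_complex_def)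
  qed (simp add: card_bits)
  also have "(\<Sum>x\<in>bits n. pmf X x * expect D (\<rho> x) (\<lambda>i j. of_real (1 / 2 ^ n) * id_form i j)) = (\<Sum>x\<in>bits n. pmf X x) * (1 / 2 ^ n)"
    unfolding sum_distrib_right by (intro sum.cong refl) (simp only: expect_scale expect_id[OF \<rho>] mult_1_right)
  finally have "1 / 2 ^ n \<in> V" using sum_pmf_bits[OF X] by simp
  hence "1 / 2 ^ n \<le> Sup V" by (rule cSup_upper[OF _ bdd])
  hence "0 < Sup V" by (rule less_le_trans[rotated]) simp
  moreover have "log 2 (Sup V) \<le> - k" using k by (simp add: guess_entropy_def V_def)
  ultimately have Sup_le: "Sup V \<le> 2 powr - k" by (simp add: log_le_iff)
  define R where "R x i j = of_bool (x = replicate n (0::bit)) * (id_form i j - (\<Sum>y\<in>bits n. M y i j))" for x i j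
  have R: "pos_form {..<D} (R x)" for x
    using M(2) by (cases "x = replicate n 0") (simp_all add: R_def[abs_def] pos_form_def qform_def)
  have "(\<Sum>x\<in>bits n. pmf X x * expect D (\<rho> x) (\<lambda>i j. M x i j + R x i j)) \<in> V"
  proof (rule in_V)
    show "pos_form {..<D} (\<lambda>i j. M x i j + R x i j)" if "x \<in> bits n" for x
      using M(1)[OF that] R unfolding pos_form_def qform_add by (simp add: add_nonneg_nonneg)
    show "(\<Sum>x\<in>bits n. M x i j + R x i j) = id_form i j" for i j
      using bits_nonempty[of n] by (simp add: R_def sum.distrib sum_distrib_right[symmetric] of_bool_def)
  qed
  hence "(\<Sum>x\<in>bits n. pmf X x * expect D (\<rho> x) (\<lambda>i j. M x i j + R x i j)) \<le> 2 powr - k"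
    using cSup_upper[OF _ bdd] Sup_le by (meson order_trans)
  moreover have "(\<Sum>x\<in>bits n. pmf X x * expect D (\<rho> x) (M x)) \<le>
      (\<Sum>x\<in>bits n. pmf X x * expect D (\<rho> x) (\<lambda>i j. M x i j + R x i j))"
    using R by (intro sum_mono mult_left_mono expect_mono \<rho>) auto
  ultimately show ?thesis by simp
qed

text \<open>The measurement that always answers \<open>a\<close> is right with probability
  \<open>pmf X a\<close>.\<close>

lemma pmf_le_guess:
  assumes X: "bit_source n X" and \<rho>: "\<And>x. x \<in> bits n \<Longrightarrow> density D (\<rho> x)"
    and k: "k \<le> guess_entropy n D X \<rho>" and a: "a \<in> bits n"
  shows "pmf X a \<le> 2 powr - k"
proof -
  let ?M = "\<lambda>x i j. of_real (of_bool (x = a)) * id_form i j"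
  have "(\<Sum>x\<in>bits n. pmf X x * expect D (\<rho> x) (?M x)) \<le> 2 powr - k"
  proof (rule guess_probability_le[OF X \<rho> k])
    show "pos_form {..<D} (?M x)" for x
      using pos_form_id[of "{..<D}"] by (cases "x = a") (simp_all add: pos_form_def qform_def)
    have "(\<Sum>x\<in>bits n. ?M x i j) = (\<Sum>x\<in>bits n. if x = a then id_form i j else 0)" for i j
      by (intro sum.cong refl) simp
    hence idM: "(\<Sum>x\<in>bits n. ?M x i j) = id_form i j" for i j using a by simp
    show "pos_form {..<D} (\<lambda>i j. id_form i j - (\<Sum>x\<in>bits n. ?M x i j))"
      unfolding idM pos_form_def qform_diff by simp
  qed
  also have "(\<Sum>x\<in>bits n. pmf X x * expect D (\<rho> x) (?M x)) = (\<Sum>x\<in>bits n. if x = a then pmf X a else 0)"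
    by (intro sum.cong refl) (auto simp: expect_scale expect_id[OF \<rho>])
  finally show ?thesis using a by simp
qed


section \<open>Composition with a seeded extractor\<close>

lemma expect_mat_sum: "expect D (mat_sum D F S) T = (\<Sum>s\<in>S. expect D (F s) T)"
proof -
  have "trp {..<D} (ent (mat_sum D F S)) T = trp {..<D} (\<lambda>i j. \<Sum>s\<in>S. ent (F s) i j) T"
    by (rule trp_cong) (auto simp: mat_sum_def)
  thus ?thesis by (simp add: expect_def trp_sum_left)
qed

lemma expect_smult: "A \<in> carrier_mat D D \<Longrightarrow> expect D (complex_of_real c \<cdot>\<^sub>m A) T = c * expect D A T"
proof -
  assume "A \<in> carrier_mat D D"
  hence "trp {..<D} (ent (complex_of_real c \<cdot>\<^sub>m A)) T = of_real c * trp {..<D} (ent A) T"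
    unfolding trp_scale_left[symmetric] by (intro trp_cong) auto
  thus ?thesis by (simp add: expect_def)
qed

lemma expect_minus:
  assumes "A \<in> carrier_mat D D" "B \<in> carrier_mat D D"
  shows "expect D (A - B) T = expect D A T - expect D B T"
proof -
  have "trp {..<D} (ent (A - B)) T = trp {..<D} (ent A) T - trp {..<D} (ent B) T"
    unfolding trp_diff_left[symmetric] using assms by (intro trp_cong) auto
  thus ?thesis by (simp add: expect_def)
qed

lemma density_herm: "density D \<rho> \<Longrightarrow> herm D \<rho>"
  by (auto simp: herm_def density_iff intro: pos_form_hermitian)

text \<open>Serves both kinds of extractor: real minus ideal state, tested by \<open>T\<close>. The
  index sets differ because the ideal state of a seeded extractor sums over the source alone, the
  real one over source and seed.\<close>

lemma cq_difference:
  fixes c :: "'s \<Rightarrow> real" and c' :: "'t \<Rightarrow> real"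
  assumes z: "\<And>s. s \<in> S \<Longrightarrow> z s \<in> bits m" and \<tau>: "\<And>s. s \<in> S \<Longrightarrow> herm D (\<tau> s)"
    and \<tau>': "\<And>s. s \<in> S' \<Longrightarrow> herm D (\<tau>' s)"
  defines "M \<equiv> mat_sum (2 ^ m * D) (\<lambda>s. of_real (c s) \<cdot>\<^sub>m (ket_bra (z s) \<otimes>\<^sub>m \<tau> s)) S -
    max_mixed m \<otimes>\<^sub>m mat_sum D (\<lambda>s. of_real (c' s) \<cdot>\<^sub>m \<tau>' s) S'"
  shows "herm (2 ^ m * D) M"
    and "expect (2 ^ m * D) M T = (\<Sum>s\<in>S. c s * expect D (\<tau> s) (block D T (z s))) -
      1 / 2 ^ m * (\<Sum>z\<in>bits m. \<Sum>s\<in>S'. c' s * expect D (\<tau>' s) (block D T z))"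
proof -
  let ?S1 = "mat_sum (2 ^ m * D) (\<lambda>s. of_real (c s) \<cdot>\<^sub>m (ket_bra (z s) \<otimes>\<^sub>m \<tau> s)) S"
  let ?S2 = "mat_sum D (\<lambda>s. of_real (c' s) \<cdot>\<^sub>m \<tau>' s) S'"
  have kb: "herm (2 ^ m * D) (ket_bra (z s) \<otimes>\<^sub>m \<tau> s)" if "s \<in> S" for s
    using that by (intro herm_kron herm_ket_bra z \<tau>)
  have S1: "herm (2 ^ m * D) ?S1" by (intro herm_mat_sum herm_smult kb)
  have S2: "herm D ?S2" by (intro herm_mat_sum herm_smult \<tau>')
  have S2': "herm (2 ^ m * D) (max_mixed m \<otimes>\<^sub>m ?S2)" by (intro herm_kron herm_max_mixed S2)
  show "herm (2 ^ m * D) M" unfolding M_def by (intro herm_minus S1 S2')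
  have 1: "expect (2 ^ m * D) ?S1 T = (\<Sum>s\<in>S. c s * expect D (\<tau> s) (block D T (z s)))"
    unfolding expect_mat_sum
  proof (rule sum.cong[OF refl])
    fix s assume s: "s \<in> S"
    show "expect (2 ^ m * D) (of_real (c s) \<cdot>\<^sub>m (ket_bra (z s) \<otimes>\<^sub>m \<tau> s)) T = c s * expect D (\<tau> s) (block D T (z s))"
      using kb[OF s] \<tau>[OF s] trp_ket_bra_kron[OF _ z[OF s], of "\<tau> s" D T]
      by (simp add: herm_def expect_smult) (simp add: expect_def)
  qed
  have 2: "expect (2 ^ m * D) (max_mixed m \<otimes>\<^sub>m ?S2) T = 1 / 2 ^ m * (\<Sum>z\<in>bits m. expect D ?S2 (block D T z))"
  proof -
    have "trp {..<2 ^ m * D} (ent (max_mixed m \<otimes>\<^sub>m ?S2)) T =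
        of_real (1 / 2 ^ m) * (\<Sum>z\<in>bits m. trp {..<D} (ent ?S2) (block D T z))"
      using S2 trp_max_mixed_kron[of ?S2 D m T] by (simp add: herm_def)
    from arg_cong[OF this, of Re] show ?thesis
      unfolding expect_def Re_sum[symmetric] by (simp del: of_real_divide)
  qed
  have 3: "expect D ?S2 U = (\<Sum>s\<in>S'. c' s * expect D (\<tau>' s) U)" for U
    unfolding expect_mat_sum by (intro sum.cong refl expect_smult) (use \<tau>' in \<open>simp add: herm_def\<close>)
  have "expect (2 ^ m * D) M T = expect (2 ^ m * D) ?S1 T - expect (2 ^ m * D) (max_mixed m \<otimes>\<^sub>m ?S2) T"
    unfolding M_def using S1 S2' by (intro expect_minus) (simp_all add: herm_def)
  thus "expect (2 ^ m * D) M T = (\<Sum>s\<in>S. c s * expect D (\<tau> s) (block D T (z s))) -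
      1 / 2 ^ m * (\<Sum>z\<in>bits m. \<Sum>s\<in>S'. c' s * expect D (\<tau>' s) (block D T z))"
    unfolding 1 2 3 .
qed

text \<open>The block-diagonal test that reads \<open>z\<close> and then applies \<open>R z\<close>;
  \<open>block\<close> recovers its parts.\<close>

definition blocks :: "nat \<Rightarrow> nat \<Rightarrow> (bit list \<Rightarrow> nat \<Rightarrow> nat \<Rightarrow> complex) \<Rightarrow> nat \<Rightarrow> nat \<Rightarrow> complex" where
  "blocks m q R x y = (if x div q = y div q
     then R (inv_into (bits m) bit_index (x div q)) (x mod q) (y mod q) else 0)"

lemma expect_block_blocks:
  assumes "z \<in> bits m"
  shows "expect q \<rho> (block q (blocks m q R) z) = expect q \<rho> (R z)"
  unfolding expect_def
  by (intro arg_cong[of _ _ Re] trp_cong)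
     (use inv_into_f_f[OF bit_index_inj assms] in \<open>auto simp: block_def blocks_def\<close>)

lemma contraction_blocks:
  assumes R: "\<And>z. z \<in> bits m \<Longrightarrow> contraction {..<q} (R z)"
  shows "contraction {..<2 ^ m * q} (blocks m q R)"
  unfolding contraction_iff[OF finite_lessThan]
proof (intro conjI allI)
  let ?z = "inv_into (bits m) bit_index"
  have z: "?z a \<in> bits m" if "a < 2 ^ m" for a
    using bij_betw_inv_into[OF bij_bit_index[of m]] that by (auto dest: bij_betwE)
  have R': "hermitian_form {..<q} (R z)" "\<bar>Re (qform {..<q} (R z) v)\<bar> \<le> sqnorm {..<q} v"
    if "z \<in> bits m" for z v
    using R[OF that] unfolding contraction_iff[OF finite_lessThan] by auto
  show "hermitian_form {..<2 ^ m * q} (blocks m q R)"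
    unfolding hermitian_form_def
  proof (intro ballI)
    fix x y assume "x \<in> {..<2 ^ m * q}" "y \<in> {..<2 ^ m * q}"
    moreover from this have "0 < q" by (cases q) auto
    ultimately have "x div q < 2 ^ m" "x mod q < q" "y mod q < q"
      by (auto simp: less_mult_imp_div_less)
    thus "blocks m q R y x = cnj (blocks m q R x y)"
      using hermitian_formD[OF R'(1)[OF z]] by (simp add: blocks_def)
  qed
  fix v :: "nat \<Rightarrow> complex"
  have "qform {..<2 ^ m * q} (blocks m q R) v = (\<Sum>a<2 ^ m. qform {..<q} (R (?z a)) (\<lambda>k. v (a * q + k)))"
    unfolding qform_def sum_lessThan_mult
  proof (rule sum.cong[OF refl], rule sum.cong[OF refl])
    fix a k assume a: "a \<in> {..<2 ^ m :: nat}" and "k \<in> {..<q}"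
    hence k: "k < q" by simp
    have "(\<Sum>b<2 ^ m. \<Sum>l<q. cnj (v (a * q + k)) * blocks m q R (a * q + k) (b * q + l) * v (b * q + l)) =
      (\<Sum>b<2 ^ m. if b = a then (\<Sum>l<q. cnj (v (a * q + k)) * R (?z a) k l * v (a * q + l)) else 0)"
      using k by (intro sum.cong refl) (auto simp: blocks_def intro!: sum.cong sum.neutral)
    thus "(\<Sum>b<2 ^ m. \<Sum>l<q. cnj (v (a * q + k)) * blocks m q R (a * q + k) (b * q + l) * v (b * q + l)) =
       (\<Sum>l<q. cnj (v (a * q + k)) * R (?z a) k l * v (a * q + l))"
      using a by simp
  qed
  hence "\<bar>Re (qform {..<2 ^ m * q} (blocks m q R) v)\<bar> \<le> (\<Sum>a<2 ^ m. \<bar>Re (qform {..<q} (R (?z a)) (\<lambda>k. v (a * q + k)))\<bar>)"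
    by (simp add: sum_abs)
  also have "\<dots> \<le> (\<Sum>a<2 ^ m. \<Sum>k<q. (cmod (v (a * q + k)))\<^sup>2)"
    by (intro sum_mono R'(2) z) simp
  also have "\<dots> = (\<Sum>i<2 ^ m * q. (cmod (v i))\<^sup>2)"
    by (rule sum_lessThan_mult[symmetric])
  finally show "\<bar>Re (qform {..<2 ^ m * q} (blocks m q R) v)\<bar> \<le> (\<Sum>i<2 ^ m * q. (cmod (v i))\<^sup>2)" .
qed

text \<open>The trace-norm guarantee evaluated on the test \<open>blocks m D R\<close>. The factor 2
  undoes the 1/2 in \<open>tr_norm\<close>.\<close>

lemma seeded_extractor_bound:
  assumes F: "seeded_extractor n d m k \<epsilon> F" and X: "bit_source n X"
    and \<rho>: "\<And>x. x \<in> bits n \<Longrightarrow> density D (\<rho> x)" and k: "k \<le> guess_entropy n D X \<rho>"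
    and R: "\<And>z. z \<in> bits m \<Longrightarrow> contraction {..<D} (R z)"
  shows "(\<Sum>x\<in>bits n. pmf X x * (1 / 2 ^ d * (\<Sum>u\<in>bits d. bias D m (\<rho> x) R (F x u)))) \<le> 2 * \<epsilon>"
proof -
  let ?M = "mat_sum (2 ^ m * D)
      (\<lambda>s. complex_of_real (pmf X (fst s) / 2 ^ d) \<cdot>\<^sub>m (ket_bra (F (fst s) (snd s)) \<otimes>\<^sub>m \<rho> (fst s))) (bits n \<times> bits d) -
    max_mixed m \<otimes>\<^sub>m mat_sum D (\<lambda>x. complex_of_real (pmf X x) \<cdot>\<^sub>m \<rho> x) (bits n)"
  have "tr_norm ?M \<le> \<epsilon>"
    using F X \<rho> k unfolding seeded_extractor_def case_prod_beta' by blast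
  moreover have Fb: "F x u \<in> bits m" if "x \<in> bits n" "u \<in> bits d" for x u
    using F that unfolding seeded_extractor_def by blast
  have M: "herm (2 ^ m * D) ?M"
    "expect (2 ^ m * D) ?M (blocks m D R) =
      (\<Sum>s\<in>bits n \<times> bits d. pmf X (fst s) / 2 ^ d * expect D (\<rho> (fst s)) (block D (blocks m D R) (F (fst s) (snd s)))) -
      1 / 2 ^ m * (\<Sum>z\<in>bits m. \<Sum>x\<in>bits n. pmf X x * expect D (\<rho> x) (block D (blocks m D R) z))"
    by (rule cq_difference; use Fb \<rho> in \<open>auto intro: density_herm\<close>)+
  moreover have "expect (2 ^ m * D) ?M (blocks m D R) \<le> 2 * tr_norm ?M"
    unfolding expect_def by (rule trp_le_tr_norm[OF _ _ contraction_blocks[OF R]]) (use M(1) in \<open>auto simp: herm_def\<close>)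
  ultimately have "(\<Sum>x\<in>bits n. \<Sum>u\<in>bits d. pmf X x / 2 ^ d * expect D (\<rho> x) (R (F x u))) -
      1 / 2 ^ m * (\<Sum>z\<in>bits m. \<Sum>x\<in>bits n. pmf X x * expect D (\<rho> x) (R z)) \<le> 2 * \<epsilon>"
    unfolding sum.cartesian_product' fst_conv snd_conv
    by (simp add: expect_block_blocks Fb cong: sum.cong)
  also have "(\<Sum>z\<in>bits m. \<Sum>x\<in>bits n. pmf X x * expect D (\<rho> x) (R z)) =
      (\<Sum>x\<in>bits n. \<Sum>z\<in>bits m. pmf X x * expect D (\<rho> x) (R z))"
    by (rule sum.swap)
  finally show ?thesis
    by (simp add: bias_def card_bits right_diff_distrib sum_subtractf sum_distrib_left sum_divide_distrib)
qed

lemma sum_take_bits: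
  fixes f :: "bit list \<Rightarrow> real"
  assumes "m \<le> N"
  shows "1 / 2 ^ N * (\<Sum>x\<in>bits N. f (take m x)) = 1 / 2 ^ m * (\<Sum>z\<in>bits m. f z)"
proof -
  obtain r where r: "N = m + r" using assms by (auto simp: le_iff_add)
  have "(\<Sum>x\<in>bits N. f (take m x)) = (\<Sum>u\<in>bits m. \<Sum>v\<in>bits r. f u)"
    unfolding r sum_bits_add by (intro sum.cong refl) (simp add: bits_def)
  also have "\<dots> = 2 ^ r * (\<Sum>u\<in>bits m. f u)"
    by (simp add: card_bits sum_distrib_left)
  finally show ?thesis by (simp add: r power_add)
qed

text \<open>Copied seed bits and truncation are absorbed into the tests: averaging \<open>R\<close>
  over the surplus bits gives contractions \<open>R'\<close> on the output of \<open>F\<close>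
  itself, with the corresponding average bias.\<close>

lemma extended_seeded_extractor_bound:
  assumes F: "seeded_extractor n d l k \<epsilon> F" and X: "bit_source n X"
    and \<rho>: "\<And>x. x \<in> bits n \<Longrightarrow> density D (\<rho> x)" and k: "k \<le> guess_entropy n D X \<rho>"
    and L: "d \<le> L" "m \<le> l + (L - d)"
    and R: "\<And>z. z \<in> bits m \<Longrightarrow> contraction {..<D} (R z)"
  shows "(\<Sum>x\<in>bits n. pmf X x * (1 / 2 ^ L * (\<Sum>w\<in>bits L. bias D m (\<rho> x) R (take m (extend_seed d F x w))))) \<le> 2 * \<epsilon>"
proof -
  define r where "r = L - d"
  have Lr: "L = d + r" using L by (simp add: r_def)
  define R' where "R' z i j = (\<Sum>v\<in>bits r. of_real (1 / 2 ^ r) * R (take m (z @ v)) i j)" for z i j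
  have R': "contraction {..<D} (R' z)" if "z \<in> bits l" for z
  proof -
    have "take m (z @ v) \<in> bits m" if "v \<in> bits r" for v
      using that \<open>z \<in> bits l\<close> L by (simp add: bits_def r_def)
    thus ?thesis
      unfolding R'_def by (intro contraction_combination R) (simp_all add: card_bits)
  qed
  have tR': "expect D A (R' z) = 1 / 2 ^ r * (\<Sum>v\<in>bits r. expect D A (R (take m (z @ v))))" for A z
    unfolding R'_def expect_sum sum_distrib_left ..
  have bias: "bias D l A R' z = 1 / 2 ^ r * (\<Sum>v\<in>bits r. bias D m A R (take m (z @ v)))" for A z
  proof -
    have "1 / 2 ^ l * (\<Sum>z\<in>bits l. expect D A (R' z)) =
        1 / 2 ^ (l + r) * (\<Sum>w\<in>bits (l + r). expect D A (R (take m w)))"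
      unfolding tR' sum_bits_add by (simp add: power_add sum_divide_distrib mult.commute)
    also have "\<dots> = 1 / 2 ^ m * (\<Sum>z\<in>bits m. expect D A (R z))"
      by (rule sum_take_bits) (use L in \<open>simp add: r_def\<close>)
    finally show ?thesis
      unfolding bias_def tR' by (simp add: sum_subtractf card_bits right_diff_distrib)
  qed
  have "(\<Sum>w\<in>bits L. bias D m A R (take m (extend_seed d F x w))) =
      (\<Sum>u\<in>bits d. \<Sum>v\<in>bits r. bias D m A R (take m (F x u @ v)))" for A x
    unfolding Lr sum_bits_add by (intro sum.cong refl) (simp add: bits_def extend_seed_def)
  hence "1 / 2 ^ L * (\<Sum>w\<in>bits L. bias D m A R (take m (extend_seed d F x w))) =
      1 / 2 ^ d * (\<Sum>u\<in>bits d. bias D l A R' (F x u))" for A x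
    unfolding bias Lr by (simp add: power_add sum_divide_distrib mult.commute)
  thus ?thesis using seeded_extractor_bound[OF F X \<rho> k R'] by simp
qed

text \<open>The bias of the output of \<open>g\<close> on the seed \<open>e x y\<close> splits into that of the seed and that of
  \<open>g\<close> on a uniform seed.\<close>

lemma composition_bound:
  fixes p q :: "bit list \<Rightarrow> real"
  assumes q: "\<And>y. y \<in> bits n \<Longrightarrow> 0 \<le> q y" "sum q (bits n) = 1"
    and \<rho>: "\<And>x. x \<in> bits n \<Longrightarrow> density D1 (\<rho> x)" and \<sigma>: "\<And>y. y \<in> bits n \<Longrightarrow> density D2 (\<sigma> y)"
    and T: "\<And>z. z \<in> bits m \<Longrightarrow> contraction ({..<D1} \<times> {..<D2}) (T z)"
    and g: "\<And>x w. x \<in> bits n \<Longrightarrow> w \<in> bits L \<Longrightarrow> g x w \<in> bits m"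
    and first: "\<And>S. (\<And>x w. x \<in> bits n \<Longrightarrow> w \<in> bits L \<Longrightarrow> contraction {..<D2} (S x w)) \<Longrightarrow>
      (\<Sum>x\<in>bits n. \<Sum>y\<in>bits n. p x * q y * bias D2 L (\<sigma> y) (S x) (e x y)) \<le> a"
    and second: "\<And>R. (\<And>z. z \<in> bits m \<Longrightarrow> contraction {..<D1} (R z)) \<Longrightarrow>
      (\<Sum>x\<in>bits n. p x * (1 / 2 ^ L * (\<Sum>w\<in>bits L. bias D1 m (\<rho> x) R (g x w)))) \<le> b"
  shows "(\<Sum>x\<in>bits n. \<Sum>y\<in>bits n. p x * q y * bias D2 m (\<sigma> y) (\<lambda>z. ptrace D1 (ent (\<rho> x)) (T z)) (g x (e x y))) \<le> a + b"
proof -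
  define f where "f x y z = expect D2 (\<sigma> y) (ptrace D1 (ent (\<rho> x)) (T z))" for x y z
  define h where "h x y z = f x y z - 1 / 2 ^ m * (\<Sum>z\<in>bits m. f x y z)" for x y z
  \<comment> \<open>On a uniform seed the second source enters only through its averaged state,
    which becomes part of a test on the first system.\<close>
  define R where "R z i j = (\<Sum>y\<in>bits n. of_real (q y) * ptrace D2 (ent (\<sigma> y)) (\<lambda>(l, j) (k, i). T z (j, l) (i, k)) i j)" for z i j
  have R: "contraction {..<D1} (R z)" if z: "z \<in> bits m" for z
    unfolding R_def
  proof (rule contraction_combination)
    show "contraction {..<D1} (ptrace D2 (ent (\<sigma> y)) (\<lambda>(l, j) (k, i). T z (j, l) (i, k)))" if "y \<in> bits n" for y
      by (intro contraction_ptrace contraction_swap T z \<sigma> that)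
  qed (use q in simp_all)
  have tR: "expect D1 (\<rho> x) (R z) = (\<Sum>y\<in>bits n. q y * f x y z)" for x z
    unfolding R_def expect_sum unfolding f_def expect_def trp_ptrace_swap[of D2 _ D1] ..
  have biasR: "bias D1 m (\<rho> x) R z = (\<Sum>y\<in>bits n. q y * h x y z)" for x z
  proof -
    have "(\<Sum>z\<in>bits m. \<Sum>y\<in>bits n. q y * f x y z) = (\<Sum>y\<in>bits n. \<Sum>z\<in>bits m. q y * f x y z)"
      by (rule sum.swap)
    thus ?thesis
      unfolding bias_def tR h_def by (simp add: sum_distrib_left sum_subtractf right_diff_distrib sum_divide_distrib)
  qed
  \<comment> \<open>The tests in \<open>first\<close> may depend on \<open>x\<close>, so the state
    \<rho> x can be built into them. This is where the seed has to be good even given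
    \<open>x\<close>.\<close>
  have 1: "(\<Sum>x\<in>bits n. \<Sum>y\<in>bits n. p x * q y * (f x y (g x (e x y)) - 1 / 2 ^ L * (\<Sum>w\<in>bits L. f x y (g x w)))) \<le> a"
    unfolding f_def bias_def[symmetric]
    by (rule first[unfolded bias_def, of "\<lambda>x w. ptrace D1 (ent (\<rho> x)) (T (g x w))", folded bias_def])
       (intro contraction_ptrace T g \<rho>)
  have "p x * (1 / 2 ^ L * (\<Sum>w\<in>bits L. bias D1 m (\<rho> x) R (g x w))) =
      (\<Sum>y\<in>bits n. p x * q y * (1 / 2 ^ L * (\<Sum>w\<in>bits L. h x y (g x w))))" for x
    unfolding biasR by (subst sum.swap) (simp add: sum_distrib_left sum_divide_distrib mult_ac)
  hence 2: "(\<Sum>x\<in>bits n. \<Sum>y\<in>bits n. p x * q y * (1 / 2 ^ L * (\<Sum>w\<in>bits L. h x y (g x w)))) \<le> b"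
    using second[of R, OF R] by simp
  have "bias D2 m (\<sigma> y) (\<lambda>z. ptrace D1 (ent (\<rho> x)) (T z)) (g x w') =
      (f x y (g x w') - 1 / 2 ^ L * (\<Sum>w\<in>bits L. f x y (g x w))) + 1 / 2 ^ L * (\<Sum>w\<in>bits L. h x y (g x w))" for x y w'
    unfolding bias_def f_def[symmetric] h_def by (simp add: sum_subtractf card_bits right_diff_distrib)
  thus ?thesis using 1 2 by (simp only: distrib_left sum.distrib)
qed


section \<open>The two-source extractor\<close>

text \<open>By duality it suffices to consider one test on the output register and both systems. Its
  diagonal blocks, with indices split into pairs, are the \<open>T z\<close>.\<close>

lemma two_source_extractorI:
  assumes E: "\<And>x y. x \<in> bits n \<Longrightarrow> y \<in> bits n \<Longrightarrow> E x y \<in> bits m"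
    and bound: "\<And>X Y D1 D2 \<rho> \<sigma> T. bit_source n X \<Longrightarrow> bit_source n Y \<Longrightarrow>
      (\<And>x. x \<in> bits n \<Longrightarrow> density D1 (\<rho> x)) \<Longrightarrow> (\<And>y. y \<in> bits n \<Longrightarrow> density D2 (\<sigma> y)) \<Longrightarrow>
      k1 \<le> guess_entropy n D1 X \<rho> \<Longrightarrow> k2 \<le> guess_entropy n D2 Y \<sigma> \<Longrightarrow>
      (\<And>z. z \<in> bits m \<Longrightarrow> contraction ({..<D1} \<times> {..<D2}) (T z)) \<Longrightarrow>
      (\<Sum>x\<in>bits n. \<Sum>y\<in>bits n. pmf X x * pmf Y y *
        bias D2 m (\<sigma> y) (\<lambda>z. ptrace D1 (ent (\<rho> x)) (T z)) (E x y)) \<le> 2 * \<epsilon>"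
  shows "two_source_extractor n m k1 k2 \<epsilon> E"
  unfolding two_source_extractor_def case_prod_beta'
proof (intro conjI ballI allI impI E)
  fix X Y D1 D2 \<rho> \<sigma>
  assume "bit_source n X \<and> bit_source n Y \<and> (\<forall>x\<in>bits n. density D1 (\<rho> x)) \<and>
    (\<forall>y\<in>bits n. density D2 (\<sigma> y)) \<and> k1 \<le> guess_entropy n D1 X \<rho> \<and> k2 \<le> guess_entropy n D2 Y \<sigma>"
  hence X: "bit_source n X" and Y: "bit_source n Y" and \<rho>: "\<And>x. x \<in> bits n \<Longrightarrow> density D1 (\<rho> x)"
    and \<sigma>: "\<And>y. y \<in> bits n \<Longrightarrow> density D2 (\<sigma> y)"
    and g: "k1 \<le> guess_entropy n D1 X \<rho>" "k2 \<le> guess_entropy n D2 Y \<sigma>" by auto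
  let ?p = "pmf X" and ?q = "pmf Y" and ?D = "D1 * D2"
  let ?M = "mat_sum (2 ^ m * ?D) (\<lambda>s. complex_of_real (?p (fst s) * ?q (snd s)) \<cdot>\<^sub>m
        (ket_bra (E (fst s) (snd s)) \<otimes>\<^sub>m \<rho> (fst s) \<otimes>\<^sub>m \<sigma> (snd s))) (bits n \<times> bits n) -
      max_mixed m \<otimes>\<^sub>m mat_sum ?D
        (\<lambda>s. complex_of_real (?p (fst s) * ?q (snd s)) \<cdot>\<^sub>m (\<rho> (fst s) \<otimes>\<^sub>m \<sigma> (snd s))) (bits n \<times> bits n)"
  have \<rho>\<sigma>: "herm ?D (\<rho> x \<otimes>\<^sub>m \<sigma> y)" if "x \<in> bits n" "y \<in> bits n" for x y
    using that by (intro herm_kron density_herm \<rho> \<sigma>)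
  have M: "herm (2 ^ m * ?D) ?M"
    "expect (2 ^ m * ?D) ?M T =
      (\<Sum>s\<in>bits n \<times> bits n. ?p (fst s) * ?q (snd s) * expect ?D (\<rho> (fst s) \<otimes>\<^sub>m \<sigma> (snd s)) (block ?D T (E (fst s) (snd s)))) -
      1 / 2 ^ m * (\<Sum>z\<in>bits m. \<Sum>s\<in>bits n \<times> bits n. ?p (fst s) * ?q (snd s) * expect ?D (\<rho> (fst s) \<otimes>\<^sub>m \<sigma> (snd s)) (block ?D T z))"
    for T
    by (rule cq_difference; use E \<rho>\<sigma> in auto)+
  show "tr_norm ?M \<le> \<epsilon>"
  proof (rule tr_norm_leI)
    fix T assume T: "contraction {..<2 ^ m * ?D} T"
    define U where "U z = (\<lambda>(j, l) (i, k). block ?D T z (j * D2 + l) (i * D2 + k))" for z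
    have U: "contraction ({..<D1} \<times> {..<D2}) (U z)" if "z \<in> bits m" for z
      unfolding U_def by (rule contraction_unpair[OF contraction_block[OF T that]])
    define f where "f x y z = expect D2 (\<sigma> y) (ptrace D1 (ent (\<rho> x)) (U z))" for x y z
    have tf: "expect ?D (\<rho> x \<otimes>\<^sub>m \<sigma> y) (block ?D T z) = f x y z" if "x \<in> bits n" "y \<in> bits n" for x y z
      unfolding f_def U_def expect_def
      using trp_kron_ptrace[of "\<rho> x" D1 "\<sigma> y" D2] \<rho>[OF that(1)] \<sigma>[OF that(2)] by (simp add: density_iff)
    have "expect (2 ^ m * ?D) ?M T = (\<Sum>x\<in>bits n. \<Sum>y\<in>bits n. ?p x * ?q y * f x y (E x y)) -
      1 / 2 ^ m * (\<Sum>z\<in>bits m. \<Sum>x\<in>bits n. \<Sum>y\<in>bits n. ?p x * ?q y * f x y z)"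
      unfolding M(2) sum.cartesian_product' fst_conv snd_conv by (simp add: tf cong: sum.cong)
    also have "(\<Sum>z\<in>bits m. \<Sum>x\<in>bits n. \<Sum>y\<in>bits n. ?p x * ?q y * f x y z) =
      (\<Sum>x\<in>bits n. \<Sum>y\<in>bits n. \<Sum>z\<in>bits m. ?p x * ?q y * f x y z)"
      unfolding sum.swap[where A = "bits m" and B = "bits n"] ..
    also have "(\<Sum>x\<in>bits n. \<Sum>y\<in>bits n. ?p x * ?q y * f x y (E x y)) - 1 / 2 ^ m * \<dots> =
      (\<Sum>x\<in>bits n. \<Sum>y\<in>bits n. ?p x * ?q y * bias D2 m (\<sigma> y) (\<lambda>z. ptrace D1 (ent (\<rho> x)) (U z)) (E x y))"
      by (simp add: bias_def f_def[symmetric] sum_distrib_left sum_subtractf right_diff_distrib sum_divide_distrib mult_ac)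
    also have "\<dots> \<le> 2 * \<epsilon>" by (rule bound[OF X Y \<rho> \<sigma> g U])
    finally show "Re (trp {..<2 ^ m * ?D} (ent ?M) T) \<le> 2 * \<epsilon>" unfolding expect_def .
  qed (use M(1) in \<open>simp_all add: herm_def\<close>)
qed

section \<open>Parities as nonsingular bilinear forms\<close>

definition mat_bits :: "bit mat \<Rightarrow> bit list \<Rightarrow> bit list" where
  "mat_bits B x = list_of_vec (B *\<^sub>v vec_of_list x)"

lemma mat_bits_in: "B \<in> carrier_mat n n \<Longrightarrow> mat_bits B x \<in> bits n"
  by (simp add: mat_bits_def bits_def)

lemma scalar_prod_bdot:
  assumes "dim_vec v = n" "length y = n"
  shows "v \<bullet> vec_of_list y = bdot n (list_of_vec v) y"
  using assms by (simp add: scalar_prod_def bdot_def lessThan_atLeast0 list_of_vec_index vec_of_list_index)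

lemma bdot_comm: "bdot n u v = bdot n v u"
  by (simp add: bdot_def mult.commute)

lemma mat_bits_inj:
  assumes B: "B \<in> carrier_mat n n" and d: "Determinant.det B \<noteq> 0"
  shows "inj_on (mat_bits B) (bits n)"
proof -
  obtain C where C: "C \<in> carrier_mat n n" "C * B = 1\<^sub>m n"
    using det_non_zero_imp_unit[OF B d] by (auto simp: Units_def ring_mat_def)
  show ?thesis
  proof (rule inj_on_inverseI)
    fix x assume "x \<in> bits n"
    hence x: "vec_of_list x \<in> carrier_vec n" by (simp add: bits_def carrier_vecI)
    have "C *\<^sub>v (B *\<^sub>v vec_of_list x) = vec_of_list x"
      unfolding assoc_mult_mat_vec[OF C(1) B x, symmetric] C(2) using x by simp
    thus "mat_bits C (mat_bits B x) = x" by (simp add: mat_bits_def vec_list list_vec)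
  qed
qed

text \<open>A nonsingular matrix maps distinct \<open>x\<close> to distinct strings, so the rows are
  distinct characters.\<close>

lemma signs_orthogonal:
  assumes B: "B \<in> carrier_mat n n" and d: "Determinant.det B \<noteq> 0" and x: "x \<in> bits n" "x' \<in> bits n"
  shows "(\<Sum>y\<in>bits n. sg (bdot n (mat_bits B x) y) * sg (bdot n (mat_bits B x') y)) = (if x = x' then 2 ^ n else 0)"
  using sum_sg_bdot_mult[OF mat_bits_in[OF B] mat_bits_in[OF B], of x x'] inj_on_eq_iff[OF mat_bits_inj[OF B d] x]
  by (simp add: bdot_comm[of n "mat_bits B _"])

lemma bdot_mat_bits_transpose:
  assumes B: "B \<in> carrier_mat n n" and "x \<in> bits n" "y \<in> bits n"
  shows "bdot n (mat_bits B x) y = bdot n (mat_bits (transpose_mat B) y) x"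
proof -
  have c: "vec_of_list x \<in> carrier_vec n" "vec_of_list y \<in> carrier_vec n" "length x = n" "length y = n"
    using assms(2,3) by (simp_all add: bits_def carrier_vecI)
  have "bdot n (mat_bits (transpose_mat B) y) x = (transpose_mat B *\<^sub>v vec_of_list y) \<bullet> vec_of_list x"
    unfolding mat_bits_def by (rule scalar_prod_bdot[symmetric]) (use B c in auto)
  also have "\<dots> = vec_of_list y \<bullet> (B *\<^sub>v vec_of_list x)"
    by (rule transpose_vec_mult_scalar[OF B c(1,2)])
  also have "\<dots> = (B *\<^sub>v vec_of_list x) \<bullet> vec_of_list y"
    by (rule comm_scalar_prod[of _ n]) (use B c in auto)
  also have "\<dots> = bdot n (mat_bits B x) y"
    unfolding mat_bits_def by (rule scalar_prod_bdot) (use B c in auto)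
  finally show ?thesis ..
qed

lemma E_D_in_bits: "E_D A n L x y \<in> bits L"
  by (simp add: E_D_def bits_def)

text \<open>The algebraic property of \<open>E_D\<close> that the analysis rests on, in a form that
  survives exchanging the two arguments. One proof then serves both versions of the
  construction.\<close>

definition nonsingular_parities :: "nat \<Rightarrow> nat \<Rightarrow> (bit list \<Rightarrow> bit list \<Rightarrow> bit list) \<Rightarrow> bool" where
  "nonsingular_parities n L e \<longleftrightarrow> (\<forall>s\<in>bits L - {replicate L 0}. \<exists>B\<in>carrier_mat n n. Determinant.det B \<noteq> 0 \<and>
     (\<forall>x\<in>bits n. \<forall>y\<in>bits n. bdot L s (e x y) = bdot n (mat_bits B x) y))"

lemma nonsingular_parities_swap:
  assumes "nonsingular_parities n L e"
  shows "nonsingular_parities n L (\<lambda>y x. e x y)"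
  unfolding nonsingular_parities_def
proof
  fix s assume "s \<in> bits L - {replicate L 0}"
  then obtain B where B: "B \<in> carrier_mat n n" "Determinant.det B \<noteq> 0"
    "\<forall>x\<in>bits n. \<forall>y\<in>bits n. bdot L s (e x y) = bdot n (mat_bits B x) y"
    using assms unfolding nonsingular_parities_def by blast
  show "\<exists>B\<in>carrier_mat n n. Determinant.det B \<noteq> 0 \<and>
      (\<forall>y\<in>bits n. \<forall>x\<in>bits n. bdot L s (e x y) = bdot n (mat_bits B y) x)"
    by (rule bexI[of _ "transpose_mat B"])
       (use B in \<open>auto simp: det_transpose[OF B(1)] bdot_mat_bits_transpose[OF B(1)]\<close>)
qed

text \<open>A nontrivial parity of the output bits of \<open>E\<^sub>D\<close> is the bilinear form of a sum of the \<open>A\<^sub>i\<close>.\<close>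

lemma nonsingular_parities_E_D:
  assumes A: "deor_matrices A" and L: "L \<le> n"
  shows "nonsingular_parities n L (E_D A n L)"
  unfolding nonsingular_parities_def
proof
  fix s assume s: "s \<in> bits L - {replicate L 0}"
  define S where "S = {i \<in> {1..L}. s ! (i - 1) = 1}"
  define B where "B = mat_sum n (A n) S"
  have A': "A n i \<in> carrier_mat n n" if "i \<in> {1..n}" for i
    using A that unfolding deor_matrices_def by blast
  have len: "length s = L" using s by (simp add: bits_def)
  have "\<exists>i<L. s ! i \<noteq> 0"
    using s len by (auto simp: list_eq_iff_nth_eq)
  then obtain i where i: "i < L" "s ! i \<noteq> 0" by blast
  have "S \<noteq> {}" "S \<subseteq> {1..n}"
    using i L by (auto simp: S_def intro!: exI[of _ "Suc i"])
  hence "vec_space.rank n B = n" using A unfolding deor_matrices_def B_def by blast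
  moreover have B: "B \<in> carrier_mat n n" by (simp add: B_def mat_sum_def)
  ultimately have d: "Determinant.det B \<noteq> 0" using vec_space.det_rank_iff[OF B] by blast
  have "bdot L s (E_D A n L x y) = bdot n (mat_bits B x) y" if x: "x \<in> bits n" and y: "y \<in> bits n" for x y
  proof -
    have c: "length x = n" "length y = n" using x y by (auto simp: bits_def)
    have "bdot L s (E_D A n L x y) = (\<Sum>i<L. s ! i * ((A n (Suc i) *\<^sub>v vec_of_list x) \<bullet> vec_of_list y))"
      unfolding bdot_def E_D_def by (intro sum.cong refl) (simp del: upt_Suc)
    also have "\<dots> = (\<Sum>i\<in>{1..L}. s ! (i - 1) * ((A n i *\<^sub>v vec_of_list x) \<bullet> vec_of_list y))"
      by (rule sum.reindex_bij_witness[of _ "\<lambda>i. i - 1" Suc]) auto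
    also have "\<dots> = (\<Sum>i\<in>S. (A n i *\<^sub>v vec_of_list x) \<bullet> vec_of_list y)"
      unfolding S_def by (rule sum.mono_neutral_cong_right) auto
    also have "\<dots> = (\<Sum>i\<in>S. \<Sum>r<n. y ! r * (\<Sum>c<n. A n i $$ (r, c) * x ! c))"
      by (intro sum.cong refl mat_bilinear_form A' c) (use L in \<open>auto simp: S_def\<close>)
    also have "\<dots> = (\<Sum>r<n. y ! r * (\<Sum>i\<in>S. \<Sum>c<n. A n i $$ (r, c) * x ! c))"
      unfolding sum_distrib_left by (rule sum.swap)
    also have "\<dots> = (\<Sum>r<n. y ! r * (\<Sum>c<n. (\<Sum>i\<in>S. A n i $$ (r, c)) * x ! c))"
      by (subst sum.swap) (simp add: sum_distrib_right)
    also have "\<dots> = (B *\<^sub>v vec_of_list x) \<bullet> vec_of_list y"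
      unfolding mat_bilinear_form[OF B c] by (simp add: B_def mat_sum_def)
    also have "\<dots> = bdot n (mat_bits B x) y"
      unfolding mat_bits_def by (rule scalar_prod_bdot) (use B c in auto)
    finally show ?thesis .
  qed
  with B d show "\<exists>B\<in>carrier_mat n n. Determinant.det B \<noteq> 0 \<and>
      (\<forall>x\<in>bits n. \<forall>y\<in>bits n. bdot L s (E_D A n L x y) = bdot n (mat_bits B x) y)" by blast
qed

text \<open>The tests know \<open>x\<close> itself, so what counts about \<open>X\<close> is its
  largest probability; for \<open>Y\<close> it is the guessing probability given the state.\<close>

lemma strong_extraction_bound:
  assumes e: "\<And>x y. e x y \<in> bits L"
    and parity: "nonsingular_parities n L e"
    and X: "bit_source n X" and Y: "bit_source n Y"
    and p: "\<And>x. x \<in> bits n \<Longrightarrow> pmf X x \<le> 2 powr - k1"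
    and \<sigma>: "\<And>y. y \<in> bits n \<Longrightarrow> density D (\<sigma> y)" and k2: "k2 \<le> guess_entropy n D Y \<sigma>"
    and S: "\<And>x w. x \<in> bits n \<Longrightarrow> w \<in> bits L \<Longrightarrow> contraction {..<D} (S x w)"
  shows "(\<Sum>x\<in>bits n. \<Sum>y\<in>bits n. pmf X x * pmf Y y * bias D L (\<sigma> y) (S x) (e x y)) \<le>
    2 ^ L * 2 powr ((real n - k1 - k2) / 2)"
proof (rule fourier_bound)
  fix s T assume s: "s \<in> bits L" "s \<noteq> replicate L 0" and T: "\<And>x. x \<in> bits n \<Longrightarrow> contraction {..<D} (T x)"
  with parity obtain B where B: "B \<in> carrier_mat n n" "Determinant.det B \<noteq> 0"
    "\<And>x y. x \<in> bits n \<Longrightarrow> y \<in> bits n \<Longrightarrow> bdot L s (e x y) = bdot n (mat_bits B x) y"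
    unfolding nonsingular_parities_def by blast
  have "(\<Sum>x\<in>bits n. \<Sum>y\<in>bits n. pmf X x * pmf Y y * sg (bdot n (mat_bits B x) y) * expect D (\<sigma> y) (T x))
      \<le> 2 powr ((real n - k1 - k2) / 2)"
  proof (rule orthogonal_signs_bound[where N = "2 ^ n" and P = "2 powr - k1" and G = "2 powr - k2"])
    show "(\<Sum>y\<in>bits n. pmf Y y * expect D (\<sigma> y) (M y)) \<le> 2 powr - k2"
      if "\<And>y. y \<in> bits n \<Longrightarrow> pos_form {..<D} (M y)"
        "pos_form {..<D} (\<lambda>i j. id_form i j - (\<Sum>y\<in>bits n. M y i j))" for M
      by (rule guess_probability_le[OF Y \<sigma> k2 that])
    have "2 ^ n * 2 powr - k1 * 2 powr - k2 = 2 powr (real n - k1 - k2)"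
      by (simp add: powr_realpow[symmetric] powr_add[symmetric])
    also have "\<dots> = (2 powr ((real n - k1 - k2) / 2))\<^sup>2"
      by (simp add: power2_eq_square powr_add[symmetric])
    finally show "2 ^ n * 2 powr - k1 * 2 powr - k2 \<le> (2 powr ((real n - k1 - k2) / 2))\<^sup>2" by simp
  qed (use signs_orthogonal[OF B(1,2)] p \<sigma> T sum_pmf_bits[OF X] sum_pmf_bits[OF Y] in auto)
  thus "(\<Sum>x\<in>bits n. \<Sum>y\<in>bits n. pmf X x * pmf Y y * sg (bdot L s (e x y)) * expect D (\<sigma> y) (T x))
      \<le> 2 powr ((real n - k1 - k2) / 2)"
    by (simp add: B(3))
qed (use e S in auto)

text \<open>The entropy of the first source is spent twice: as a bound on its probabilities, for the
  quality of the seed, and together with its states, for the seeded extractor.\<close>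

lemma seeded_composition_bound:
  assumes F: "seeded_extractor n d l k \<epsilon>' F" and k: "k \<le> k1" and L: "d \<le> L" "m \<le> l + (L - d)"
    and e: "\<And>x y. e x y \<in> bits L"
    and parity: "nonsingular_parities n L e"
    and X: "bit_source n X" and Y: "bit_source n Y"
    and \<rho>: "\<And>x. x \<in> bits n \<Longrightarrow> density D1 (\<rho> x)" and k1: "k1 \<le> guess_entropy n D1 X \<rho>"
    and \<sigma>: "\<And>y. y \<in> bits n \<Longrightarrow> density D2 (\<sigma> y)" and k2: "k2 \<le> guess_entropy n D2 Y \<sigma>"
    and T: "\<And>z. z \<in> bits m \<Longrightarrow> contraction ({..<D1} \<times> {..<D2}) (T z)"
  shows "(\<Sum>x\<in>bits n. \<Sum>y\<in>bits n. pmf X x * pmf Y y *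
      bias D2 m (\<sigma> y) (\<lambda>z. ptrace D1 (ent (\<rho> x)) (T z)) (take m (extend_seed d F x (e x y)))) \<le>
    2 ^ L * 2 powr ((real n - k1 - k2) / 2) + 2 * \<epsilon>'"
proof (rule composition_bound[where g = "\<lambda>x w. take m (extend_seed d F x w)" and e = e, OF _ _ \<rho> \<sigma> T])
  have "F x u \<in> bits l" if "x \<in> bits n" "u \<in> bits d" for x u
    using F that unfolding seeded_extractor_def by blast
  thus "take m (extend_seed d F x w) \<in> bits m" if "x \<in> bits n" "w \<in> bits L" for x w
    using that L by (simp add: bits_def extend_seed_def)
  show "(\<Sum>x\<in>bits n. \<Sum>y\<in>bits n. pmf X x * pmf Y y * bias D2 L (\<sigma> y) (S x) (e x y)) \<le>
      2 ^ L * 2 powr ((real n - k1 - k2) / 2)"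
    if "\<And>x w. x \<in> bits n \<Longrightarrow> w \<in> bits L \<Longrightarrow> contraction {..<D2} (S x w)" for S
    by (rule strong_extraction_bound[OF e parity X Y pmf_le_guess[OF X \<rho> k1] \<sigma> k2 that])
  show "(\<Sum>x\<in>bits n. pmf X x * (1 / 2 ^ L * (\<Sum>w\<in>bits L. bias D1 m (\<rho> x) R (take m (extend_seed d F x w))))) \<le> 2 * \<epsilon>'"
    if "\<And>z. z \<in> bits m \<Longrightarrow> contraction {..<D1} (R z)" for R
    using k k1 by (intro extended_seeded_extractor_bound[OF F X \<rho> _ L that]) auto
qed (use sum_pmf_bits[OF Y] in auto)

lemma deor_two_source_extractor:
  assumes A: "deor_matrices A"
    and F: "seeded_extractor n (d n k e) (l n k e) (real k) \<epsilon>' (ES n k e)"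
    and k: "real k \<le> (if sw then k2 else k1)"
    and L: "d n k e \<le> L" "L \<le> n" "m \<le> l n k e + (L - d n k e)"
    and eps: "2 ^ L * 2 powr ((real n - k1 - k2) / 2) + 2 * \<epsilon>' \<le> 2 * \<epsilon>"
  shows "two_source_extractor n m k1 k2 \<epsilon> (deor A ES d n k e L sw m)"
proof -
  have "ES n k e x u \<in> bits (l n k e)" if "x \<in> bits n" "u \<in> bits (d n k e)" for x u
    using F that unfolding seeded_extractor_def by blast
  hence E: "deor A ES d n k e L sw m x y \<in> bits m" if "x \<in> bits n" "y \<in> bits n" for x y
    using that L E_D_in_bits[of A n L x y] by (simp add: deor_def extend_seed_def bits_def)
  note parities = nonsingular_parities_E_D[OF A L(2)]
  show ?thesis
  proof (rule two_source_extractorI[OF E])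
    fix X Y D1 D2 \<rho> \<sigma> and T :: "bit list \<Rightarrow> nat \<times> nat \<Rightarrow> nat \<times> nat \<Rightarrow> complex"
    assume X: "bit_source n X" and Y: "bit_source n Y" and \<rho>: "\<And>x. x \<in> bits n \<Longrightarrow> density D1 (\<rho> x)"
      and \<sigma>: "\<And>y. y \<in> bits n \<Longrightarrow> density D2 (\<sigma> y)"
      and g1: "k1 \<le> guess_entropy n D1 X \<rho>" and g2: "k2 \<le> guess_entropy n D2 Y \<sigma>"
      and T: "\<And>z. z \<in> bits m \<Longrightarrow> contraction ({..<D1} \<times> {..<D2}) (T z)"
    have "(\<Sum>x\<in>bits n. \<Sum>y\<in>bits n. pmf X x * pmf Y y *
        bias D2 m (\<sigma> y) (\<lambda>z. ptrace D1 (ent (\<rho> x)) (T z)) (deor A ES d n k e L sw m x y))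
      \<le> 2 ^ L * 2 powr ((real n - k1 - k2) / 2) + 2 * \<epsilon>'" (is "?lhs \<le> ?rhs")
    proof (cases sw)
      case False
      show ?thesis
        unfolding deor_def if_not_P[OF False]
        by (rule seeded_composition_bound[OF F _ L(1,3) E_D_in_bits parities X Y \<rho> g1 \<sigma> g2 T]) (use k False in auto)
    next
      case True
      \<comment> \<open>The test with its tensor factors exchanged. The bias does not change, since
        both orders of contraction give the same number.\<close>
      let ?T = "\<lambda>z. \<lambda>(l, j) (k, i). T z (j, l) (i, k)"
      have "?lhs = (\<Sum>y\<in>bits n. \<Sum>x\<in>bits n. pmf Y y * pmf X x *
          bias D1 m (\<rho> x) (\<lambda>z. ptrace D2 (ent (\<sigma> y)) (?T z)) (deor A ES d n k e L sw m x y))"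
        unfolding bias_def expect_def trp_ptrace_swap[of D2 _ D1]
        by (subst sum.swap) (simp add: mult.commute)
      also have "\<dots> \<le> 2 ^ L * 2 powr ((real n - k2 - k1) / 2) + 2 * \<epsilon>'"
        unfolding deor_def if_P[OF True]
        by (rule seeded_composition_bound[OF F _ L(1,3) E_D_in_bits nonsingular_parities_swap[OF parities]
              Y X \<sigma> g2 \<rho> g1 contraction_swap[OF T]])
           (use k True in auto)
      finally show ?thesis by (simp add: algebra_simps)
    qed
    also note eps
    finally show "(\<Sum>x\<in>bits n. \<Sum>y\<in>bits n. pmf X x * pmf Y y *
        bias D2 m (\<sigma> y) (\<lambda>z. ptrace D1 (ent (\<rho> x)) (T z)) (deor A ES d n k e L sw m x y)) \<le> 2 * \<epsilon>" .
  qed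
qed

section \<open>Choice of the parameters\<close>

text \<open>Output length of \<open>E\<^sub>D\<close>: \<open>L = \<lfloor>\<kappa>/4\<rfloor>\<close> with \<open>\<kappa> = k1 + k2 - n\<close>. The constant \<open>324\<close> makes the seed length
  at most \<open>27 \<bar>a\<bar> \<Lambda>\<^sup>3 \<le> \<kappa>/12\<close>, where \<open>\<Lambda> = log 2 (n / \<epsilon>)\<close>.\<close>

lemma deor_parameters:
  fixes a b k1 k2 \<epsilon> :: real and n m :: nat
  assumes A: "deor_matrices A" and ES: "explicit_seeded_extractors a b ES d l"
    and n: "2 \<le> n" and k12: "k1 \<le> real n" "k2 \<le> real n" and \<epsilon>: "0 < \<epsilon>" "\<epsilon> < 1"
    and k: "k1 + k2 > real n + (324 * \<bar>a\<bar> + 8) * (log 2 (real n / \<epsilon>)) ^ 3"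
    and m: "int m = \<lfloor>(1 - min 1 (16 * log 2 (real n) / real n)) * max k1 k2 + 1/6 * (k1 + k2 - real n) -
      9 * log 2 (1 / \<epsilon>) - (\<bar>b\<bar> + 18)\<rfloor>"
  shows "\<exists>k e L sw. (n, k, e, L, sw, m) \<in> deor_params d l \<and>
     two_source_extractor n m k1 k2 \<epsilon> (deor A ES d n k e L sw m)"
proof -
  define lam where "lam = log 2 (1 / \<epsilon>)"
  define Lam where "Lam = log 2 (real n / \<epsilon>)"
  define \<kappa> where "\<kappa> = k1 + k2 - real n"
  define K where "K = max k1 k2"
  \<comment> \<open>Since \<open>K\<close> exceeds n/2, \<delta> times \<open>K\<close> is at least
    8 log n unless the minimum is 1; this pays for the loss \<open>8 * log 2 (real k)\<close> of the
    seeded extractor.\<close>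
  define \<delta> where "\<delta> = min 1 (16 * log 2 (real n) / real n)"
  have lam: "0 < lam" using \<epsilon> by (simp add: lam_def)
  have logn: "1 \<le> log 2 (real n)" using n by (simp add: le_log_iff)
  have Lam: "Lam = log 2 (real n) + lam"
    using n \<epsilon> by (simp add: Lam_def lam_def log_divide)
  have Lam1: "1 \<le> Lam" using Lam lam logn by simp
  have Lam3: "Lam \<le> Lam ^ 3" using Lam1 by (simp add: self_le_power)
  have \<kappa>: "\<kappa> > 324 * \<bar>a\<bar> * Lam ^ 3 + 8 * Lam ^ 3"
    using k by (simp add: \<kappa>_def Lam_def algebra_simps)
  have aL: "0 \<le> \<bar>a\<bar> * Lam ^ 3" using Lam1 by simp
  have \<kappa>8: "8 * Lam ^ 3 < \<kappa>" "0 < \<kappa>" using \<kappa> aL Lam1 Lam3 by linarith+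
  have \<kappa>n: "\<kappa> \<le> n" using k12 by (simp add: \<kappa>_def)
  have K: "K \<le> n" "real n / 2 < K" "k1 \<le> K" "k2 \<le> K"
    using k12 \<kappa>8 by (auto simp: K_def \<kappa>_def max_def)
  define k where "k = nat \<lfloor>K\<rfloor>"
  have k_bounds: "real k \<le> K" "K - 1 \<le> real k" using K n unfolding k_def by linarith+
  have k1: "1 \<le> k" using K n by (simp add: k_def le_nat_floor)
  have kn: "k \<le> n" using k_bounds K by linarith
  \<comment> \<open>This makes \<open>1 / 2 ^ e\<close> at most \<epsilon>/2. Of the doubled error 2
    \<epsilon>, one half then goes to the extractor and the other to the seed.\<close>
  define e where "e = nat \<lceil>lam + 1\<rceil>"
  have e: "lam + 1 \<le> real e" "real e \<le> lam + 2" using lam unfolding e_def by linarith+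
  have e1: "1 \<le> e" using e lam by linarith
  have en: "e \<le> n"
  proof -
    have "real e \<le> 3 * Lam" using e Lam logn lam by linarith
    hence "real e \<le> real n" using Lam3 Lam1 \<kappa>8 \<kappa>n by linarith
    thus ?thesis by simp
  qed
  define L where "L = nat \<lfloor>\<kappa> / 4\<rfloor>"
  have L: "real L \<le> \<kappa> / 4" "\<kappa> / 4 - 1 \<le> real L"
    using \<kappa>8 unfolding L_def by linarith+
  have Ln: "L \<le> n" using L \<kappa>n \<kappa>8 by linarith
  have spec: "seeded_extractor n (d n k e) (l n k e) (real k) (1 / 2 ^ e) (ES n k e)"
    "real (d n k e) \<le> a * (log 2 (real n * 2 ^ e)) ^ 3"
    "real (l n k e) \<ge> real (d n k e) + real k - 8 * log 2 (real k) - 8 * real e - b"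
    using ES k1 kn e1 unfolding explicit_seeded_extractors_def by blast+
  have d12: "real (d n k e) \<le> \<kappa> / 12"
  proof -
    have lg: "log 2 (real n * 2 ^ e) = log 2 (real n) + e"
      using n by (simp add: log_mult log_nat_power)
    \<comment> \<open>As \<open>Lam\<close> is at least 1, log n + \<open>e\<close> is at most
      \<open>Lam + 2\<close> and so at most \<open>3 * Lam\<close>; the cube gives 27, and 324 is 12
      times 27.\<close>
    have "a * (log 2 (real n * 2 ^ e)) ^ 3 \<le> \<bar>a\<bar> * (3 * Lam) ^ 3"
      unfolding lg using logn e Lam lam by (intro mult_mono power_mono) auto
    also have "\<dots> = 27 * (\<bar>a\<bar> * Lam ^ 3)" by (simp add: power_mult_distrib)
    finally show ?thesis using spec(2) \<kappa> \<kappa>8 Lam1 Lam3 by linarith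
  qed
  have dL: "d n k e \<le> L"
  proof -
    \<comment> \<open>The summand 8 in the constant gives \<kappa> > 8, so \<kappa>/12 is at most
      \<kappa>/4 - 1 and the rounding of \<open>L\<close> does no harm.\<close>
    have "real (d n k e) \<le> real L" using d12 L \<kappa>8 Lam1 Lam3 by linarith
    thus ?thesis by simp
  qed
  have m_le: "real m \<le> (1 - \<delta>) * K + \<kappa> / 6 - 9 * lam - (\<bar>b\<bar> + 18)"
    using m unfolding \<delta>_def K_def \<kappa>_def lam_def by linarith
  have "real m \<le> real (l n k e) + (real L - real (d n k e))"
  proof (cases "\<delta> = 1")
    \<comment> \<open>Only the surplus bits of \<open>E_D\<close> count here: \<open>L\<close> minus
      the seed length is at least \<kappa>/4 - 1 - \<kappa>/12, whence the coefficient 1/6.\<close>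
    case True
    hence "real m \<le> \<kappa> / 6 - 18" using m_le lam by simp
    thus ?thesis using L d12 by linarith
  next
    case False
    hence \<delta>: "\<delta> = 16 * log 2 (real n) / real n" by (simp add: \<delta>_def min_def split: if_splits)
    have "0 \<le> \<delta>" using logn by (simp add: \<delta>)
    hence "\<delta> * (real n / 2) \<le> \<delta> * K" using K by (intro mult_left_mono) auto
    moreover have "\<delta> * (real n / 2) = 8 * log 2 (real n)" using n by (simp add: \<delta>)
    moreover have "log 2 (real k) \<le> log 2 (real n)" using k1 kn by simp
    moreover have "(1 - \<delta>) * K = K - \<delta> * K" by (simp add: algebra_simps)
    \<comment> \<open>The 18 in the constant consists of 16 from \<open>8 * real e\<close>, as
      \<open>e\<close> is at most \<open>lam + 2\<close>, and of 1 each for rounding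
      \<open>K\<close> and \<kappa>/4.\<close>
    ultimately show ?thesis using m_le spec(3) k_bounds e L \<kappa>8 lam by linarith
  qed
  hence ml: "m \<le> l n k e + (L - d n k e)" using dL by linarith
  \<comment> \<open>The seeded extractor is applied to the source with the larger entropy.\<close>
  have "(n, k, e, L, k1 < k2, m) \<in> deor_params d l"
    using k1 kn e1 en dL Ln ml by (simp add: deor_params_def)
  moreover have "two_source_extractor n m k1 k2 \<epsilon> (deor A ES d n k e L (k1 < k2) m)"
  proof (rule deor_two_source_extractor[where \<epsilon>' = "1 / 2 ^ e" and n = n and k = k and e = e and d = d and l = l
      and ES = ES, OF A spec(1) _ dL Ln ml])
    show "real k \<le> (if k1 < k2 then k2 else k1)" using k_bounds by (auto simp: K_def max_def split: if_splits)
    have eps: "2 powr - lam = \<epsilon>" using \<epsilon> by (simp add: lam_def powr_minus log_divide)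
    have "2 ^ L * 2 powr ((real n - k1 - k2) / 2) = 2 powr (real L - \<kappa> / 2)"
      by (simp add: \<kappa>_def powr_realpow[symmetric] powr_add[symmetric] field_simps)
    also have "\<dots> \<le> 2 powr - lam"
      using L \<kappa>8 Lam Lam1 Lam3 logn by (intro powr_mono) linarith+
    finally have 1: "2 ^ L * 2 powr ((real n - k1 - k2) / 2) \<le> \<epsilon>" using eps by simp
    have "1 / 2 ^ e = 2 powr - real e" by (simp add: powr_minus powr_realpow divide_inverse)
    also have "\<dots> \<le> 2 powr (- lam - 1)" using e by (intro powr_mono) auto
    also have "\<dots> = \<epsilon> / 2" using eps by (simp add: powr_diff)
    finally show "2 ^ L * 2 powr ((real n - k1 - k2) / 2) + 2 * (1 / 2 ^ e) \<le> 2 * \<epsilon>" using 1 by simp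
  qed
  ultimately show ?thesis by blast
qed

lemma log_over_tendsto_0: "(\<lambda>n. 16 * log 2 (real n) / real n) \<longlonglongrightarrow> 0"
proof -
  have "(\<lambda>n. 16 / ln 2 * (ln (real n) / real n)) \<longlonglongrightarrow> 16 / ln 2 * 0"
    by (intro tendsto_mult tendsto_const lim_ln_over_n)
  thus ?thesis by (simp add: log_def mult_ac)
qed

text \<open>The constants depend only on \<open>a\<close> and \<open>b\<close>, the constants
  implied in the guarantees of the seeded extractors, and are therefore fixed before the matrices
  and the extractors.\<close>

theorem theorem4:
  fixes a b :: real
  shows "\<exists>C>0. \<exists>c>0. \<exists>\<delta>::nat \<Rightarrow> real.
    (\<forall>n. 0 \<le> \<delta> n \<and> \<delta> n \<le> 1) \<and> \<delta> \<longlonglongrightarrow> 0 \<and>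
    (\<forall>A ES d l. deor_matrices A \<and> explicit_seeded_extractors a b ES d l \<longrightarrow>
       deor_explicit A ES d l \<and>
       (\<forall>(n::nat) (k1::real) (k2::real) (\<epsilon>::real) (m::nat).
          n \<ge> 2 \<and> 0 \<le> k1 \<and> k1 \<le> real n \<and> 0 \<le> k2 \<and> k2 \<le> real n \<and> 0 < \<epsilon> \<and> \<epsilon> < 1 \<and>
          k1 + k2 > real n + C * (log 2 (real n / \<epsilon>)) ^ 3 \<and>
          int m = \<lfloor>(1 - \<delta> n) * max k1 k2 + 1/6 * (k1 + k2 - real n) - 9 * log 2 (1 / \<epsilon>) - c\<rfloor> \<and>
          m \<ge> 1 \<longrightarrow>
          (\<exists>k e L sw. (n, k, e, L, sw, m) \<in> deor_params d l \<and>
             two_source_extractor n m k1 k2 \<epsilon> (deor A ES d n k e L sw m))))"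
proof (rule exI[of _ "324 * \<bar>a\<bar> + 8"], rule conjI[rotated], rule exI[of _ "\<bar>b\<bar> + 18"], rule conjI[rotated],
    rule exI[of _ "\<lambda>n. min 1 (16 * log 2 (real n) / real n)"], intro conjI allI impI)
  let ?\<delta> = "\<lambda>n::nat. min 1 (16 * log 2 (real n) / real n)"
  show "0 < 324 * \<bar>a\<bar> + 8" "0 < \<bar>b\<bar> + 18" by auto
  show "0 \<le> ?\<delta> n" "?\<delta> n \<le> 1" for n
    by (cases "n = 0") auto
  have "?\<delta> \<longlonglongrightarrow> min 1 0"
    by (intro tendsto_min tendsto_const log_over_tendsto_0)
  thus "?\<delta> \<longlonglongrightarrow> 0" by simp
next
  fix A ES d l assume "deor_matrices A \<and> explicit_seeded_extractors a b ES d l"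
  thus "deor_explicit A ES d l" by (blast intro: poly_time_deor)
qed (elim conjE, rule deor_parameters; assumption)

end
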